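(* Let $\pi$ be a set of primes, let $G$ be a finite $\pi'$-soluble group, and let $\mathcal F$ be an $\mathfrak N^\pi$-Fitting set of $G$. Let $K$ be a normal subgroup of $G$ containing the $\mathfrak N^\pi$-residual $G^{\mathfrak N^\pi}$ of $G$, let $W$ be an $\mathcal F$-maximal subgroup of $K$, and let $V$ and $V_1$ be $\mathcal F$-maximal subgroups of $G$ which contain $W$. Then: (a) If $W\unlhd K$, then there exists an $\mathfrak N^\pi$-projector $P$ of $G$ such that $V=(WP)_{\mathcal F}$. (b) In any case (whether or not $W\unlhd K$), $V$ and $V_1$ are conjugate in $\langle V,V_1\rangle$. More precisely, there exists $x\in \langle V,V_1\rangle^{\mathfrak N^\pi}$ such that $V_1^x=V$.
   Context: All groups are finite. $\pi'$ is the complement of $\pi$ in the set of all primes. For a set of primes $\rho$, a group is $\rho$-separable if each of its composition factors is either a $\rho$-group or a $\rho'$-group; it is $\rho$-soluble if it is $\rho$-separable and each composition factor that is a $\rho$-group is a $p$-group for some prime $p\in\rho$. $\mathfrak N^\pi$ is the class of all groups $H\times K$ with $H$ a $\pi$-group and $K$ a nilpotent $\pi'$-group. For a group $X$, the $\mathfrak N^\pi$-residual $X^{\mathfrak N^\pi}$ is the smallest normal subgroup of $X$ whose quotient belongs to $\mathfrak N^\pi$. $O^\pi(X)$ is the smallest normal subgroup of $X$ whose quotient is a $\pi$-group. $\mathfrak N^\pi$-Dnormal subgroups: For a Sylow $p$-subgroup $G_p$ of a group $G$ and $H\le G$, write $G_p\searrow H$ if $G_p\cap H$ is a Sylow $p$-subgroup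 of $H$. A subgroup $H$ of $G$ is $\mathfrak N^\pi$-Dnormal in $G$ if (1) whenever $p\in\pi'$, $G_p\in\mathrm{Syl}_p(G)$ and $G_p\searrow H$, then $G_p\le N_G(H)$; and (2) whenever $p\in\pi$, $G_p\in\mathrm{Syl}_p(G)$ and $G_p\searrow H$, then $G_p\le N_G(H)$ if $\pi=\{p\}$, and $G_p\le N_G(O^\pi(H))$ if $|\pi|\ge 2$. A subgroup $S$ of $G$ is $\mathfrak N^\pi$-Dsubnormal in $G$ if there is a chain $S=S_0\le S_1\le\cdots\le S_k=G$ with $S_i$ $\mathfrak N^\pi$-Dnormal in $S_{i+1}$ for $0\le i\le k-1$. A non-empty set $\mathcal F$ of subgroups of a group $G$ is an $\mathfrak N^\pi$-Fitting set of $G$ if: (FS1) if $T$ is an $\mathfrak N^\pi$-Dsubnormal subgroup of $S\in\mathcal F$, then $T\in\mathcal F$; (FS2) if $S,T\in\mathcal F$ and $S,T$ are $\mathfrak N^\pi$-Dnormal in $\langle S,T\rangle$, then $\langle S,T\rangle\in\mathcal F$; (FS3) if $S\in\mathcal F$ and $x\in G$, then $S^x\in\mathcal F$. For $H\le G$, the $\mathcal F$-radical $H_{\mathcal F}$ is the join of all normal subgroups of $H$ that belong to $\mathcal F$. An $\mathcal F$-maximal subgroup of $H\le G$ is a subgroup of $H$ that is maximal, with respect to inclusion, among the subgroups of $H$ belonging to $\mathcal F$. For a class of groups $\mathfrak X$, a subgroup $U$ of a group $G$ is an $\mathfrak X$-projector of $G$ if, for every $K\unlhd G$, $UK/K$ is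 an $\mathfrak X$-maximal subgroup of $G/K$ (i.e. maximal among the subgroups of $G/K$ belonging to $\mathfrak X$). $A^x=x^{-1}Ax$. *)

theory Defs
  imports "HOL-Algebra.SimpleGroups" "HOL-Algebra.Group_Action" "HOL-Algebra.Generated_Groups"
begin

definition prime_compl :: "nat set \<Rightarrow> nat set" where
  "prime_compl \<pi> = {p. prime p} - \<pi>"

definition pi_group :: "nat set \<Rightarrow> ('a, 'b) monoid_scheme \<Rightarrow> bool" where
  "pi_group \<pi> X \<longleftrightarrow> group X \<and> finite (carrier X) \<and>
     (\<forall>p. prime p \<longrightarrow> p dvd order X \<longrightarrow> p \<in> \<pi>)"

definition composition_series :: "('a, 'b) monoid_scheme \<Rightarrow> nat \<Rightarrow> (nat \<Rightarrow> 'a set) \<Rightarrow> bool" where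
  "composition_series X n S \<longleftrightarrow> S 0 = {\<one>\<^bsub>X\<^esub>} \<and> S n = carrier X \<and>
     (\<forall>i<n. S i \<lhd> X\<lparr>carrier := S (Suc i)\<rparr> \<and>
            simple_group (X\<lparr>carrier := S (Suc i)\<rparr> Mod S i))"

definition composition_factor :: "('a, 'b) monoid_scheme \<Rightarrow> 'a set monoid \<Rightarrow> bool" where
  "composition_factor X Q \<longleftrightarrow>
     (\<exists>n S i. composition_series X n S \<and> i < n \<and> Q = X\<lparr>carrier := S (Suc i)\<rparr> Mod S i)"

definition pi_separable :: "nat set \<Rightarrow> ('a, 'b) monoid_scheme \<Rightarrow> bool" where
  "pi_separable \<rho> X \<longleftrightarrow>
     (\<forall>Q. composition_factor X Q \<longrightarrow> pi_group \<rho> Q \<or> pi_group (prime_compl \<rho>) Q)"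

definition pi_soluble :: "nat set \<Rightarrow> ('a, 'b) monoid_scheme \<Rightarrow> bool" where
  "pi_soluble \<rho> X \<longleftrightarrow> pi_separable \<rho> X \<and>
     (\<forall>Q. composition_factor X Q \<longrightarrow> pi_group \<rho> Q \<longrightarrow> (\<exists>p\<in>\<rho>. prime p \<and> pi_group {p} Q))"

text \<open>Nilpotency is existence of a central series: the commutator condition says that
  \<open>Z (Suc i) / Z i\<close> is contained in the centre of \<open>X / Z i\<close>.\<close>

definition nilpotent_group :: "('a, 'b) monoid_scheme \<Rightarrow> bool" where
  "nilpotent_group X \<longleftrightarrow> group X \<and>
     (\<exists>n Z. Z 0 = {\<one>\<^bsub>X\<^esub>} \<and> Z n = carrier X \<and>
        (\<forall>i<n. Z i \<lhd> X \<and> Z i \<subseteq> Z (Suc i) \<and>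
           (\<forall>x\<in>Z (Suc i). \<forall>g\<in>carrier X.
              x \<otimes>\<^bsub>X\<^esub> g \<otimes>\<^bsub>X\<^esub> inv\<^bsub>X\<^esub> x \<otimes>\<^bsub>X\<^esub> inv\<^bsub>X\<^esub> g \<in> Z i)))"

text \<open>Membership in \<open>\<NN>\<^sup>\<pi>\<close>. Taking the factors over the element type of \<open>X\<close> is no
  restriction, since direct factors of \<open>X\<close> are isomorphic to subgroups of \<open>X\<close>.\<close>

definition npi_group :: "nat set \<Rightarrow> ('a, 'b) monoid_scheme \<Rightarrow> bool" where
  "npi_group \<pi> X \<longleftrightarrow> group X \<and>
     (\<exists>(H :: 'a monoid) (K :: 'a monoid).
        pi_group \<pi> H \<and> pi_group (prime_compl \<pi>) K \<and> nilpotent_group K \<and> X \<cong> H \<times>\<times> K)"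

text \<open>The order on sets is inclusion, so \<open>LEAST\<close> denotes the smallest such normal subgroup.\<close>

definition residual :: "('a set monoid \<Rightarrow> bool) \<Rightarrow> ('a, 'b) monoid_scheme \<Rightarrow> 'a set" where
  "residual \<X> X = (LEAST N. N \<lhd> X \<and> \<X> (X Mod N))"

definition O_upper :: "nat set \<Rightarrow> ('a, 'b) monoid_scheme \<Rightarrow> 'a set" where
  "O_upper \<pi> X = residual (pi_group \<pi>) X"

definition sylow_subgroup :: "nat \<Rightarrow> ('a, 'b) monoid_scheme \<Rightarrow> 'a set \<Rightarrow> bool" where
  "sylow_subgroup p X P \<longleftrightarrow> subgroup P X \<and> card P = p ^ multiplicity p (order X)"

definition reduces_into :: "nat \<Rightarrow> ('a, 'b) monoid_scheme \<Rightarrow> 'a set \<Rightarrow> 'a set \<Rightarrow> bool" where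
  "reduces_into p X P H \<longleftrightarrow> sylow_subgroup p (X\<lparr>carrier := H\<rparr>) (P \<inter> H)"

text \<open>The disjunct \<open>infinite \<pi>\<close> is needed because \<open>card\<close> of an infinite set is \<open>0\<close>.\<close>

definition npi_dnormal :: "nat set \<Rightarrow> ('a, 'b) monoid_scheme \<Rightarrow> 'a set \<Rightarrow> bool" where
  "npi_dnormal \<pi> X H \<longleftrightarrow> subgroup H X \<and>
     (\<forall>p P. p \<in> prime_compl \<pi> \<longrightarrow> sylow_subgroup p X P \<longrightarrow> reduces_into p X P H \<longrightarrow>
        P \<subseteq> normalizer X H) \<and>
     (\<forall>p P. p \<in> \<pi> \<longrightarrow> sylow_subgroup p X P \<longrightarrow> reduces_into p X P H \<longrightarrow>
        (\<pi> = {p} \<longrightarrow> P \<subseteq> normalizer X H) \<and>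
        (infinite \<pi> \<or> card \<pi> \<ge> 2 \<longrightarrow> P \<subseteq> normalizer X (O_upper \<pi> (X\<lparr>carrier := H\<rparr>))))"

definition npi_dsubnormal :: "nat set \<Rightarrow> ('a, 'b) monoid_scheme \<Rightarrow> 'a set \<Rightarrow> bool" where
  "npi_dsubnormal \<pi> X S \<longleftrightarrow>
     (\<exists>k C. C 0 = S \<and> C k = carrier X \<and> (\<forall>i\<le>k. subgroup (C i) X) \<and>
        (\<forall>i<k. npi_dnormal \<pi> (X\<lparr>carrier := C (Suc i)\<rparr>) (C i)))"

text \<open>The conjugate \<open>A\<^sup>x = x\<inverse> A x\<close>.\<close>

definition conj_set :: "('a, 'b) monoid_scheme \<Rightarrow> 'a set \<Rightarrow> 'a \<Rightarrow> 'a set" where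
  "conj_set G A x = (\<lambda>a. inv\<^bsub>G\<^esub> x \<otimes>\<^bsub>G\<^esub> a \<otimes>\<^bsub>G\<^esub> x) ` A"

definition npi_fitting_set :: "nat set \<Rightarrow> ('a, 'b) monoid_scheme \<Rightarrow> 'a set set \<Rightarrow> bool" where
  "npi_fitting_set \<pi> G \<F> \<longleftrightarrow>
     \<F> \<noteq> {} \<and> (\<forall>S\<in>\<F>. subgroup S G) \<and>
     (\<forall>S\<in>\<F>. \<forall>T. npi_dsubnormal \<pi> (G\<lparr>carrier := S\<rparr>) T \<longrightarrow> T \<in> \<F>) \<and>
     (\<forall>S\<in>\<F>. \<forall>T\<in>\<F>.
        npi_dnormal \<pi> (G\<lparr>carrier := generate G (S \<union> T)\<rparr>) S \<longrightarrow>
        npi_dnormal \<pi> (G\<lparr>carrier := generate G (S \<union> T)\<rparr>) T \<longrightarrow>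
        generate G (S \<union> T) \<in> \<F>) \<and>
     (\<forall>S\<in>\<F>. \<forall>x\<in>carrier G. conj_set G S x \<in> \<F>)"

definition radical :: "('a, 'b) monoid_scheme \<Rightarrow> 'a set set \<Rightarrow> 'a set \<Rightarrow> 'a set" where
  "radical G \<F> H = generate G (\<Union>{N \<in> \<F>. N \<lhd> G\<lparr>carrier := H\<rparr>})"

definition F_maximal :: "'a set set \<Rightarrow> 'a set \<Rightarrow> 'a set \<Rightarrow> bool" where
  "F_maximal \<F> H U \<longleftrightarrow> U \<in> \<F> \<and> U \<subseteq> H \<and> (\<forall>L\<in>\<F>. L \<subseteq> H \<longrightarrow> U \<subseteq> L \<longrightarrow> L = U)"

definition class_maximal ::
    "(('a, 'b) monoid_scheme \<Rightarrow> bool) \<Rightarrow> ('a, 'b) monoid_scheme \<Rightarrow> 'a set \<Rightarrow> bool" where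
  "class_maximal \<X> X M \<longleftrightarrow> subgroup M X \<and> \<X> (X\<lparr>carrier := M\<rparr>) \<and>
     (\<forall>L. subgroup L X \<longrightarrow> \<X> (X\<lparr>carrier := L\<rparr>) \<longrightarrow> M \<subseteq> L \<longrightarrow> L = M)"

definition projector ::
    "('a set monoid \<Rightarrow> bool) \<Rightarrow> ('a, 'b) monoid_scheme \<Rightarrow> 'a set \<Rightarrow> bool" where
  "projector \<X> G U \<longleftrightarrow> subgroup U G \<and>
     (\<forall>K. K \<lhd> G \<longrightarrow>
        class_maximal \<X> (G Mod K) (carrier (G\<lparr>carrier := U <#>\<^bsub>G\<^esub> K\<rparr> Mod K)))"

end

theory Submission
  imports Defs "HOL-Algebra.Sylow" "HOL-Algebra.Multiplicative_Group" "HOL-Number_Theory.Cong"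
begin

text \<open>Since \<open>V \<inter> K = W = V\<^sub>1 \<inter> K\<close>, the subgroup \<open>W\<close> is normal in \<open>L = \<langle>V, V\<^sub>1\<rangle>\<close>, so only the case
  of normal \<open>W\<close> matters. There \<open>V\<close> turns out to be the \<open>\<F>\<close>-radical of \<open>W P\<close> for a covering subgroup
  \<open>P\<close> of the normalizer of \<open>V\<close>, because \<open>V P / W\<close> embeds in \<open>V P / V \<times> V P / (V P \<inter> K)\<close> and hence
  lies in \<open>\<NN>\<^sup>\<pi>\<close>. By induction and a Frattini argument the normalizer of \<open>V\<close> supplements the residual
  of \<open>L\<close>, and likewise in every intermediate group; therefore \<open>P\<close> is a covering subgroup of \<open>L\<close>
  itself. Covering subgroups are conjugate under the residual, and so are \<open>V\<close> and \<open>V\<^sub>1\<close>.\<close>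

subsection \<open>Numbers with prescribed prime divisors\<close>

text \<open>The obstacle is the \<pi>-part. In a nilpotent quotient all subgroups are subnormal, so
  closure under normal subgroups and normal joins controls the F-maximal subgroups; a \<pi>-quotient
  has too few normal subgroups for that. Here (FS2) for Dnormal subgroups closes the gap: if a
  subgroup contains all \<pi>'-elements of a group, so do its conjugates there, and if \<pi> has at
  least two elements they are Dnormal in their joins, so that maximality makes them coincide. Hence
  the \<pi>'-part is treated first and a Hall \<pi>-subgroup enters afterwards. Covering subgroups
  require complements in sections whose \<pi>-chief factors may be insoluble. A chief factor S/M
  just below the residual is treated with \<sigma> = {q} if q does not divide its order, where
  Sylow's theorem gives the complements, and with \<sigma> = -{q} if it is an abelian q-group, where
  products over transversals do. A Fitting set consists of subgroups of one fixed group and does not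
  pass to quotients, so sections are handled by preimages and indices inside G.\<close>

definition pi_num :: "nat set \<Rightarrow> nat \<Rightarrow> bool" where
  "pi_num \<sigma> n \<longleftrightarrow> n > 0 \<and> (\<forall>p. prime p \<longrightarrow> p dvd n \<longrightarrow> p \<in> \<sigma>)"

lemma pi_num_1 [simp]: "pi_num \<sigma> (Suc 0)" "pi_num \<sigma> 1"
  by (auto simp: pi_num_def)

lemma pi_num_mult: "pi_num \<sigma> (a * b) \<longleftrightarrow> pi_num \<sigma> a \<and> pi_num \<sigma> b"
  by (auto simp: pi_num_def prime_dvd_mult_iff)

lemma pi_num_dvd: "pi_num \<sigma> n \<Longrightarrow> m dvd n \<Longrightarrow> pi_num \<sigma> m"
  by (auto simp: pi_num_def intro: Nat.gr0I dvd_trans)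

lemma pi_num_mono: "pi_num \<sigma> n \<Longrightarrow> \<sigma> \<subseteq> \<tau> \<Longrightarrow> pi_num \<tau> n"
  by (auto simp: pi_num_def)

text \<open>Complements are taken in the set of all naturals, where complementing twice is the
  identity; only primes are ever tested, so this agrees with the complement in the set of
  primes.\<close>

lemma pi_num_coprime: "pi_num \<sigma> a \<Longrightarrow> pi_num (- \<sigma>) b \<Longrightarrow> coprime a b"
  unfolding pi_num_def
  by (metis ComplD coprime_iff_gcd_eq_1 gcd_dvd1 gcd_dvd2 dvd_trans prime_factor_nat)

lemma pi_num_both: "pi_num \<sigma> a \<Longrightarrow> pi_num (- \<sigma>) a \<Longrightarrow> a = 1"
  using pi_num_coprime[of \<sigma> a a] by simp

lemma pi_num_split: "n > 0 \<Longrightarrow> \<exists>a b. n = a * b \<and> pi_num \<sigma> a \<and> pi_num (- \<sigma>) b"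
proof (induction n rule: less_induct)
  case (less n)
  show ?case
  proof (cases "pi_num (-\<sigma>) n")
    case True
    thus ?thesis by (intro exI[of _ 1] exI[of _ n]) auto
  next
    case False
    then obtain p where p: "prime p" "p dvd n" "p \<in> \<sigma>"
      using less.prems by (auto simp: pi_num_def)
    then obtain m where m: "n = p * m" by blast
    have "m < n" "m > 0" using m p less.prems prime_gt_1_nat[of p] by auto
    then obtain a b where "m = a * b" "pi_num \<sigma> a" "pi_num (-\<sigma>) b" using less.IH by blast
    moreover have "pi_num \<sigma> p" using p primes_dvd_imp_eq by (auto simp: pi_num_def prime_gt_0_nat)
    ultimately show ?thesis using m by (intro exI[of _ "p * a"] exI[of _ b]) (auto simp: pi_num_mult)
  qed
qed

lemma pi_num_prime_power: "prime p \<Longrightarrow> pi_num {p} n \<Longrightarrow> \<exists>k. n = p ^ k"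
proof (induction n rule: less_induct)
  case (less n)
  show ?case
  proof (cases "n = 1")
    case True thus ?thesis by (metis power_0)
  next
    case False
    then obtain q where q: "prime q" "q dvd n" by (metis prime_factor_nat)
    with less.prems have "q = p" by (auto simp: pi_num_def)
    with q obtain m where m: "n = p * m" by blast
    with less.prems have "m < n" "pi_num {p} m" using prime_gt_1_nat[of p]
      by (auto simp: pi_num_def)
    with less obtain k where "m = p ^ k" by blast
    thus ?thesis using m by (metis power_Suc)
  qed
qed

lemma pi_num_power: "prime p \<Longrightarrow> pi_num {p} (p ^ k)"
  by (auto simp: pi_num_def prime_gt_0_nat dest: prime_dvd_power primes_dvd_imp_eq)

text \<open>If x^(a*b) = 1, raising x to such a power k keeps its \<sigma>-part and kills its
  \<sigma>'-part.\<close>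

lemma pi_num_cong_exp:
  assumes "pi_num \<sigma> a" "pi_num (-\<sigma>) b"
  shows "\<exists>k::nat. [k = 1] (mod a) \<and> [k = 0] (mod b)"
  using binary_chinese_remainder_nat[OF pi_num_coprime[OF assms], of 1 0] by blast

subsection \<open>Subgroups and conjugation\<close>

locale fin_group = group G for G (structure) +
  assumes finite_carrier [simp, intro]: "finite (carrier G)"

context group
begin

lemma inv_cancel [simp]:
  "x \<in> carrier G \<Longrightarrow> y \<in> carrier G \<Longrightarrow> inv x \<otimes> (x \<otimes> y) = y"
  "x \<in> carrier G \<Longrightarrow> y \<in> carrier G \<Longrightarrow> x \<otimes> (inv x \<otimes> y) = y"
  by (simp_all add: m_assoc[symmetric])

definition cnj :: "'a \<Rightarrow> 'a \<Rightarrow> 'a" where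
  "cnj x a = inv x \<otimes> a \<otimes> x"

abbreviation cnj_set :: "'a set \<Rightarrow> 'a \<Rightarrow> 'a set" where
  "cnj_set \<equiv> conj_set G"

lemma cnj_set_def: "cnj_set A x = cnj x ` A"
  by (simp add: conj_set_def cnj_def)

lemma cnj_closed [simp, intro]: "x \<in> carrier G \<Longrightarrow> a \<in> carrier G \<Longrightarrow> cnj x a \<in> carrier G"
  by (simp add: cnj_def)

lemma cnj_mult: "x \<in> carrier G \<Longrightarrow> a \<in> carrier G \<Longrightarrow> b \<in> carrier G \<Longrightarrow> cnj x (a \<otimes> b) = cnj x a \<otimes> cnj x b"
  by (simp add: cnj_def m_assoc)

lemma cnj_cnj: "x \<in> carrier G \<Longrightarrow> y \<in> carrier G \<Longrightarrow> a \<in> carrier G \<Longrightarrow> cnj y (cnj x a) = cnj (x \<otimes> y) a"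
  by (simp add: cnj_def m_assoc inv_mult_group)

lemma cnj_one [simp]: "a \<in> carrier G \<Longrightarrow> cnj \<one> a = a" "x \<in> carrier G \<Longrightarrow> cnj x \<one> = \<one>"
  by (simp_all add: cnj_def)

lemma cnj_inv: "x \<in> carrier G \<Longrightarrow> a \<in> carrier G \<Longrightarrow> cnj x (inv a) = inv (cnj x a)"
  by (simp add: cnj_def m_assoc inv_mult_group)

lemma cnj_inv_cancel [simp]:
  "x \<in> carrier G \<Longrightarrow> a \<in> carrier G \<Longrightarrow> cnj (inv x) (cnj x a) = a"
  "x \<in> carrier G \<Longrightarrow> a \<in> carrier G \<Longrightarrow> cnj x (cnj (inv x) a) = a"
  by (simp_all add: cnj_cnj)

lemma cnj_pow: "x \<in> carrier G \<Longrightarrow> a \<in> carrier G \<Longrightarrow> cnj x (a [^] (n::nat)) = cnj x a [^] n"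
  by (induction n) (simp_all add: cnj_mult)

lemma inj_cnj: "x \<in> carrier G \<Longrightarrow> A \<subseteq> carrier G \<Longrightarrow> inj_on (cnj x) A"
  by (rule inj_on_inverseI[of _ "cnj (inv x)"]) auto

lemma card_cnj_set: "x \<in> carrier G \<Longrightarrow> A \<subseteq> carrier G \<Longrightarrow> card (cnj_set A x) = card A"
  by (simp add: cnj_set_def card_image inj_cnj)

lemma cnj_set_cnj_set: "x \<in> carrier G \<Longrightarrow> y \<in> carrier G \<Longrightarrow> A \<subseteq> carrier G \<Longrightarrow> cnj_set (cnj_set A x) y = cnj_set A (x \<otimes> y)"
  by (auto simp: cnj_set_def image_image intro!: image_cong cnj_cnj)

lemma cnj_set_one [simp]: "A \<subseteq> carrier G \<Longrightarrow> cnj_set A \<one> = A"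
  by (force simp: cnj_set_def)

lemma cnj_set_mono: "A \<subseteq> B \<Longrightarrow> cnj_set A x \<subseteq> cnj_set B x"
  by (auto simp: cnj_set_def)

lemma cnj_set_carrier: "x \<in> carrier G \<Longrightarrow> A \<subseteq> carrier G \<Longrightarrow> cnj_set A x \<subseteq> carrier G"
  by (auto simp: cnj_set_def)

lemma cnj_set_inv_cancel [simp]: "x \<in> carrier G \<Longrightarrow> A \<subseteq> carrier G \<Longrightarrow> cnj_set (cnj_set A x) (inv x) = A"
  "x \<in> carrier G \<Longrightarrow> A \<subseteq> carrier G \<Longrightarrow> cnj_set (cnj_set A (inv x)) x = A"
  by (simp_all add: cnj_set_cnj_set)

lemma cnj_set_self: "subgroup L G \<Longrightarrow> x \<in> L \<Longrightarrow> cnj_set L x = L"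
proof -
  assume L: "subgroup L G" and x: "x \<in> L"
  have *: "cnj_set L y \<subseteq> L" if "y \<in> L" for y
    using that L by (auto simp: cnj_set_def cnj_def subgroup.m_closed subgroup.m_inv_closed)
  have "x \<in> carrier G" "L \<subseteq> carrier G" using L x subgroup.subset by auto
  with *[OF x] cnj_set_mono[OF *[of "inv x"], of x] x L show ?thesis
    by (simp add: subgroup.m_inv_closed)
qed

lemma subgroup_cnj_set: assumes "subgroup A G" "x \<in> carrier G" shows "subgroup (cnj_set A x) G"
proof (rule subgroupI)
  have A: "A \<subseteq> carrier G" using assms subgroup.subset by auto
  show "cnj_set A x \<subseteq> carrier G" using assms A cnj_set_carrier by auto
  show "cnj_set A x \<noteq> {}" using assms subgroup.one_closed by (fastforce simp: cnj_set_def)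
  show "inv a \<in> cnj_set A x" if "a \<in> cnj_set A x" for a
    using that assms A subgroup.m_inv_closed[OF assms(1)] by (force simp: cnj_set_def cnj_inv[symmetric])
  show "a \<otimes> b \<in> cnj_set A x" if "a \<in> cnj_set A x" "b \<in> cnj_set A x" for a b
    using that assms A subgroup.m_closed[OF assms(1)]
    by (auto simp: cnj_set_def subset_iff cnj_mult[symmetric])
qed

lemma cnj_set_Int: "x \<in> carrier G \<Longrightarrow> A \<subseteq> carrier G \<Longrightarrow> B \<subseteq> carrier G \<Longrightarrow> cnj_set (A \<inter> B) x = cnj_set A x \<inter> cnj_set B x"
  unfolding cnj_set_def by (rule inj_on_image_Int[of _ "carrier G"]) (auto simp: inj_cnj)

lemma mem_set_mult: "x \<in> A <#> B \<longleftrightarrow> (\<exists>a\<in>A. \<exists>b\<in>B. x = a \<otimes> b)"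
  by (auto simp: set_mult_def)

lemma set_multI: "a \<in> A \<Longrightarrow> b \<in> B \<Longrightarrow> a \<otimes> b \<in> A <#> B"
  by (auto simp: set_mult_def)

lemma set_multE: assumes "x \<in> A <#> B" obtains a b where "a \<in> A" "b \<in> B" "x = a \<otimes> b"
  using assms by (auto simp: set_mult_def)

lemma cnj_set_set_mult: "x \<in> carrier G \<Longrightarrow> A \<subseteq> carrier G \<Longrightarrow> B \<subseteq> carrier G \<Longrightarrow>
   cnj_set (A <#> B) x = cnj_set A x <#> cnj_set B x"
proof -
  assume c: "x \<in> carrier G" "A \<subseteq> carrier G" "B \<subseteq> carrier G"
  have m: "cnj x (a \<otimes> b) = cnj x a \<otimes> cnj x b" if "a \<in> A" "b \<in> B" for a b
    using c that by (intro cnj_mult) auto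
  show ?thesis
  proof
    show "cnj_set (A <#> B) x \<subseteq> cnj_set A x <#> cnj_set B x"
      using m by (auto simp: cnj_set_def elim!: set_multE intro!: set_multI)
    show "cnj_set A x <#> cnj_set B x \<subseteq> cnj_set (A <#> B) x"
    proof
      fix y assume "y \<in> cnj_set A x <#> cnj_set B x"
      then obtain a b where "a \<in> A" "b \<in> B" "y = cnj x a \<otimes> cnj x b"
        by (auto simp: cnj_set_def elim!: set_multE)
      thus "y \<in> cnj_set (A <#> B) x" using m[of a b] unfolding cnj_set_def
        by (intro image_eqI[of _ _ "a \<otimes> b"] set_multI) auto
    qed
  qed
qed

lemma cnj_set_generate:
  assumes "x \<in> carrier G" "A \<subseteq> carrier G"
  shows "cnj_set (generate G A) x = generate G (cnj_set A x)"
proof -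
  have *: "cnj_set (generate G A) x \<subseteq> generate G (cnj_set A x)" if "x \<in> carrier G" "A \<subseteq> carrier G" for x A
  proof -
    have "cnj x a \<in> generate G (cnj_set A x)" if "a \<in> generate G A" for a
      using that
    proof induction
      case one thus ?case using \<open>x \<in> carrier G\<close> by (simp add: generate.one)
    next
      case (incl h) thus ?case by (auto simp: cnj_set_def intro: generate.incl)
    next
      case (inv h) thus ?case using \<open>x \<in> carrier G\<close> \<open>A \<subseteq> carrier G\<close>
        by (auto simp: cnj_set_def cnj_inv subset_iff intro: generate.inv)
    next
      case (eng h1 h2) thus ?case using \<open>x \<in> carrier G\<close> \<open>A \<subseteq> carrier G\<close>
        by (auto simp: cnj_mult generate_in_carrier intro: generate.eng)
    qed
    thus ?thesis by (auto simp: cnj_set_def)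
  qed
  have "generate G (cnj_set A x) \<subseteq> cnj_set (cnj_set (generate G (cnj_set A x)) (inv x)) x"
    using assms by (simp add: generate_incl cnj_set_carrier)
  also have "\<dots> \<subseteq> cnj_set (generate G (cnj_set (cnj_set A x) (inv x))) x"
    using assms by (intro cnj_set_mono *) (auto simp: cnj_set_carrier)
  also have "\<dots> = cnj_set (generate G A) x" using assms by simp
  finally show ?thesis using *[OF assms] by blast
qed

text \<open>Normality is kept relative to an ambient subgroup; \<open>normal_in N L\<close> is \<open>N \<lhd> L\<close>.\<close>

definition normal_in :: "'a set \<Rightarrow> 'a set \<Rightarrow> bool" where
  "normal_in N L \<longleftrightarrow> subgroup N G \<and> subgroup L G \<and> N \<subseteq> L \<and> (\<forall>x\<in>L. cnj_set N x = N)"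

text \<open>Applying the containment to \<open>inv x\<close> and conjugating by \<open>x\<close>
  gives the reverse containment.\<close>

lemma nrmI:
  assumes "subgroup N G" "subgroup L G" "N \<subseteq> L" "\<And>x. x \<in> L \<Longrightarrow> cnj_set N x \<subseteq> N"
  shows "normal_in N L"
proof -
  have "cnj_set N x = N" if x: "x \<in> L" for x
  proof -
    have c: "x \<in> carrier G" "N \<subseteq> carrier G" "inv x \<in> L"
      using x assms subgroup.subset[OF assms(1)] subgroup.subset[OF assms(2)]
      by (auto simp: subgroup.m_inv_closed)
    show ?thesis using assms(4)[OF x] cnj_set_mono[OF assms(4)[OF c(3)], of x] c by simp
  qed
  thus ?thesis using assms by (auto simp: normal_in_def)
qed

lemma normal_in_subgroup: "normal_in N L \<Longrightarrow> subgroup N G" "normal_in N L \<Longrightarrow> subgroup L G"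
  "normal_in N L \<Longrightarrow> N \<subseteq> L"
  by (auto simp: normal_in_def)

lemma normal_in_cnj_set: "normal_in N L \<Longrightarrow> x \<in> L \<Longrightarrow> cnj_set N x = N"
  by (auto simp: normal_in_def)

lemma normal_in_cnj: "normal_in N L \<Longrightarrow> x \<in> L \<Longrightarrow> n \<in> N \<Longrightarrow> cnj x n \<in> N"
  unfolding normal_in_def cnj_set_def by blast

lemma sub_carr: "subgroup H G \<Longrightarrow> x \<in> H \<Longrightarrow> x \<in> carrier G"
  by (rule subgroup.mem_carrier)

lemma normal_iff_normal_in:
  assumes L: "subgroup L G"
  shows "N \<lhd> G\<lparr>carrier := L\<rparr> \<longleftrightarrow> normal_in N L"
proof -
  interpret L: group "G\<lparr>carrier := L\<rparr>" using L by (simp add: subgroup_imp_group)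
  have inv: "inv\<^bsub>G\<lparr>carrier := L\<rparr>\<^esub> x = inv x" if "x \<in> L" for x
    using that L by (simp add: m_inv_consistent)
  show ?thesis
  proof
    assume N: "N \<lhd> G\<lparr>carrier := L\<rparr>"
    hence sN: "subgroup N (G\<lparr>carrier := L\<rparr>)" by (rule normal_imp_subgroup)
    hence "subgroup N G" "N \<subseteq> L" using incl_subgroup[OF L] subgroup.subset by fastforce+
    moreover have "cnj_set N x \<subseteq> N" if "x \<in> L" for x
      using normal.inv_op_closed1[OF N, of x] that by (auto simp: cnj_set_def cnj_def inv)
    ultimately show "normal_in N L" using L by (intro nrmI)
  next
    assume N: "normal_in N L"
    show "N \<lhd> G\<lparr>carrier := L\<rparr>"
    proof (rule L.normal_invI)
      show "subgroup N (G\<lparr>carrier := L\<rparr>)" using N L by (auto simp: normal_in_def intro: subgroup_incl)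
      fix x h assume x: "x \<in> carrier (G\<lparr>carrier := L\<rparr>)" "h \<in> N"
      hence "cnj (inv x) h \<in> N" using normal_in_cnj[OF N, of "inv x"] L by (simp add: subgroup.m_inv_closed)
      thus "x \<otimes>\<^bsub>G\<lparr>carrier := L\<rparr>\<^esub> h \<otimes>\<^bsub>G\<lparr>carrier := L\<rparr>\<^esub> inv\<^bsub>G\<lparr>carrier := L\<rparr>\<^esub> x \<in> N"
        using x L by (simp add: inv cnj_def sub_carr)
    qed
  qed
qed

lemma normal_iff_normal_in_carrier: "N \<lhd> G \<longleftrightarrow> normal_in N (carrier G)"
  using normal_iff_normal_in[OF subgroup_self, of N] by simp

lemma normal_in_sub: "normal_in N L \<Longrightarrow> subgroup A G \<Longrightarrow> N \<subseteq> A \<Longrightarrow> A \<subseteq> L \<Longrightarrow> normal_in N A"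
  by (auto simp: normal_in_def)

lemma normal_in_Int: "normal_in N L \<Longrightarrow> subgroup A G \<Longrightarrow> A \<subseteq> L \<Longrightarrow> normal_in (N \<inter> A) A"
proof -
  assume a: "normal_in N L" "subgroup A G" "A \<subseteq> L"
  have "cnj_set (N \<inter> A) x \<subseteq> N \<inter> A" if "x \<in> A" for x
  proof -
    have "cnj_set (N \<inter> A) x \<subseteq> cnj_set N x" "cnj_set (N \<inter> A) x \<subseteq> cnj_set A x" by (auto intro!: cnj_set_mono)
    thus ?thesis using that a normal_in_cnj_set[of N L x] cnj_set_self[of A x] by blast
  qed
  thus ?thesis using a by (intro nrmI subgroups_Inter_pair) (auto simp: normal_in_def)
qed

lemma normal_in_self: "subgroup L G \<Longrightarrow> normal_in L L"
  by (auto simp: normal_in_def cnj_set_self)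

lemma normal_in_one: "subgroup L G \<Longrightarrow> normal_in {\<one>} L"
  by (intro nrmI triv_subgroup) (auto simp: subgroup.one_closed cnj_set_def sub_carr)

lemma normal_in_cnj_set_cnj_set:
  assumes "normal_in N L" "x \<in> carrier G" shows "normal_in (cnj_set N x) (cnj_set L x)"
proof (rule nrmI)
  show "subgroup (cnj_set N x) G" "subgroup (cnj_set L x) G" "cnj_set N x \<subseteq> cnj_set L x"
    using assms cnj_set_mono[of N L x] by (auto simp: normal_in_def intro: subgroup_cnj_set)
  fix z assume "z \<in> cnj_set L x"
  then obtain y where y: "y \<in> L" "z = cnj x y" by (auto simp: cnj_set_def)
  have c: "y \<in> carrier G" "N \<subseteq> carrier G"
    using y assms by (auto simp: normal_in_def sub_carr subgroup.subset dest!: subgroup.subset)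
  have "cnj_set (cnj_set N x) z = cnj_set (cnj_set N y) x"
    using c assms y by (simp add: cnj_set_cnj_set cnj_def m_assoc)
  thus "cnj_set (cnj_set N x) z \<subseteq> cnj_set N x" using normal_in_cnj_set[OF assms(1) y(1)] by simp
qed

definition normalizer_in :: "'a set \<Rightarrow> 'a set \<Rightarrow> 'a set" where
  "normalizer_in L A = {x \<in> L. cnj_set A x = A}"

lemma subgroup_normalizer_in: assumes "subgroup L G" "A \<subseteq> carrier G" shows "subgroup (normalizer_in L A) G"
proof (rule subgroupI)
  show "normalizer_in L A \<subseteq> carrier G" using assms subgroup.subset by (auto simp: normalizer_in_def)
  show "normalizer_in L A \<noteq> {}" using assms subgroup.one_closed by (force simp: normalizer_in_def)
  fix a assume a: "a \<in> normalizer_in L A"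
  hence *: "a \<in> carrier G" "cnj_set A a = A" "a \<in> L" "inv a \<in> L"
    using assms by (auto simp: normalizer_in_def sub_carr subgroup.m_inv_closed)
  hence "cnj_set (cnj_set A a) (inv a) = A" using assms(2) by (intro cnj_set_inv_cancel)
  with * have "cnj_set A (inv a) = A" by simp
  with *
show "inv a \<in> normalizer_in L A" by (auto simp: normalizer_in_def)
  fix b assume b: "b \<in> normalizer_in L A"
  show "a \<otimes> b \<in> normalizer_in L A" using a b assms
    by (auto simp: normalizer_in_def sub_carr subgroup.m_closed cnj_set_cnj_set[symmetric])
qed

lemma normalizer_in_sub: "normalizer_in L A \<subseteq> L" by (auto simp: normalizer_in_def)

lemma normal_in_normalizer_in: "subgroup L G \<Longrightarrow> subgroup A G \<Longrightarrow> A \<subseteq> L \<Longrightarrow> normal_in A (normalizer_in L A)"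
  using subgroup_normalizer_in[of L A] by (auto simp: normal_in_def normalizer_in_def subgroup.subset cnj_set_self)

lemma join_sub:
  assumes A: "subgroup A G" and B: "subgroup B G" and nb: "\<And>b. b \<in> B \<Longrightarrow> cnj_set A b \<subseteq> A"
  shows "subgroup (A <#> B) G" "B <#> A = A <#> B" "A \<subseteq> A <#> B" "B \<subseteq> A <#> B"
proof -
  have c: "A \<subseteq> carrier G" "B \<subseteq> carrier G" using A B subgroup.subset by auto
  have ab: "b \<otimes> a \<in> A <#> B" if "a \<in> A" "b \<in> B" for a b
  proof -
    have "cnj (inv b) a \<in> A" using nb[of "inv b"] that B by (auto simp: cnj_set_def subgroup.m_inv_closed)
    moreover have "b \<otimes> a = cnj (inv b) a \<otimes> b"
      using that c by (auto simp: cnj_def m_assoc subset_iff)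
    ultimately show ?thesis using that by (auto simp: mem_set_mult)
  qed
  have ba: "a \<otimes> b \<in> B <#> A" if "a \<in> A" "b \<in> B" for a b
  proof -
    have "cnj b a \<in> A" using nb[of "b"] that by (auto simp: cnj_set_def)
    moreover have "a \<otimes> b = b \<otimes> cnj b a"
      using that c by (auto simp: cnj_def m_assoc subset_iff)
    ultimately show ?thesis using that by (auto simp: mem_set_mult)
  qed
  show eq: "B <#> A = A <#> B" using ab ba by (auto simp: mem_set_mult)
  show "A \<subseteq> A <#> B" using c B subgroup.one_closed[OF B] by (force simp: mem_set_mult)
  show "B \<subseteq> A <#> B" using c subgroup.one_closed[OF A] by (force simp: mem_set_mult)
  show "subgroup (A <#> B) G"
  proof (rule subgroupI)
    show "A <#> B \<subseteq> carrier G" using c by (rule setmult_subset_G)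
    show "A <#> B \<noteq> {}" using A B subgroup.one_closed by (fastforce simp: set_mult_def)
    show "inv x \<in> A <#> B" if "x \<in> A <#> B" for x
    proof -
      from that obtain a b where x: "a \<in> A" "b \<in> B" "x = a \<otimes> b" by (auto simp: mem_set_mult)
      hence "inv x = inv b \<otimes> inv a" using c by (auto simp: inv_mult_group subset_iff)
      thus ?thesis using ab[of "inv a" "inv b"] x A B by (auto simp: subgroup.m_inv_closed)
    qed
    show "x \<otimes> y \<in> A <#> B" if "x \<in> A <#> B" "y \<in> A <#> B" for x y
    proof -
      from that obtain a b where x: "a \<in> A" "b \<in> B" "x = a \<otimes> b" by (auto simp: mem_set_mult)
      from that obtain a' b' where y: "a' \<in> A" "b' \<in> B" "y = a' \<otimes> b'" by (auto simp: mem_set_mult)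
      from ab[OF y(1) x(2)] obtain a1 b1 where z: "a1 \<in> A" "b1 \<in> B" "b \<otimes> a' = a1 \<otimes> b1"
        by (auto simp: mem_set_mult)
      have "x \<otimes> y = a \<otimes> (b \<otimes> a') \<otimes> b'" using x y c by (simp add: m_assoc subset_iff)
      also have "\<dots> = (a \<otimes> a1) \<otimes> (b1 \<otimes> b')" using x y z c by (simp add: m_assoc subset_iff)
      finally show ?thesis using x y z A B by (simp add: set_multI subgroup.m_closed)
    qed
  qed
qed

lemma set_mult_least: "subgroup C G \<Longrightarrow> A \<subseteq> C \<Longrightarrow> B \<subseteq> C \<Longrightarrow> A <#> B \<subseteq> C"
  by (auto simp: mem_set_mult subset_iff subgroup.m_closed)

lemma normal_in_join:
  assumes "normal_in N L" "subgroup A G" "A \<subseteq> L"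
  shows "subgroup (N <#> A) G" "A <#> N = N <#> A" "N \<subseteq> N <#> A" "A \<subseteq> N <#> A" "N <#> A \<subseteq> L"
  "normal_in N (N <#> A)"
proof -
  have N: "subgroup N G" and *: "\<And>b. b \<in> A \<Longrightarrow> cnj_set N b \<subseteq> N" using assms by (auto simp: normal_in_def)
  show "subgroup (N <#> A) G" "A <#> N = N <#> A" "N \<subseteq> N <#> A" "A \<subseteq> N <#> A"
    using join_sub[OF N assms(2) *] by auto
  show s: "N <#> A \<subseteq> L" using assms by (intro set_mult_least) (auto simp: normal_in_def)
  show "normal_in N (N <#> A)" using \<open>subgroup (N <#> A) G\<close> s assms
    by (intro normal_in_sub[OF assms(1)]) (auto simp: \<open>N \<subseteq> N <#> A\<close>)
qed

lemma normal_in_normal_in_join: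
  assumes "normal_in N L" "normal_in A L" shows "normal_in (N <#> A) L"
proof -
  have A: "subgroup A G" "A \<subseteq> L" "N \<subseteq> carrier G" "A \<subseteq> carrier G" "L \<subseteq> carrier G"
    using assms by (auto simp: normal_in_def subgroup.subset dest!: subgroup.subset)
  note j = normal_in_join[OF assms(1) A(1,2)]
  show ?thesis
  proof (rule nrmI[OF j(1) _ j(5)])
    show "subgroup L G" using assms by (auto simp: normal_in_def)
    fix x assume "x \<in> L"
    thus "cnj_set (N <#> A) x \<subseteq> N <#> A"
      using assms A by (auto simp: cnj_set_set_mult normal_in_cnj_set)
  qed
qed

lemma dedekind:
  assumes "subgroup A G" "subgroup C G" "A \<subseteq> C" "B \<subseteq> carrier G"
  shows "C \<inter> (A <#> B) = A <#> (C \<inter> B)"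
proof
  show "C \<inter> (A <#> B) \<subseteq> A <#> (C \<inter> B)"
  proof
    fix x assume "x \<in> C \<inter> (A <#> B)"
    then obtain a b where ab: "a \<in> A" "b \<in> B" "x = a \<otimes> b" "x \<in> C" by (auto simp: mem_set_mult)
    have "b = inv a \<otimes> x" using ab assms by (auto simp: sub_carr subset_iff)
    moreover have "inv a \<otimes> x \<in> C" using ab assms
      by (intro subgroup.m_closed subgroup.m_inv_closed) auto
    ultimately have "b \<in> C" by simp
    thus "x \<in> A <#> (C \<inter> B)" using ab by (auto simp: mem_set_mult)
  qed
  show "A <#> (C \<inter> B) \<subseteq> C \<inter> (A <#> B)"
    using assms by (auto simp: mem_set_mult subset_iff subgroup.m_closed)
qed

lemma generate_join:
  assumes "subgroup A G" "subgroup B G" "A <#> B = B <#> A \<or> subgroup (A <#> B) G"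
    "subgroup (A <#> B) G"
  shows "generate G (A \<union> B) = A <#> B"
proof
  have c: "A \<subseteq> carrier G" "B \<subseteq> carrier G" using assms subgroup.subset by auto
  show "generate G (A \<union> B) \<subseteq> A <#> B"
  proof (rule generate_subgroup_incl[OF _ assms(4)])
    show "A \<union> B \<subseteq> A <#> B" using c assms(1,2)[THEN subgroup.one_closed]
      by (force simp: mem_set_mult)
  qed
  show "A <#> B \<subseteq> generate G (A \<union> B)"
    using c by (intro set_mult_least generate_is_subgroup) (auto intro: generate.incl)
qed

end

section \<open>Orders and indices of subgroups\<close>

context fin_group
begin

lemma fin_sub [simp]: "subgroup H G \<Longrightarrow> finite H"
  using finite_carrier finite_subset subgroup.subset by blast

lemma card_sub_pos: "subgroup H G \<Longrightarrow> card H > 0"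
  using subgroup.one_closed[of H G] by (auto simp: card_gt_0_iff)

lemma card_dvd: "subgroup A G \<Longrightarrow> subgroup B G \<Longrightarrow> A \<subseteq> B \<Longrightarrow> card A dvd card B"
proof -
  assume a: "subgroup A G" "subgroup B G" "A \<subseteq> B"
  interpret B: group "G\<lparr>carrier := B\<rparr>" using a by (simp add: subgroup_imp_group)
  have "subgroup A (G\<lparr>carrier := B\<rparr>)" using a by (simp add: subgroup_incl)
  from B.lagrange[OF this] show ?thesis by (auto simp: order_def) (metis dvd_triv_right)
qed

text \<open>Natural division, exact by Lagrange when A is a subgroup of B. For normal A it is the
  order of B/A, available without forming the quotient.\<close>

definition index :: "'a set \<Rightarrow> 'a set \<Rightarrow> nat" where
  "index B A = card B div card A"

lemma index_mult: "subgroup A G \<Longrightarrow> subgroup B G \<Longrightarrow> A \<subseteq> B \<Longrightarrow> card B = index B A * card A"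
  using card_dvd[of A B] by (simp add: index_def)

lemma index_pos: "subgroup A G \<Longrightarrow> subgroup B G \<Longrightarrow> A \<subseteq> B \<Longrightarrow> index B A > 0"
  using index_mult[of A B] card_sub_pos[of B] by (auto intro: Nat.gr0I)

lemma index_trans: "subgroup A G \<Longrightarrow> subgroup B G \<Longrightarrow> subgroup C G \<Longrightarrow> A \<subseteq> B \<Longrightarrow> B \<subseteq> C \<Longrightarrow>
    index C A = index C B * index B A"
  using index_mult[of A B] index_mult[of B C] card_sub_pos[of A]
  by (metis index_def mult.assoc nonzero_mult_div_cancel_right not_gr0)

lemma index_1: "subgroup A G \<Longrightarrow> subgroup B G \<Longrightarrow> A \<subseteq> B \<Longrightarrow> index B A = 1 \<Longrightarrow> A = B"
  using index_mult[of A B] by (simp add: card_subset_eq)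

lemma index_self: "subgroup A G \<Longrightarrow> index A A = 1"
  using card_sub_pos[of A] unfolding index_def by (metis div_self not_gr0)

text \<open>Double counting of pairs: the fibre of the multiplication over
  \<open>a \<otimes> b\<close> is parametrised by d in \<open>A \<inter> B\<close> through the pairs
  \<open>(a \<otimes> d, inv d \<otimes> b)\<close>.\<close>

lemma card_set_mult:
  assumes A: "subgroup A G" and B: "subgroup B G"
  shows "card (A <#> B) * card (A \<inter> B) = card A * card B"
proof -
  have c: "A \<subseteq> carrier G" "B \<subseteq> carrier G" using A B subgroup.subset by auto
  let ?f = "\<lambda>(a, b). a \<otimes> b"
  have im: "?f ` (A \<times> B) = A <#> B" by (force simp: set_mult_def)
  have fib: "card {ab \<in> A \<times> B. ?f ab = x} = card (A \<inter> B)" if "x \<in> A <#> B" for x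
  proof -
    from that obtain a b where x: "a \<in> A" "b \<in> B" "x = a \<otimes> b" by (auto simp: mem_set_mult)
    have cc: "a \<in> carrier G" "b \<in> carrier G" using x c by auto
    have "bij_betw (\<lambda>d. (a \<otimes> d, inv d \<otimes> b)) (A \<inter> B) {ab \<in> A \<times> B. ?f ab = x}"
    proof (rule bij_betwI[where g = "\<lambda>(a', b'). inv a \<otimes> a'"])
      show "(\<lambda>d. (a \<otimes> d, inv d \<otimes> b)) \<in> A \<inter> B \<rightarrow> {ab \<in> A \<times> B. ?f ab = x}"
      proof safe
        fix d assume d: "d \<in> A" "d \<in> B"
        show "a \<otimes> d \<in> A" "inv d \<otimes> b \<in> B"
          using x A B d by (simp_all add: subgroup.m_closed subgroup.m_inv_closed)
        have "d \<in> carrier G" using d c by auto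
        thus "a \<otimes> d \<otimes> (inv d \<otimes> b) = x" using cc x by (simp add: m_assoc)
      qed
      have "inv a \<otimes> a' \<in> B" if "a' \<in> A" "b' \<in> B" "a' \<otimes> b' = a \<otimes> b" for a' b'
      proof -
        have c': "a' \<in> carrier G" "b' \<in> carrier G" using that c by auto
        have "inv a \<otimes> a' = inv a \<otimes> (a' \<otimes> b') \<otimes> inv b'" using c' cc by (simp add: m_assoc)
        also have "\<dots> = b \<otimes> inv b'" using c' cc that(3) by (simp add: m_assoc)
        finally have "inv a \<otimes> a' = b \<otimes> inv b'" .
        thus ?thesis using x that B by (auto simp: subgroup.m_closed subgroup.m_inv_closed)
      qed
      thus "(\<lambda>(a', b'). inv a \<otimes> a') \<in> {ab \<in> A \<times> B. ?f ab = x} \<rightarrow> A \<inter> B"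
        using x A by (auto simp: subgroup.m_closed subgroup.m_inv_closed)
      show "(\<lambda>(a', b'). inv a \<otimes> a') (a \<otimes> d, inv d \<otimes> b) = d" if "d \<in> A \<inter> B" for d
        using that c cc by auto
      show "(\<lambda>d. (a \<otimes> d, inv d \<otimes> b)) ((\<lambda>(a', b'). inv a \<otimes> a') p) = p"
        if "p \<in> {ab \<in> A \<times> B. ?f ab = x}" for p
      proof -
        obtain a' b' where p: "p = (a', b')" "a' \<in> A" "b' \<in> B" "a' \<otimes> b' = a \<otimes> b" 
          using \<open>p \<in> _\<close> x by (cases p) auto
        have c': "a' \<in> carrier G" "b' \<in> carrier G" using p c by auto
        have "b' = inv a' \<otimes> (a \<otimes> b)" using p(4) c' by (metis inv_cancel(1))
        thus ?thesis using p(1) cc c' by (simp add: inv_mult_group m_assoc)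
      qed
    qed
    from bij_betw_same_card[OF this] show ?thesis by simp
  qed
  have "card (A \<times> B) = (\<Sum>x\<in>A <#> B. card {ab \<in> A \<times> B. ?f ab = x})"
  proof -
    have "(\<Sum>ab\<in>A \<times> B. card {x \<in> A <#> B. ?f ab = x}) = (\<Sum>x\<in>A <#> B. card {ab \<in> A \<times> B. ?f ab = x})"
      using A B im by (intro sum_multicount_gen) (auto simp flip: im)
    moreover have "{x \<in> A <#> B. ?f ab = x} = {?f ab}" if "ab \<in> A \<times> B" for ab
      using that im by auto
    ultimately show ?thesis by simp
  qed
  thus ?thesis using fib by (simp add: card_cartesian_product mult.commute)
qed

end

subsection \<open>Fixed points of p-groups and Sylow subgroups\<close>

text \<open>Turns a number of fixed points divisible by q, together with one obvious fixed point,
  into a second fixed point.\<close>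

lemma ex_other_elem:
  assumes "finite A" "a \<in> A" "prime q" "q dvd card A"
  shows "\<exists>b\<in>A. b \<noteq> a"
proof (rule ccontr)
  assume "\<not> ?thesis"
  hence "A = {a}" using assms(2) by blast
  hence "card A = 1" by simp
  thus False using assms(3,4) by simp
qed

text \<open>Orbit sizes divide p^k, so every orbit that is not a singleton has size divisible by p;
  the singleton orbits are the fixed points.\<close>

lemma (in group_action) p_group_fixed:
  assumes E: "finite E" and p: "prime p" and ord: "order G = p ^ k"
  shows "[card E = card {x \<in> E. \<forall>g\<in>carrier G. \<phi> g x = x}] (mod p)"
proof -
  interpret group G using group_hom group_hom.axioms(1) by auto
  let ?F = "{x \<in> E. \<forall>g\<in>carrier G. \<phi> g x = x}"
  let ?pi_hull = "orbits G E \<phi>"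
  have UO: "\<Union>?pi_hull = E" using orbits_coverture by blast
  have finO: "finite ?pi_hull" using E by (auto simp: orbits_def)
  have sub: "Ob \<subseteq> E" if "Ob \<in> ?pi_hull" for Ob using that UO by blast
  have orb: "Ob = orbit G \<phi> x" if "Ob \<in> ?pi_hull" "x \<in> Ob" for Ob x
  proof -
    obtain y where y: "y \<in> E" "Ob = orbit G \<phi> y" using \<open>Ob \<in> ?pi_hull\<close> by (auto simp: orbits_def)
    have "x \<in> E" using that sub by blast
    moreover have "x \<in> Ob \<inter> orbit G \<phi> x" using that orbit_refl[OF \<open>x \<in> E\<close>] by blast
    moreover have "orbit G \<phi> x \<in> ?pi_hull" using \<open>x \<in> E\<close> by (auto simp: orbits_def)
    ultimately show ?thesis using disjoint_union[of Ob "orbit G \<phi> x"] that by blast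
  qed
  have cd: "p dvd card Ob" if "Ob \<in> ?pi_hull" "card Ob \<noteq> 1" for Ob
  proof -
    from that obtain x where x: "x \<in> E" "Ob = orbit G \<phi> x" by (auto simp: orbits_def)
    have "card Ob * card (stabilizer G \<phi> x) = p ^ k"
      using orbit_stabilizer_theorem[OF x(1)] x ord by simp
    hence "card Ob dvd p ^ k" by (metis dvd_triv_left)
    then obtain i where "card Ob = p ^ i" using p by (meson divides_primepow_nat)
    thus ?thesis using that by (cases i) auto
  qed
  have one: "card Ob = 1 \<longleftrightarrow> (\<exists>x\<in>?F. Ob = {x})" if "Ob \<in> ?pi_hull" for Ob
  proof
    assume "card Ob = 1"
    then obtain x where x: "Ob = {x}" by (auto simp: card_1_singleton_iff)
    with orb[OF that] have "orbit G \<phi> x = {x}" by simp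
    hence "\<forall>g\<in>carrier G. \<phi> g x = x" by (auto simp: orbit_def)
    thus "\<exists>x\<in>?F. Ob = {x}" using x sub[OF that] by auto
  qed auto
  have "card E = (\<Sum>Ob\<in>?pi_hull. card Ob)"
  proof -
    have "card (\<Union>?pi_hull) = (\<Sum>Ob\<in>?pi_hull. card Ob)"
      using disjoint_union E sub by (intro card_Union_disjoint)
        (auto simp: pairwise_def disjnt_def intro!: finite_subset[OF sub E])
    thus ?thesis by (simp add: UO)
  qed
  also have "\<dots> = (\<Sum>Ob\<in>{Ob\<in>?pi_hull. card Ob = 1}. card Ob) + (\<Sum>Ob\<in>{Ob\<in>?pi_hull. card Ob \<noteq> 1}. card Ob)"
    using finO by (subst sum.union_disjoint[symmetric]) (auto intro!: sum.cong)
  also have "(\<Sum>Ob\<in>{Ob\<in>?pi_hull. card Ob = 1}. card Ob) = card {Ob\<in>?pi_hull. card Ob = 1}"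
    by simp
  also have "{Ob\<in>?pi_hull. card Ob = 1} = (\<lambda>x. {x}) ` ?F"
  proof -
    have "{x} \<in> ?pi_hull" if "x \<in> ?F" for x
    proof -
      have "orbit G \<phi> x = {x}" 
        using that one_closed unfolding orbit_def by (simp add: set_eq_iff) (metis one_closed)
      thus ?thesis using that by (auto simp: orbits_def)
    qed
    hence "(\<lambda>x. {x}) ` ?F \<subseteq> {Ob\<in>?pi_hull. card Ob = 1}"
      by (intro image_subsetI CollectI conjI) simp_all
    moreover have "{Ob\<in>?pi_hull. card Ob = 1} \<subseteq> (\<lambda>x. {x}) ` ?F"
    proof
      fix Ob assume "Ob \<in> {Ob\<in>?pi_hull. card Ob = 1}"
      then obtain x where "x \<in> ?F" "Ob = {x}" using one by blast
      thus "Ob \<in> (\<lambda>x. {x}) ` ?F" by (rule rev_image_eqI)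
    qed
    ultimately show ?thesis by (intro antisym)
  qed
  also have "card \<dots> = card ?F" by (rule card_image) auto
  finally have "card E = card ?F + (\<Sum>Ob\<in>{Ob\<in>?pi_hull. card Ob \<noteq> 1}. card Ob)" .
  moreover have "p dvd (\<Sum>Ob\<in>{Ob\<in>?pi_hull. card Ob \<noteq> 1}. card Ob)" using cd by (intro dvd_sum) auto
  ultimately show ?thesis by (simp only: cong_add_lcancel_0_nat cong_0_iff)
qed

section \<open>Elements of prescribed order and commutators\<close>

context group
begin

text \<open>Asking for some annihilating exponent, instead of speaking about the order of x, lets
  the notion pass to conjugates and homomorphic images at once.\<close>

definition pi_elem :: "nat set \<Rightarrow> 'a \<Rightarrow> bool" where
  "pi_elem \<sigma> x \<longleftrightarrow> x \<in> carrier G \<and> (\<exists>n. pi_num \<sigma> n \<and> x [^] n = \<one>)"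

text \<open>The convention fits right conjugation, \<open>cnj y x = x \<otimes> commut x y\<close>;
  the central series in \<open>nilpotent_group\<close> uses the opposite one, x g x^-1 g^-1.\<close>

definition commut :: "'a \<Rightarrow> 'a \<Rightarrow> 'a" where
  "commut x y = inv x \<otimes> inv y \<otimes> x \<otimes> y"

lemma pi_elem_carrier: "pi_elem \<sigma> x \<Longrightarrow> x \<in> carrier G" by (simp add: pi_elem_def)

lemma pi_elem_mono: "pi_elem \<sigma> x \<Longrightarrow> \<sigma> \<subseteq> \<tau> \<Longrightarrow> pi_elem \<tau> x"
  by (auto simp: pi_elem_def intro: pi_num_mono)

lemma pi_elem_cnj: "pi_elem \<sigma> x \<Longrightarrow> g \<in> carrier G \<Longrightarrow> pi_elem \<sigma> (cnj g x)"
  by (auto simp: pi_elem_def cnj_pow[symmetric])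

lemma pow_cong: "x \<in> carrier G \<Longrightarrow> x [^] n = \<one> \<Longrightarrow> [i = j] (mod n) \<Longrightarrow> x [^] i = x [^] j" for i j n :: nat
proof -
  assume a: "x \<in> carrier G" "x [^] n = \<one>" "[i = j] (mod n)"
  have *: "x [^] k = x [^] (k mod n)" for k :: nat
  proof -
    have "x [^] (n * (k div n) + k mod n) = (x [^] n) [^] (k div n) \<otimes> x [^] (k mod n)"
      using a(1) by (simp only: nat_pow_mult[symmetric] nat_pow_pow)
    thus ?thesis using a(1,2) by simp
  qed
  show ?thesis using *[of i] *[of j] a(3) by (simp add: cong_def)
qed

lemma subgroup_pow: "subgroup H G \<Longrightarrow> x \<in> H \<Longrightarrow> x [^] (n::nat) \<in> H"
  by (induction n) (auto simp: subgroup.one_closed subgroup.m_closed)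

text \<open>Bezout's identity over the naturals expresses x through powers of x^m and x^n. An
  exponent 0 forces the other one to be 1 and is split off beforehand.\<close>

lemma pow_coprime_in:
  fixes m n :: nat
  assumes "subgroup H G" "x \<in> carrier G" "x [^] m \<in> H" "x [^] n \<in> H" "coprime m n"
  shows "x \<in> H"
proof (cases "n = 0 \<or> m = 0")
  case True thus ?thesis using assms by auto
next
  case False
  hence "\<exists>u v. m * u = n * v + 1"
    using bezout_nat[of m n] assms(5) by (simp add: coprime_iff_gcd_eq_1)
  then obtain u v where uv: "m * u = n * v + 1" by blast
  have "x [^] (m * u) = x [^] (n * v) \<otimes> x" using uv assms(2) by simp
  hence "x = inv (x [^] (n * v)) \<otimes> x [^] (m * u)" using assms(2) by simp
  moreover have "x [^] (n * v) \<in> H" "x [^] (m * u) \<in> H"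
    using subgroup_pow[OF assms(1,3), of u] subgroup_pow[OF assms(1,4), of v] assms(2)
    by (auto simp: nat_pow_pow)
  ultimately show ?thesis using assms(1) by (metis subgroup.m_closed subgroup.m_inv_closed)
qed

lemma commut_closed [simp]: "x \<in> carrier G \<Longrightarrow> y \<in> carrier G \<Longrightarrow> commut x y \<in> carrier G"
  by (simp add: commut_def)

lemma commut_cnj: "x \<in> carrier G \<Longrightarrow> y \<in> carrier G \<Longrightarrow> commut x y = inv x \<otimes> cnj y x"
  by (simp add: commut_def cnj_def m_assoc)

lemma cnj_commut: "x \<in> carrier G \<Longrightarrow> y \<in> carrier G \<Longrightarrow> cnj y x = x \<otimes> commut x y"
  by (simp add: commut_def cnj_def m_assoc)

lemma cnj_of_commut: "g \<in> carrier G \<Longrightarrow> x \<in> carrier G \<Longrightarrow> y \<in> carrier G \<Longrightarrow> cnj g (commut x y) = commut (cnj g x) (cnj g y)"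
  by (simp add: commut_def cnj_mult cnj_inv)

lemma inv_commut: "x \<in> carrier G \<Longrightarrow> y \<in> carrier G \<Longrightarrow> inv (commut x y) = commut y x"
  by (simp add: commut_def inv_mult_group m_assoc)

lemma commut_in: "subgroup H G \<Longrightarrow> x \<in> H \<Longrightarrow> y \<in> H \<Longrightarrow> commut x y \<in> H"
  by (simp add: commut_def subgroup.m_closed subgroup.m_inv_closed)

lemma commut_sym_in: "subgroup M G \<Longrightarrow> x \<in> carrier G \<Longrightarrow> y \<in> carrier G \<Longrightarrow> commut x y \<in> M \<Longrightarrow> commut y x \<in> M"
  using inv_commut[of x y] subgroup.m_inv_closed[of M G "commut x y"] by simp

lemma commut_normal_in: assumes "normal_in N L" "x \<in> N" "y \<in> L" shows "commut x y \<in> N" "commut y x \<in> N"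
proof -
  have c: "x \<in> carrier G" "y \<in> carrier G" using assms by (auto simp: normal_in_def sub_carr)
  show 1: "commut x y \<in> N" using normal_in_cnj[OF assms(1,3,2)] assms c
    by (auto simp: commut_cnj normal_in_def subgroup.m_closed subgroup.m_inv_closed)
  show "commut y x \<in> N" using commut_sym_in[OF _ c 1] assms by (auto simp: normal_in_def)
qed

end

context fin_group
begin

text \<open>One exponent serves all elements, being chosen modulo the order of G: congruent to 1
  modulo its \<sigma>-part and to 0 modulo its \<sigma>'-part. This uniformity allows taking the
  \<sigma>-parts of two congruent elements simultaneously.\<close>

lemma pi_elem_exp: "\<exists>k::nat. (\<forall>x\<in>carrier G. pi_elem \<sigma> (x [^] k)) \<and> (\<forall>x. pi_elem \<sigma> x \<longrightarrow> x [^] k = x) \<and>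
    (\<forall>x. pi_elem (-\<sigma>) x \<longrightarrow> x [^] k = \<one>)"
proof -
  have n0: "order G > 0" using order_gt_0_iff_finite by simp
  then obtain a b where ab: "order G = a * b" "pi_num \<sigma> a" "pi_num (-\<sigma>) b" using pi_num_split by blast
  obtain k where k: "[k = 1] (mod a)" "[k = 0] (mod b)" using pi_num_cong_exp[OF ab(2,3)] by blast
  have 1: "x [^] a = \<one>" if "pi_elem \<sigma> x" for x
  proof -
    from that obtain m where m: "pi_num \<sigma> m" "x [^] m = \<one>" "x \<in> carrier G" by (auto simp: pi_elem_def)
    have "(x [^] a) [^] m = (x [^] m) [^] a" using m(3) by (simp add: nat_pow_pow mult.commute)
    hence "(x [^] a) [^] m = \<one>" using m(2) by simp
    moreover have "(x [^] a) [^] b = \<one>" using m ab pow_order_eq_1 by (simp add: nat_pow_pow)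
    ultimately show ?thesis
      using pow_coprime_in[OF triv_subgroup, of "x [^] a" m b] m pi_num_coprime[OF m(1) ab(3)] by simp
  qed
  have 2: "x [^] b = \<one>" if "pi_elem (-\<sigma>) x" for x
  proof -
    from that obtain m where m: "pi_num (-\<sigma>) m" "x [^] m = \<one>" "x \<in> carrier G" by (auto simp: pi_elem_def)
    have "(x [^] b) [^] m = (x [^] m) [^] b" using m(3) by (simp add: nat_pow_pow mult.commute)
    hence "(x [^] b) [^] m = \<one>" using m(2) by simp
    moreover have "(x [^] b) [^] a = \<one>" using m ab pow_order_eq_1 by (simp add: nat_pow_pow mult.commute)
    ultimately show ?thesis
      using pow_coprime_in[OF triv_subgroup, of "x [^] b" a m] m pi_num_coprime[OF ab(2) m(1)] by simp
  qed
  have "pi_elem \<sigma> (x [^] k)" if x: "x \<in> carrier G" for x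
  proof -
    obtain c where "k = b * c" using k(2) by (auto simp: cong_0_iff)
    hence "(x [^] k) [^] a = (x [^] order G) [^] c" using x ab by (simp add: nat_pow_pow ac_simps)
    hence "(x [^] k) [^] a = \<one>" using x pow_order_eq_1 by simp
    thus ?thesis using x ab by (auto simp: pi_elem_def)
  qed
  moreover have "x [^] k = x" if "pi_elem \<sigma> x" for x
    using pow_cong[OF pi_elem_carrier[OF that] 1[OF that] k(1)] that by (simp add: pi_elem_carrier)
  moreover have "x [^] k = \<one>" if "pi_elem (-\<sigma>) x" for x
    using pow_cong[OF pi_elem_carrier[OF that] 2[OF that] k(2)] that by (simp add: pi_elem_carrier)
  ultimately show ?thesis by blast
qed

text \<open>The factors are x^k and x^l with k + l congruent to 1 modulo the order of G. That b is a
  power of x serves \<open>pi_elem_quotient_lift\<close>, where it turns x^n in M into b^n in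
  M.\<close>

lemma pi_elem_split:
  assumes "subgroup H G" "x \<in> H"
  shows "\<exists>a b. pi_elem \<sigma> a \<and> pi_elem (-\<sigma>) b \<and> a \<in> H \<and> b \<in> H \<and> x = a \<otimes> b \<and> (\<exists>l::nat. b = x [^] l)"
proof -
  have x: "x \<in> carrier G" using assms sub_carr by blast
  have n0: "order G > 0" using order_gt_0_iff_finite by simp
  then obtain a b where ab: "order G = a * b" "pi_num \<sigma> a" "pi_num (-\<sigma>) b" using pi_num_split by blast
  obtain k where k: "[k = 1] (mod a)" "[k = 0] (mod b)" using pi_num_cong_exp[OF ab(2,3)] by blast
  obtain l where l: "[l = 1] (mod b)" "[l = 0] (mod a)" using pi_num_cong_exp[of "-\<sigma>" b a] ab by auto
  have "[k + l = 1] (mod a)" "[k + l = 1] (mod b)"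
    using cong_add[OF k(1) l(2)] cong_add[OF k(2) l(1)] by auto
  hence "[k + l = 1] (mod a * b)" using pi_num_coprime[OF ab(2,3)] by (metis coprime_cong_mult_nat)
  hence "x [^] (k + l) = x" using pow_cong[OF x pow_order_eq_1[OF x], of "k + l" 1] ab(1) x by simp
  hence "x = x [^] k \<otimes> x [^] l" using x by (simp add: nat_pow_mult)
  moreover have "pi_elem \<sigma> (x [^] k)"
  proof -
    obtain c where "k = b * c" using k(2) by (auto simp: cong_0_iff)
    hence "(x [^] k) [^] a = (x [^] order G) [^] c" using x ab by (simp add: nat_pow_pow ac_simps)
    thus ?thesis using x ab pow_order_eq_1 by (auto simp: pi_elem_def)
  qed
  moreover have "pi_elem (-\<sigma>) (x [^] l)"
  proof -
    obtain c where "l = a * c" using l(2) by (auto simp: cong_0_iff)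
    hence "(x [^] l) [^] b = (x [^] order G) [^] c" using x ab by (simp add: nat_pow_pow ac_simps)
    thus ?thesis using x ab pow_order_eq_1 by (auto simp: pi_elem_def)
  qed
  ultimately show ?thesis using subgroup_pow[OF assms] by blast
qed

lemma pow_card: "subgroup H G \<Longrightarrow> x \<in> H \<Longrightarrow> x [^] card H = \<one>"
proof -
  assume H: "subgroup H G" "x \<in> H"
  interpret H: group "G\<lparr>carrier := H\<rparr>" using H by (simp add: subgroup_imp_group)
  show ?thesis using H.pow_order_eq_1[of x] H by (simp add: order_def nat_pow_consistent[symmetric])
qed

lemma pi_elem_card: "subgroup H G \<Longrightarrow> pi_num \<sigma> (card H) \<Longrightarrow> x \<in> H \<Longrightarrow> pi_elem \<sigma> x"
  using pow_card[of H x] by (auto simp: pi_elem_def sub_carr)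

lemma order_Mod:
  assumes "normal_in N L" shows "order (G\<lparr>carrier := L\<rparr> Mod N) = index L N"
proof -
  have L: "subgroup L G" "subgroup N G" "N \<subseteq> L" using assms by (auto simp: normal_in_def)
  interpret L: group "G\<lparr>carrier := L\<rparr>" using L by (simp add: subgroup_imp_group)
  have "subgroup N (G\<lparr>carrier := L\<rparr>)" using L by (simp add: subgroup_incl)
  from L.lagrange[OF this] have "card (rcosets\<^bsub>G\<lparr>carrier := L\<rparr>\<^esub> N) * card N = card L" by (simp add: order_def)
  hence "index L N = card (rcosets\<^bsub>G\<lparr>carrier := L\<rparr>\<^esub> N)"
    using card_sub_pos[OF L(2)] unfolding index_def by (metis nonzero_mult_div_cancel_right not_gr0)
  thus ?thesis by (simp add: order_def FactGroup_def)
qed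

lemma pow_index: assumes "normal_in N L" "x \<in> L" shows "x [^] index L N \<in> N"
proof -
  have L: "subgroup L G" "subgroup N G" "N \<subseteq> L" using assms by (auto simp: normal_in_def)
  interpret L: group "G\<lparr>carrier := L\<rparr>" using L by (simp add: subgroup_imp_group)
  have nN: "N \<lhd> G\<lparr>carrier := L\<rparr>" using assms normal_iff_normal_in L by blast
  interpret N: normal N "G\<lparr>carrier := L\<rparr>" by (fact nN)
  interpret Q: group "G\<lparr>carrier := L\<rparr> Mod N" by (rule N.factorgroup_is_group)
  let ?c = "N #>\<^bsub>G\<lparr>carrier := L\<rparr>\<^esub> x"
  have c: "?c \<in> carrier (G\<lparr>carrier := L\<rparr> Mod N)" using assms by (auto simp: carrier_FactGroup)
  have "?c [^]\<^bsub>G\<lparr>carrier := L\<rparr> Mod N\<^esub> index L N = N"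
    using Q.pow_order_eq_1[OF c] order_Mod[OF assms(1)] by simp
  hence "N #>\<^bsub>G\<lparr>carrier := L\<rparr>\<^esub> (x [^]\<^bsub>G\<lparr>carrier := L\<rparr>\<^esub> index L N) = N"
    using N.FactGroup_pow[of x "index L N"] assms by simp
  moreover have "x [^] index L N \<in> N #> x [^] index L N"
    using L assms by (intro rcos_self) (auto simp: sub_carr)
  ultimately show ?thesis by (simp flip: nat_pow_consistent)
qed

text \<open>A power of x with a \<sigma>-exponent is trivial and one with a \<sigma>'-exponent lies
  in N; these exponents are coprime.\<close>

lemma pi_elem_in: assumes "normal_in N L" "pi_num (-\<sigma>) (index L N)" "x \<in> L" "pi_elem \<sigma> x" shows "x \<in> N"
proof -
  obtain n where n: "pi_num \<sigma> n" "x [^] n = \<one>" "x \<in> carrier G" using assms by (auto simp: pi_elem_def)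
  have N: "subgroup N G" using assms by (simp add: normal_in_def)
  show ?thesis
    using pow_coprime_in[OF N n(3) _ pow_index[OF assms(1,3)], of n] n pi_num_coprime[OF n(1) assms(2)]
      subgroup.one_closed[OF N] by simp
qed

text \<open>With q-order and q'-index in place of an explicit prime power, Sylow subgroups can be
  followed through chains of subgroups by multiplying indices.\<close>

definition sylow_in :: "nat \<Rightarrow> 'a set \<Rightarrow> 'a set \<Rightarrow> bool" where
  "sylow_in q L P \<longleftrightarrow> subgroup P G \<and> P \<subseteq> L \<and> pi_num {q} (card P) \<and> pi_num (-{q}) (index L P)"

lemma sylow_in_ex: assumes "prime q" "subgroup L G" shows "\<exists>P. sylow_in q L P"
proof -
  interpret L: group "G\<lparr>carrier := L\<rparr>" using assms by (simp add: subgroup_imp_group)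
  obtain a b where ab: "card L = a * b" "pi_num {q} a" "pi_num (-{q}) b"
    using pi_num_split card_sub_pos[OF assms(2)] by blast
  obtain k where k: "a = q ^ k" using pi_num_prime_power assms ab by blast
  have "\<exists>H. subgroup H (G\<lparr>carrier := L\<rparr>) \<and> card H = q ^ k"
    using assms ab k L.is_group by (intro sylow_thm[of q _ k b]) (auto simp: order_def)
  then obtain H where H: "subgroup H (G\<lparr>carrier := L\<rparr>)" "card H = q ^ k" by blast
  have "subgroup H G" "H \<subseteq> L" using incl_subgroup[OF assms(2) H(1)] subgroup.subset[OF H(1)] by auto
  moreover have "index L H = b" using H ab k prime_gt_0_nat[OF assms(1)] by (simp add: index_def)
  ultimately show ?thesis using H ab k by (auto simp: sylow_in_def)
qed

text \<open>U acts on the right cosets of P in L by right multiplication. A fixed coset P x means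
  that U lies in the conjugate of P by x, which yields both Sylow's theorem and the growth of
  normalizers in q-groups.\<close>

lemma coset_fixed:
  assumes L: "subgroup L G" and U: "subgroup U G" "U \<subseteq> L" and P: "subgroup P G" "P \<subseteq> L"
    and q: "prime q" "pi_num {q} (card U)"
  shows "[index L P = card {c \<in> (\<lambda>x. P #> x) ` L. \<forall>u\<in>U. c #> u = c}] (mod q)"
proof -
  let ?E = "(\<lambda>x. P #> x) ` L"
  let ?U = "G\<lparr>carrier := U\<rparr>"
  \<comment> \<open>Multiplying by the inverse makes right multiplication a left action; the
    restriction to \<open>?E\<close> is demanded by \<open>BijGroup\<close>.\<close>
  let ?f = "\<lambda>u. \<lambda>c\<in>?E. c #> inv u"
  have Lc: "L \<subseteq> carrier G" "P \<subseteq> carrier G" using L P subgroup.subset by auto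
  interpret U: group ?U using U by (simp add: subgroup_imp_group)
  have st: "P #> x #> inv u = P #> (x \<otimes> inv u)" "x \<otimes> inv u \<in> L" if "x \<in> L" "u \<in> U" for x u
    using that U L Lc by (auto simp: coset_mult_assoc sub_carr subgroup.m_closed subgroup.m_inv_closed subset_iff)
  have map: "?f u c \<in> ?E" if "c \<in> ?E" "u \<in> U" for u c
    using that st by auto
  have comp: "?f (u \<otimes> v) c = ?f u (?f v c)" if "u \<in> U" "v \<in> U" "c \<in> ?E" for u v c
  proof -
    from that obtain x where x: "x \<in> L" "c = P #> x" by auto
    have c: "u \<in> carrier G" "v \<in> carrier G" "x \<in> carrier G" using that U x Lc by (auto simp: sub_carr)
    have uv: "u \<otimes> v \<in> U" using that U by (simp add: subgroup.m_closed)
    have "?f (u \<otimes> v) c = P #> (x \<otimes> inv (u \<otimes> v))" using x st(1)[OF x(1) uv] that by auto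
    also have "\<dots> = P #> (x \<otimes> inv v) #> inv u"
      using c Lc by (simp add: coset_mult_assoc inv_mult_group m_assoc)
    also have "\<dots> = ?f u (?f v c)" using x st[OF x(1) that(2)] by auto
    finally show ?thesis .
  qed
  have idf: "?f \<one> c = c" if "c \<in> ?E" for c
  proof -
    from that obtain x where x: "x \<in> L" "c = P #> x" by auto
    hence "P #> x \<subseteq> carrier G" using Lc by (intro r_coset_subset_G) auto
    hence "P #> x #> inv \<one> = P #> x" by (simp only: inv_one coset_mult_one)
    thus ?thesis using that x by (simp only: restrict_apply if_True)
  qed
  have bij: "bij_betw (?f u) ?E ?E" if "u \<in> U" for u
  proof (rule bij_betwI[where g = "?f (inv u)"])
    have iu: "inv u \<in> U" using that U by (simp add: subgroup.m_inv_closed)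
    show "?f u \<in> ?E \<rightarrow> ?E" "?f (inv u) \<in> ?E \<rightarrow> ?E" using map[OF _ that] map[OF _ iu] by (simp_all only: Pi_I)
    have uc: "u \<in> carrier G" using that U by (simp add: sub_carr)
    show "?f (inv u) (?f u c) = c" if "c \<in> ?E" for c
      using comp[OF iu \<open>u \<in> U\<close> that] idf[OF that] uc by (simp del: restrict_apply)
    show "?f u (?f (inv u) c) = c" if "c \<in> ?E" for c
      using comp[OF \<open>u \<in> U\<close> iu that] idf[OF that] uc by (simp del: restrict_apply)
  qed
  have B: "?f u \<in> Bij ?E" if "u \<in> U" for u
    using bij[OF that] unfolding Bij_def by auto
  have hom: "group_hom ?U (BijGroup ?E) ?f"
  proof (unfold group_hom_def group_hom_axioms_def, intro conjI)
    show "group ?U" by (rule U.is_group)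
    show "group (BijGroup ?E)" by (rule group_BijGroup)
    show "?f \<in> hom ?U (BijGroup ?E)"
    proof (rule homI)
      fix u v assume uv: "u \<in> carrier ?U" "v \<in> carrier ?U"
      hence "?f (u \<otimes> v) = compose ?E (?f u) (?f v)"
        using comp[of u v] by (auto simp: compose_def restrict_def fun_eq_iff)
      thus "?f (u \<otimes>\<^bsub>?U\<^esub> v) = ?f u \<otimes>\<^bsub>BijGroup ?E\<^esub> ?f v"
        using uv B by (simp add: BijGroup_def)
    qed (use B in \<open>simp add: BijGroup_def\<close>)
  qed
  interpret A: group_action ?U ?E ?f by (rule group_action.intro) (fact hom)
  have "finite ?E" using L by simp
  moreover obtain k where "card U = q ^ k" using pi_num_prime_power q by blast
  ultimately have "[card ?E = card {c \<in> ?E. \<forall>u\<in>carrier ?U. ?f u c = c}] (mod q)"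
    using q by (intro A.p_group_fixed) (auto simp: order_def)
  moreover have "{c \<in> ?E. \<forall>u\<in>carrier ?U. ?f u c = c} = {c \<in> ?E. \<forall>u\<in>U. c #> u = c}" (is "?X = ?Y")
  proof
    show "?X \<subseteq> ?Y"
    proof
      fix c assume c: "c \<in> ?X"
      have "c #> u = c" if u: "u \<in> U" for u
      proof -
        have "inv u \<in> carrier ?U" using u U by (simp add: subgroup.m_inv_closed)
        hence "?f (inv u) c = c" using c by blast
        moreover have "c \<in> ?E" using c by simp
        ultimately have "c #> inv (inv u) = c" by (simp only: restrict_apply if_True)
        thus ?thesis using u U by (simp add: sub_carr)
      qed
      thus "c \<in> ?Y" using c by blast
    qed
    show "?Y \<subseteq> ?X" using U by (auto simp: subgroup.m_inv_closed)
  qed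
  moreover have "card ?E = index L P"
  proof -
    interpret L: group "G\<lparr>carrier := L\<rparr>" using L by (simp add: subgroup_imp_group)
    have "subgroup P (G\<lparr>carrier := L\<rparr>)" using L P by (simp add: subgroup_incl)
    from L.lagrange[OF this] have "card (rcosets\<^bsub>G\<lparr>carrier := L\<rparr>\<^esub> P) * card P = card L" by (simp add: order_def)
    moreover have "rcosets\<^bsub>G\<lparr>carrier := L\<rparr>\<^esub> P = ?E" by (auto simp: RCOSETS_def)
    ultimately show ?thesis using card_sub_pos[OF P(1)] unfolding index_def
      by (metis nonzero_mult_div_cancel_right not_gr0)
  qed
  ultimately show ?thesis by simp
qed

lemma coset_eq_iff:
  assumes "subgroup P G" "x \<in> carrier G" "y \<in> carrier G"
  shows "P #> x = P #> y \<longleftrightarrow> x \<otimes> inv y \<in> P"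
proof
  assume "P #> x = P #> y"
  hence "x \<in> P #> y" using rcos_self[of x P] assms by auto
  then obtain p where p: "p \<in> P" "x = p \<otimes> y" by (auto simp: r_coset_def)
  hence "x \<otimes> inv y = p" using assms by (simp add: m_assoc sub_carr)
  thus "x \<otimes> inv y \<in> P" using p by simp
next
  assume a: "x \<otimes> inv y \<in> P"
  have "x = (x \<otimes> inv y) \<otimes> y" using assms by (simp add: m_assoc)
  hence "x \<in> P #> y" using a by (auto simp: r_coset_def)
  thus "P #> x = P #> y" using repr_independence assms by metis
qed

lemma coset_fixed_cnj_set:
  assumes "subgroup P G" "x \<in> carrier G" "u \<in> carrier G" "P #> x #> u = P #> x"
  shows "u \<in> cnj_set P x"
proof -
  have "P #> (x \<otimes> u) = P #> x" using assms by (simp add: coset_mult_assoc subgroup.subset)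
  hence "x \<otimes> u \<otimes> inv x \<in> P" using assms coset_eq_iff by simp
  moreover have "u = cnj x (x \<otimes> u \<otimes> inv x)" using assms by (simp add: cnj_def m_assoc)
  ultimately show ?thesis by (auto simp: cnj_set_def)
qed

text \<open>The number of cosets of P is prime to q, so the q-group U fixes one of them.\<close>

lemma sylow_in_dom:
  assumes L: "subgroup L G" and q: "prime q" and P: "sylow_in q L P"
    and U: "subgroup U G" "U \<subseteq> L" "pi_num {q} (card U)"
  shows "\<exists>x\<in>L. U \<subseteq> cnj_set P x"
proof -
  have P': "subgroup P G" "P \<subseteq> L" "pi_num (-{q}) (index L P)" using P by (auto simp: sylow_in_def)
  have "\<not> q dvd index L P" using P'(3) q by (auto simp: pi_num_def)
  hence "card {c \<in> (\<lambda>x. P #> x) ` L. \<forall>u\<in>U. c #> u = c} \<noteq> 0"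
    using coset_fixed[OF L U(1,2) P'(1,2) q U(3)] by (metis cong_0_iff)
  hence "{c \<in> (\<lambda>x. P #> x) ` L. \<forall>u\<in>U. c #> u = c} \<noteq> {}" by (metis card.empty)
  then obtain x where x: "x \<in> L" "\<forall>u\<in>U. P #> x #> u = P #> x" by blast
  have "u \<in> cnj_set P x" if "u \<in> U" for u
    using coset_fixed_cnj_set[OF P'(1), of x u] x that L U by (simp add: sub_carr)
  thus ?thesis using x by blast
qed

lemma sylow_in_card_eq:
  assumes "subgroup L G" "sylow_in q L P" "sylow_in q L Q" shows "card P = card Q"
proof -
  have e: "card L = index L P * card P" "card L = index L Q * card Q"
    using assms by (auto simp: sylow_in_def intro: index_mult)
  have c: "coprime (card P) (index L Q)" "coprime (card Q) (index L P)"
    using assms by (auto simp: sylow_in_def intro: pi_num_coprime)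
  have "card P dvd index L Q * card Q" "card Q dvd index L P * card P" using e by (metis dvd_triv_right)+
  hence "card P dvd card Q" "card Q dvd card P"
    using c by (simp_all only: coprime_dvd_mult_right_iff)
  thus ?thesis by (rule dvd_antisym)
qed

lemma sylow_in_conj:
  assumes L: "subgroup L G" and q: "prime q" and P: "sylow_in q L P" and Q: "sylow_in q L Q"
  shows "\<exists>x\<in>L. cnj_set P x = Q"
proof -
  have "subgroup Q G" "Q \<subseteq> L" "pi_num {q} (card Q)" using Q by (auto simp: sylow_in_def)
  from sylow_in_dom[OF L q P this] obtain x where x: "x \<in> L" "Q \<subseteq> cnj_set P x" by blast
  have xc: "x \<in> carrier G" using x L sub_carr by blast
  have "card (cnj_set P x) = card P" using xc P by (intro card_cnj_set) (auto simp: sylow_in_def subgroup.subset)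
  hence "card (cnj_set P x) = card Q" using sylow_in_card_eq[OF L P Q] by simp
  moreover have "finite (cnj_set P x)" using xc P subgroup_cnj_set[of P x] by (auto simp: sylow_in_def)
  ultimately have "Q = cnj_set P x" using x(2) by (intro card_subset_eq) simp_all
  thus ?thesis using x(1) by blast
qed

lemma sylow_in_cnj_set: assumes "sylow_in q L P" "x \<in> L" "subgroup L G" shows "sylow_in q L (cnj_set P x)"
proof -
  have c: "x \<in> carrier G" "P \<subseteq> carrier G" using assms sub_carr by (auto simp: sylow_in_def subgroup.subset)
  have "cnj_set P x \<subseteq> cnj_set L x" using assms by (intro cnj_set_mono) (auto simp: sylow_in_def)
  thus ?thesis using assms c by (auto simp: sylow_in_def index_def card_cnj_set subgroup_cnj_set cnj_set_self)
qed

text \<open>Let P act on its own cosets in Q. Their number is divisible by q and the coset P is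
  fixed, so another coset P x is fixed, and then x normalizes P.\<close>

lemma p_growth:
  assumes q: "prime q" and Q: "subgroup Q G" "pi_num {q} (card Q)" and P: "subgroup P G" "P \<subset> Q"
  shows "\<exists>x\<in>Q. x \<notin> P \<and> cnj_set P x = P"
proof -
  let ?F = "{c \<in> (\<lambda>x. P #> x) ` Q. \<forall>u\<in>P. c #> u = c}"
  have PQ: "P \<subseteq> Q" using P by blast
  have pP: "pi_num {q} (card P)" using pi_num_dvd[OF Q(2) card_dvd[OF P(1) Q(1) PQ]] .
  have i: "card Q = index Q P * card P" using index_mult[OF P(1) Q(1) PQ] .
  hence "pi_num {q} (index Q P)" using Q(2) by (simp add: pi_num_mult)
  moreover have "index Q P \<noteq> 1" using index_1[OF P(1) Q(1) PQ] P by auto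
  ultimately have "q dvd index Q P" using q pi_num_prime_power[of q "index Q P"]
    by (metis dvd_power power_0 not_gr0)
  hence "q dvd card ?F" using coset_fixed[OF Q(1) P(1) PQ P(1) PQ q pP] cong_dvd_iff by blast
  moreover have Pc: "P \<subseteq> carrier G" using P by (simp add: subgroup.subset)
  have "P \<in> ?F"
  proof -
    have "P #> u = P" if "u \<in> P" for u using coset_join2[of u P] that P Pc by auto
    moreover have "P \<in> (\<lambda>x. P #> x) ` Q"
      using Pc Q by (intro image_eqI[of _ _ \<one>]) (simp_all add: subgroup.one_closed)
    ultimately show ?thesis unfolding mem_Collect_eq by blast
  qed
  have fF: "finite ?F" using Q by simp
  have "q dvd card ?F" by fact
  from ex_other_elem[OF fF \<open>P \<in> ?F\<close> q this] obtain c where "c \<in> ?F" "c \<noteq> P" by blast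
  then obtain x where x: "x \<in> Q" "P #> x \<noteq> P" "\<forall>u\<in>P. P #> x #> u = P #> x" by auto
  have xc: "x \<in> carrier G" using x Q by (simp add: sub_carr)
  have "x \<notin> P" using x coset_join2[of x P] P Pc by auto
  moreover have "P \<subseteq> cnj_set P x" using coset_fixed_cnj_set[OF P(1) xc] x Pc by blast
  hence "cnj_set P x = P" using card_cnj_set[OF xc Pc] subgroup_cnj_set[OF P(1) xc] by (metis card_subset_eq fin_sub)
  ultimately show ?thesis using x by blast
qed

text \<open>This is the nontrivial centre of the q-group N/M: conjugation on N/M has a fixed point
  besides the identity.\<close>

lemma rel_center:
  assumes q: "prime q" and M: "normal_in M N" "M \<noteq> N" "pi_num {q} (index N M)"
  shows "\<exists>z\<in>N. z \<notin> M \<and> (\<forall>n\<in>N. commut z n \<in> M)"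
proof -
  have L: "subgroup N G" "subgroup M G" "M \<subseteq> N" using M by (auto simp: normal_in_def)
  let ?N = "G\<lparr>carrier := N\<rparr>"
  let ?Q = "?N Mod M"
  interpret L: group ?N using L by (simp add: subgroup_imp_group)
  have nN: "M \<lhd> ?N" using M normal_iff_normal_in L by blast
  interpret N: normal M ?N by (fact nN)
  interpret Q: group ?Q by (rule N.factorgroup_is_group)
  interpret A: group_action ?Q "carrier ?Q" "\<lambda>g. \<lambda>h\<in>carrier ?Q. g \<otimes>\<^bsub>?Q\<^esub> h \<otimes>\<^bsub>?Q\<^esub> inv\<^bsub>?Q\<^esub> g"
    by (rule Q.action_by_conjugation)
  let ?F = "{x \<in> carrier ?Q. \<forall>g\<in>carrier ?Q. (\<lambda>h\<in>carrier ?Q. g \<otimes>\<^bsub>?Q\<^esub> h \<otimes>\<^bsub>?Q\<^esub> inv\<^bsub>?Q\<^esub> g) x = x}"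
  obtain k where k: "index N M = q ^ k" using pi_num_prime_power q M by blast
  have card: "card (carrier ?Q) = index N M" using order_Mod[OF M(1)] by (simp add: order_def)
  have fin: "finite (carrier ?Q)" using L by (auto simp: carrier_FactGroup)
  have "[card (carrier ?Q) = card ?F] (mod q)"
    using A.p_group_fixed[OF fin q] order_Mod[OF M(1)] k by simp
  moreover have "index N M \<noteq> 1" using index_1[OF L(2,1,3)] M by auto
  hence "q dvd card (carrier ?Q)" using k card by (metis dvd_power power_0 not_gr0)
  ultimately have d: "q dvd card ?F" using cong_dvd_iff by blast
  have o: "\<one>\<^bsub>?Q\<^esub> \<in> ?F" by (auto simp del: one_FactGroup mult_FactGroup)
  have fF: "finite ?F" using fin by simp
  obtain c where c: "c \<in> ?F" "c \<noteq> \<one>\<^bsub>?Q\<^esub>" using ex_other_elem[OF fF o q d] by (elim bexE)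
  have "c \<in> carrier ?Q" using c(1) by blast
  then obtain z where z: "z \<in> N" "c = M #> z" by (auto simp: carrier_FactGroup)
  have zc: "z \<in> carrier G" using z L by (simp add: sub_carr)
  have Mc: "M \<subseteq> carrier G" using L by (simp add: subgroup.subset)
  have "z \<notin> M" using c z coset_join2[of z M] L zc by auto
  moreover have "commut z n \<in> M" if n: "n \<in> N" for n
  proof -
    have nc: "n \<in> carrier G" "inv n \<in> N" using n L by (auto simp add: sub_carr subgroup.m_inv_closed)
    have C: "M #> x \<in> carrier ?Q" if "x \<in> N" for x using that by (auto simp: carrier_FactGroup)
    have m: "(M #> x) \<otimes>\<^bsub>?Q\<^esub> (M #> y) = M #> (x \<otimes> y)" if "x \<in> N" "y \<in> N" for x y
      using N.rcos_sum[of x y] that by simp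
    have "(M #> n) \<otimes>\<^bsub>?Q\<^esub> c \<otimes>\<^bsub>?Q\<^esub> inv\<^bsub>?Q\<^esub> (M #> n) = c"
      using c C[OF n] by (force simp del: one_FactGroup mult_FactGroup)
    hence "(M #> n) \<otimes>\<^bsub>?Q\<^esub> c = c \<otimes>\<^bsub>?Q\<^esub> (M #> n)"
      using C[OF n] C[OF z(1)] z(2) by (metis Q.inv_solve_right' Q.m_closed)
    hence "M #> (n \<otimes> z) = M #> (z \<otimes> n)" using m z n by simp
    hence "n \<otimes> z \<otimes> inv (z \<otimes> n) \<in> M"
      using coset_eq_iff[OF L(2)] nc zc by simp
    \<comment> \<open>Conjugation by z n turns the element n z (z n)^-1 into a commutator in the
      convention of \<open>commut\<close>.\<close>
    hence "cnj (z \<otimes> n) (n \<otimes> z \<otimes> inv (z \<otimes> n)) \<in> M"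
      using normal_in_cnj[OF M(1)] z n L by (auto simp: subgroup.m_closed)
    hence "inv n \<otimes> inv z \<otimes> n \<otimes> z \<in> M" using nc zc by (simp add: cnj_def m_assoc inv_mult_group)
    hence "commut n z \<in> M" by (simp add: commut_def)
    thus ?thesis using commut_sym_in[OF L(2) nc(1) zc] by simp
  qed
  ultimately show ?thesis using z by blast
qed

lemma index_no_prime:
  assumes "subgroup H G" "subgroup L G" "H \<subseteq> L" "\<And>r. prime r \<Longrightarrow> pi_num (-{r}) (index L H)"
  shows "H = L"
proof (rule index_1[OF assms(1-3)])
  show "index L H = 1" using assms(4) by (metis ComplD insertI1 pi_num_def prime_factor_nat)
qed

text \<open>For r in \<sigma> a Sylow r-subgroup of L consists of \<sigma>-elements and so lies in
  H; hence r does not divide the index.\<close>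

lemma index_pi_elem:
  assumes "subgroup H G" "subgroup L G" "H \<subseteq> L" "\<And>x. x \<in> L \<Longrightarrow> pi_elem \<sigma> x \<Longrightarrow> x \<in> H"
  shows "pi_num (-\<sigma>) (index L H)"
proof -
  have "\<not> r dvd index L H" if r: "prime r" "r \<in> \<sigma>" for r
  proof -
    obtain R where R: "sylow_in r L R" using sylow_in_ex r assms by blast
    have R': "subgroup R G" "pi_num {r} (card R)" "R \<subseteq> L" using R by (auto simp: sylow_in_def)
    have "R \<subseteq> H"
    proof
      fix x assume "x \<in> R"
      hence "pi_elem {r} x" using pi_elem_card R' by blast
      hence "pi_elem \<sigma> x" using r by (auto intro: pi_elem_mono)
      thus "x \<in> H" using assms(4) \<open>x \<in> R\<close> R' by blast
    qed
    hence "index L R = index L H * index H R" using R' assms by (intro index_trans) auto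
    hence "pi_num (-{r}) (index L H)" using R by (simp add: sylow_in_def pi_num_mult)
    thus ?thesis using r by (auto simp: pi_num_def)
  qed
  thus ?thesis using index_pos[OF assms(1-3)] by (auto simp: pi_num_def)
qed

text \<open>A Sylow q-subgroup and the q'-elements together contain Sylow subgroups for all primes.
  Typically H is a normalizer or a centralizer that has to be the whole of L.\<close>

lemma gen_q:
  assumes "subgroup H G" "subgroup L G" "H \<subseteq> L" "sylow_in q L P" "P \<subseteq> H" "prime q"
    "\<And>x. x \<in> L \<Longrightarrow> pi_elem (-{q}) x \<Longrightarrow> x \<in> H"
  shows "H = L"
proof (rule index_no_prime[OF assms(1-3)])
  fix r :: nat assume r: "prime r"
  show "pi_num (-{r}) (index L H)"
  proof (cases "r = q")
    case True
    have "index L P = index L H * index H P" using assms by (intro index_trans) (auto simp: sylow_in_def)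
    thus ?thesis using assms True by (simp add: sylow_in_def pi_num_mult)
  next
    case False
    have "pi_num (-(-{q})) (index L H)" using assms by (intro index_pi_elem) auto
    thus ?thesis using False by (auto elim!: pi_num_mono)
  qed
qed

end

subsection \<open>Complements\<close>

text \<open>The abelian case of the Schur-Zassenhaus theorem, set up for a whole group so that it
  can be instantiated with a quotient X/M.\<close>

locale coprime_abelian_normal = fin_group +
  fixes N
  assumes nN: "normal_in N (carrier G)"
    and ab: "\<And>a b. a \<in> N \<Longrightarrow> b \<in> N \<Longrightarrow> a \<otimes> b = b \<otimes> a"
    and cop: "coprime (card N) (index (carrier G) N)"
begin

abbreviation A where "A \<equiv> G\<lparr>carrier := N\<rparr>"

definition E where "E = (\<lambda>x. N #> x) ` carrier G"

text \<open>Normality of N makes left translation permute the right cosets in \<open>E\<close>, see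
  \<open>act_coset\<close>.\<close>

definition act :: "'a \<Rightarrow> 'a set \<Rightarrow> 'a set" where
  "act g c = (\<lambda>y. g \<otimes> y) ` c"

definition tr :: "('a set \<Rightarrow> 'a) \<Rightarrow> bool" where
  "tr t \<longleftrightarrow> (\<forall>c\<in>E. t c \<in> c)"

text \<open>For transversals \<open>t\<close>, \<open>s\<close> of \<open>N\<close> let \<open>D t s\<close> be the product of the quotients
  \<open>t c \<otimes> inv (s c)\<close> over all cosets. Then \<open>g \<mapsto> D (mv g t) t\<close> is a crossed homomorphism which on \<open>N\<close>
  is the power map with exponent \<open>|G : N|\<close>, a bijection; so its kernel is a complement of \<open>N\<close>.\<close>

definition D :: "('a set \<Rightarrow> 'a) \<Rightarrow> ('a set \<Rightarrow> 'a) \<Rightarrow> 'a" where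
  "D t s = finprod A (\<lambda>c. t c \<otimes> inv (s c)) E"

definition mv :: "'a \<Rightarrow> ('a set \<Rightarrow> 'a) \<Rightarrow> 'a set \<Rightarrow> 'a" where
  "mv g t c = g \<otimes> t (act (inv g) c)"

lemma sN: "subgroup N G" using nN by (simp add: normal_in_def)

lemma Nc: "x \<in> N \<Longrightarrow> x \<in> carrier G" using sN by (rule sub_carr)

lemma comm_A: "comm_group A"
proof -
  interpret A: group A using sN by (rule subgroup_imp_group)
  show ?thesis by (rule A.group_comm_groupI) (simp add: ab)
qed

sublocale A: comm_group A by (rule comm_A)

lemma finite_E: "finite E" by (simp add: E_def)

lemma card_E: "card E = index (carrier G) N"
proof -
  have "E = rcosets N" by (auto simp: E_def RCOSETS_def)
  moreover have "card (rcosets N) * card N = order G" using lagrange[OF sN] .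
  ultimately show ?thesis using card_sub_pos[OF sN] unfolding index_def order_def
    by (metis nonzero_mult_div_cancel_right not_gr0)
qed

lemma E_sub: "c \<in> E \<Longrightarrow> y \<in> c \<Longrightarrow> y \<in> carrier G"
  using r_coset_subset_G[of N] sN by (auto simp: E_def subgroup.subset)

lemma E_mem: "c \<in> E \<Longrightarrow> y \<in> c \<Longrightarrow> c = N #> y"
  using repr_independence sN by (auto simp: E_def)

lemma E_div: "c \<in> E \<Longrightarrow> x \<in> c \<Longrightarrow> y \<in> c \<Longrightarrow> x \<otimes> inv y \<in> N"
  using E_mem[of c x] E_mem[of c y] E_sub[of c x] E_sub[of c y] coset_eq_iff[OF sN] by metis

lemma act_coset:
  assumes "g \<in> carrier G" "x \<in> carrier G" shows "act g (N #> x) = N #> (g \<otimes> x)"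
proof
  show "act g (N #> x) \<subseteq> N #> (g \<otimes> x)"
  proof
    fix y assume "y \<in> act g (N #> x)"
    then obtain n where n: "n \<in> N" "y = g \<otimes> (n \<otimes> x)" by (auto simp: act_def r_coset_def)
    have "y = cnj (inv g) n \<otimes> (g \<otimes> x)" using n assms by (simp add: cnj_def m_assoc Nc)
    moreover have "cnj (inv g) n \<in> N" using normal_in_cnj[OF nN] n assms by simp
    ultimately show "y \<in> N #> (g \<otimes> x)" by (auto simp: r_coset_def)
  qed
  show "N #> (g \<otimes> x) \<subseteq> act g (N #> x)"
  proof
    fix y assume "y \<in> N #> (g \<otimes> x)"
    then obtain n where n: "n \<in> N" "y = n \<otimes> (g \<otimes> x)" by (auto simp: r_coset_def)
    have "y = g \<otimes> (cnj g n \<otimes> x)" using n assms by (simp add: cnj_def m_assoc Nc)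
    moreover have "cnj g n \<in> N" using normal_in_cnj[OF nN] n assms by simp
    ultimately show "y \<in> act g (N #> x)" by (auto simp: r_coset_def act_def)
  qed
qed

lemma act_E: "g \<in> carrier G \<Longrightarrow> c \<in> E \<Longrightarrow> act g c \<in> E"
  by (auto simp: E_def act_coset)

lemma act_act: "g \<in> carrier G \<Longrightarrow> h \<in> carrier G \<Longrightarrow> c \<in> E \<Longrightarrow> act g (act h c) = act (g \<otimes> h) c"
  using act_coset by (auto simp: E_def m_assoc)

lemma act_one: "c \<in> E \<Longrightarrow> act \<one> c = c"
  by (auto simp: E_def act_coset)

lemma act_N: "n \<in> N \<Longrightarrow> c \<in> E \<Longrightarrow> act n c = c"
proof -
  assume n: "n \<in> N" "c \<in> E"
  then obtain x where x: "x \<in> carrier G" "c = N #> x" by (auto simp: E_def)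
  have "n \<otimes> x \<otimes> inv x \<in> N" using n x by (simp add: m_assoc Nc)
  hence "N #> (n \<otimes> x) = N #> x" using coset_eq_iff[OF sN] x n by (simp add: Nc)
  thus ?thesis using x n by (simp add: act_coset Nc)
qed

lemma bij_act: "g \<in> carrier G \<Longrightarrow> bij_betw (act g) E E"
  by (rule bij_betwI[where g = "act (inv g)"]) (auto simp: act_E act_act act_one)

lemma tr_mem: "tr t \<Longrightarrow> c \<in> E \<Longrightarrow> t c \<in> c" by (simp add: tr_def)

lemma tr_carrier: "tr t \<Longrightarrow> c \<in> E \<Longrightarrow> t c \<in> carrier G" using tr_mem E_sub by blast

lemma tr_diff: "tr t \<Longrightarrow> tr s \<Longrightarrow> c \<in> E \<Longrightarrow> t c \<otimes> inv (s c) \<in> N"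
  using E_div tr_mem by blast

lemma D_closed: "tr t \<Longrightarrow> tr s \<Longrightarrow> D t s \<in> N"
  using A.finprod_closed[of "\<lambda>c. t c \<otimes> inv (s c)" E] tr_diff by (auto simp: D_def)

text \<open>The factors telescope coset by coset; since N is abelian they may be regrouped.\<close>

lemma D_trans: assumes "tr t" "tr s" "tr r" shows "D t s \<otimes> D s r = D t r"
proof -
  have "D t r = finprod A (\<lambda>c. (t c \<otimes> inv (s c)) \<otimes>\<^bsub>A\<^esub> (s c \<otimes> inv (r c))) E"
    unfolding D_def using assms tr_diff
    by (intro A.finprod_cong') (auto simp: m_assoc tr_carrier)
  also have "\<dots> = D t s \<otimes>\<^bsub>A\<^esub> D s r"
    unfolding D_def using assms tr_diff by (intro A.finprod_multf) auto
  finally show ?thesis by simp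
qed

lemma mv_tr: assumes "g \<in> carrier G" "tr t" shows "tr (mv g t)"
proof -
  have "g \<otimes> t (act (inv g) c) \<in> c" if c: "c \<in> E" for c
  proof -
    have "t (act (inv g) c) \<in> act (inv g) c" using tr_mem[OF assms(2)] act_E c assms by simp
    hence "g \<otimes> t (act (inv g) c) \<in> act g (act (inv g) c)" by (auto simp: act_def)
    thus ?thesis using act_act[of g "inv g" c] act_one c assms by simp
  qed
  thus ?thesis by (simp add: tr_def mv_def)
qed

lemma mv_mv: "g \<in> carrier G \<Longrightarrow> h \<in> carrier G \<Longrightarrow> tr t \<Longrightarrow> c \<in> E \<Longrightarrow> mv g (mv h t) c = mv (g \<otimes> h) t c"
  by (simp add: mv_def act_act act_E m_assoc inv_mult_group tr_carrier)

text \<open>\<open>mv_mv\<close> and the invariance of a transversal hold on \<open>E\<close> only,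
  so values elsewhere must not matter.\<close>

lemma D_cong: "(\<And>c. c \<in> E \<Longrightarrow> t c = t' c) \<Longrightarrow> (\<And>c. c \<in> E \<Longrightarrow> s c = s' c) \<Longrightarrow> tr t \<Longrightarrow> tr s \<Longrightarrow> D t s = D t' s'"
  unfolding D_def using tr_diff[of t s] by (intro A.finprod_cong') auto

lemma cnj_finprod:
  assumes "g \<in> carrier G" "finite C" "f \<in> C \<rightarrow> N"
  shows "cnj g (finprod A f C) = finprod A (\<lambda>c. cnj g (f c)) C"
  using assms(2,3)
proof (induction C rule: finite_induct)
  case empty thus ?case using assms(1) by simp
next
  case (insert x C)
  have c: "(\<lambda>c. cnj g (f c)) \<in> C \<rightarrow> N" "cnj g (f x) \<in> N" "f x \<in> N" "f \<in> C \<rightarrow> N"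
    using insert.prems normal_in_cnj[OF nN assms(1)] by auto
  have "finprod A f C \<in> N" using A.finprod_closed[of f C] c by simp
  thus ?case using insert c assms(1) by (simp add: cnj_mult Nc)
qed

text \<open>After reindexing the product by the permutation \<open>act g\<close> of
  \<open>E\<close>, each factor is conjugated by \<open>inv g\<close>.\<close>

lemma D_mv:
  assumes g: "g \<in> carrier G" and ts: "tr t" "tr s"
  shows "D (mv g t) (mv g s) = cnj (inv g) (D t s)"
proof -
  let ?f = "\<lambda>c. mv g t c \<otimes> inv (mv g s c)"
  have e: "act g ` E = E" "inj_on (act g) E" using bij_act[OF g] by (auto simp: bij_betw_def)
  have "D (mv g t) (mv g s) = finprod A ?f (act g ` E)" by (simp add: D_def e)
  also have "\<dots> = finprod A (\<lambda>c. ?f (act g c)) E"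
    using e tr_diff[OF mv_tr[OF g ts(1)] mv_tr[OF g ts(2)]] by (intro A.finprod_reindex) auto
  also have "\<dots> = finprod A (\<lambda>c. cnj (inv g) (t c \<otimes> inv (s c))) E"
  proof (rule A.finprod_cong')
    show "(\<lambda>c. cnj (inv g) (t c \<otimes> inv (s c))) \<in> E \<rightarrow> carrier A"
      using g tr_diff[OF ts] normal_in_cnj[OF nN] by auto
    fix c assume c: "c \<in> E"
    have "mv g r (act g c) = g \<otimes> r c" for r
      using g c by (simp add: mv_def act_act act_one)
    thus "?f (act g c) = cnj (inv g) (t c \<otimes> inv (s c))"
      using g tr_carrier[OF ts(1) c] tr_carrier[OF ts(2) c] by (simp add: cnj_def m_assoc inv_mult_group)
  qed simp
  also have "\<dots> = cnj (inv g) (D t s)"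
    unfolding D_def using g tr_diff[OF ts] by (intro cnj_finprod[symmetric] finite_E) auto
  finally show ?thesis .
qed

text \<open>An element of N fixes every coset, so every factor of the product equals n.\<close>

lemma D_N: assumes n: "n \<in> N" and t: "tr t" shows "D (mv n t) t = n [^] card E"
proof -
  have "inv n \<in> N" using n sN by (simp add: subgroup.m_inv_closed)
  hence "D (mv n t) t = finprod A (\<lambda>c. n) E"
    unfolding D_def using n tr_carrier[OF t] by (intro A.finprod_cong') (auto simp: mv_def act_N m_assoc Nc)
  also have "\<dots> = n [^]\<^bsub>A\<^esub> card E" using n by (simp add: A.finprod_const)
  finally show ?thesis by (simp flip: nat_pow_consistent)
qed

lemma D_self: "tr t \<Longrightarrow> D t t = \<one>"
  using D_trans[of t t t] D_closed[of t t] by (simp add: Nc)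

lemma pow_E_inj: "n \<in> N \<Longrightarrow> n [^] card E = \<one> \<Longrightarrow> n = \<one>"
  using pow_coprime_in[OF triv_subgroup, of n "card E" "card N"] pow_card[OF sN, of n] cop card_E
  by (simp add: coprime_commute Nc)

lemma pow_E_surj: assumes "d \<in> N" shows "\<exists>n\<in>N. n [^] card E = d"
proof -
  have "card N > 0" using card_sub_pos[OF sN] .
  then obtain k where k: "[card E * k = 1] (mod card N)"
    using cong_solve_coprime_nat[of "card E" "card N"] cop card_E by (auto simp: coprime_commute)
  have "(d [^] k) [^] card E = d [^] (card E * k)" using assms by (simp add: nat_pow_pow Nc mult.commute)
  also have "\<dots> = d" using pow_cong[OF Nc[OF assms] pow_card[OF sN assms] k] assms by (simp add: Nc)
  finally show ?thesis using subgroup_pow[OF sN assms] by blast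
qed

definition Ker where "Ker t = {g \<in> carrier G. D (mv g t) t = \<one>}"

text \<open>Insert the transversal \<open>mv g t\<close> between \<open>mv (g \<otimes> h) t\<close>
  and \<open>t\<close>.\<close>

lemma D_mult:
  assumes "g \<in> carrier G" "h \<in> carrier G" "tr t"
  shows "D (mv (g \<otimes> h) t) t = cnj (inv g) (D (mv h t) t) \<otimes> D (mv g t) t"
proof -
  have t: "tr (mv g t)" "tr (mv h t)" "tr (mv (g \<otimes> h) t)" "tr (mv g (mv h t))"
    using assms by (auto intro!: mv_tr)
  have "D (mv (g \<otimes> h) t) t = D (mv g (mv h t)) t"
    using assms t by (intro D_cong) (auto simp: mv_mv)
  also have "\<dots> = D (mv g (mv h t)) (mv g t) \<otimes> D (mv g t) t" using t assms by (intro D_trans[symmetric])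
  also have "D (mv g (mv h t)) (mv g t) = cnj (inv g) (D (mv h t) t)" using t assms by (intro D_mv)
  finally show ?thesis .
qed

lemma subgroup_Ker: assumes t: "tr t" shows "subgroup (Ker t) G"
proof (rule subgroupI)
  show "Ker t \<subseteq> carrier G" by (auto simp: Ker_def)
  have 1: "D (mv \<one> t) t = \<one>" using D_N[OF subgroup.one_closed[OF sN] t] by simp
  thus "Ker t \<noteq> {}" by (auto simp: Ker_def)
  fix g assume g: "g \<in> Ker t"
  have "D (mv (inv g \<otimes> g) t) t = cnj g (D (mv g t) t) \<otimes> D (mv (inv g) t) t"
    using D_mult[of "inv g" g t] g t by (simp add: Ker_def)
  thus "inv g \<in> Ker t" using g 1 D_closed[OF mv_tr[of "inv g" t] t] t by (auto simp: Ker_def Nc)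
  fix h assume h: "h \<in> Ker t"
  show "g \<otimes> h \<in> Ker t" using D_mult[of g h t] g h t by (simp add: Ker_def)
qed

lemma Ker_N: "tr t \<Longrightarrow> Ker t \<inter> N = {\<one>}"
  using D_N pow_E_inj subgroup.one_closed[OF subgroup_Ker] subgroup.one_closed[OF sN]
  by (auto simp: Ker_def)

lemma ex_tr: "\<exists>t. tr t"
proof -
  have "\<exists>y. y \<in> c" if "c \<in> E" for c
    using that rcos_self[OF _ sN] by (auto simp: E_def)
  thus ?thesis by (intro exI[of _ "\<lambda>c. SOME y. y \<in> c"]) (auto simp: tr_def some_in_eq)
qed

theorem complement_exists: "\<exists>H. subgroup H G \<and> H \<inter> N = {\<one>} \<and> N <#> H = carrier G"
proof -
  obtain t where t: "tr t" using ex_tr by blast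
  have "g \<in> N <#> Ker t" if g: "g \<in> carrier G" for g
  proof -
    have f: "D (mv g t) t \<in> N" using D_closed mv_tr g t by simp
    \<comment> \<open>The number of cosets is coprime to the order of N, so some n cancels the value
      of \<open>D\<close> at g; then \<open>n \<otimes> g\<close> lies in the kernel.\<close>
    then obtain n where n: "n \<in> N" "n [^] card E = inv (D (mv g t) t)"
      using pow_E_surj[of "inv (D (mv g t) t)"] sN by (auto simp: subgroup.m_inv_closed)
    have tt: "tr (mv g t)" "tr (mv (n \<otimes> g) t)" "tr (mv n (mv g t))" using g t n by (auto intro!: mv_tr simp: Nc)
    have "D (mv (n \<otimes> g) t) t = D (mv n (mv g t)) t"
      using n g t tt by (intro D_cong) (auto simp: mv_mv Nc)
    also have "\<dots> = D (mv n (mv g t)) (mv g t) \<otimes> D (mv g t) t" using tt t by (intro D_trans[symmetric])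
    also have "\<dots> = \<one>" using n f tt by (simp add: D_N Nc)
    finally have k: "n \<otimes> g \<in> Ker t" using n g by (simp add: Ker_def Nc)
    have "g = inv n \<otimes> (n \<otimes> g)" using n g by (simp add: Nc)
    thus ?thesis using set_multI[of "inv n" N "n \<otimes> g" "Ker t"] n k sN by (simp add: subgroup.m_inv_closed)
  qed
  moreover have "N <#> Ker t \<subseteq> carrier G"
    using sN subgroup_Ker[OF t] by (intro setmult_subset_G subgroup.subset)
  ultimately have "N <#> Ker t = carrier G" by blast
  thus ?thesis using subgroup_Ker[OF t] Ker_N[OF t] by blast
qed

text \<open>H contains exactly one element of each coset, and \<open>mv h t c\<close> is again the
  element of H in c.\<close>

lemma tr_complement:
  assumes H: "subgroup H G" "H \<inter> N = {\<one>}" "N <#> H = carrier G"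
  shows "\<exists>t. tr t \<and> (\<forall>c\<in>E. t c \<in> H) \<and> (\<forall>h\<in>H. \<forall>c\<in>E. mv h t c = t c)"
proof -
  have "\<exists>y. y \<in> c \<and> y \<in> H" if c: "c \<in> E" for c
  proof -
    obtain x where x: "x \<in> carrier G" "c = N #> x" using c by (auto simp: E_def)
    obtain n h where nh: "n \<in> N" "h \<in> H" "x = n \<otimes> h"
      using x(1) unfolding H(3)[symmetric] by (elim set_multE)
    have "h \<in> carrier G" using nh H sub_carr by blast
    hence "h = inv n \<otimes> x" using nh by (simp add: Nc)
    hence "h \<in> N #> x" using nh sN by (auto simp: r_coset_def subgroup.m_inv_closed)
    thus ?thesis using x nh by blast
  qed
  then obtain t where t: "\<And>c. c \<in> E \<Longrightarrow> t c \<in> c \<and> t c \<in> H" by metis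
  have tt: "tr t" using t by (simp add: tr_def)
  have "mv h t c = t c" if h: "h \<in> H" "c \<in> E" for h c
  proof -
    have hc: "h \<in> carrier G" using h H sub_carr by blast
    have "mv h t c \<in> c" using mv_tr[OF hc tt] h by (simp add: tr_def)
    moreover have "mv h t c \<in> H" unfolding mv_def using h hc H t[of "act (inv h) c"] act_E
      by (simp add: subgroup.m_closed)
    moreover have "t c \<in> c" "t c \<in> H" using t[OF h(2)] by auto
    ultimately have "mv h t c \<otimes> inv (t c) \<in> H \<inter> N"
      using E_div[OF h(2)] subgroup.m_closed[OF H(1)] subgroup.m_inv_closed[OF H(1)] by (intro IntI) simp_all
    hence "mv h t c \<otimes> inv (t c) = \<one>" using H by blast
    thus ?thesis using tr_carrier[OF tt h(2)] tr_carrier[OF mv_tr[OF hc tt] h(2)]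
      by (metis inv_closed inv_inv inv_equality)
  qed
  thus ?thesis using tt t by blast
qed

text \<open>A suitable n in N moves the transversal from H' to one whose \<open>D\<close>-value
  against that from H is trivial. Then H and the conjugate of H' by \<open>inv n\<close> both lie in
  \<open>Ker t\<close>; as \<open>Ker t\<close> meets N trivially, both are equal to it.\<close>

theorem complements_conjugate:
  assumes H: "subgroup H G" "H \<inter> N = {\<one>}" "N <#> H = carrier G"
    and H': "subgroup H' G" "H' \<inter> N = {\<one>}" "N <#> H' = carrier G"
  shows "\<exists>n\<in>N. cnj_set H' n = H"
proof -
  obtain t where t: "tr t" "\<forall>h\<in>H. \<forall>c\<in>E. mv h t c = t c" using tr_complement[OF H] by blast
  obtain s where s: "tr s" "\<forall>h\<in>H'. \<forall>c\<in>E. mv h s c = s c" using tr_complement[OF H'] by blast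
  have Hc: "H \<subseteq> carrier G" "H' \<subseteq> carrier G" using H(1) H'(1) by (auto simp: subgroup.subset)
  obtain n where n: "n \<in> N" "n [^] card E = inv (D s t)"
    using pow_E_surj[of "inv (D s t)"] sN D_closed[OF s(1) t(1)] by (auto simp: subgroup.m_inv_closed)
  let ?r = "mv n s"
  have r: "tr ?r" using mv_tr n s by (simp add: Nc)
  have rt: "D ?r t = \<one>"
    using D_trans[OF r s(1) t(1)] D_N[OF n(1) s(1)] n D_closed[OF s(1) t(1)] by (simp add: Nc)
  have tr': "D t ?r = \<one>"
    using D_trans[OF t(1) r t(1)] rt D_self[OF t(1)] D_closed[OF t(1) r] by (simp add: Nc)
  have HK: "H \<subseteq> Ker t"
  proof
    fix h assume h: "h \<in> H"
    have "D (mv h t) t = D t t" using h Hc t by (intro D_cong mv_tr) auto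
    thus "h \<in> Ker t" using h Hc D_self[OF t(1)] by (auto simp: Ker_def)
  qed
  have "g \<in> Ker t" if g: "g \<in> cnj_set H' (inv n)" for g
  proof -
    obtain h where h: "h \<in> H'" "g = cnj (inv n) h" using g by (auto simp: cnj_set_def)
    have c: "h \<in> carrier G" "g \<in> carrier G" "n \<in> carrier G" using h Hc n by (auto simp: Nc)
    have gn: "g \<otimes> n = n \<otimes> h" using h c by (simp add: cnj_def m_assoc)
    have e: "mv g ?r c = ?r c" if "c \<in> E" for c
    proof -
      have "mv g ?r c = mv (n \<otimes> h) s c" using c that s gn by (simp add: mv_mv)
      also have "\<dots> = mv n (mv h s) c" using c that s by (simp add: mv_mv)
      also have "\<dots> = mv n s c" using h s that act_E[of "inv n" c] c by (simp add: mv_def[of n])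
      finally show ?thesis .
    qed
    have ts: "tr (mv g t)" "tr (mv g ?r)" using c t r by (auto intro: mv_tr)
    \<comment> \<open>The first factor is a conjugate of \<open>D t ?r = \<one>\<close>; the second
      equals \<open>D ?r t\<close>, because g fixes \<open>?r\<close> on \<open>E\<close>.\<close>
    have "D (mv g t) t = D (mv g t) (mv g ?r) \<otimes> D (mv g ?r) t" using ts t by (simp add: D_trans)
    also have "D (mv g t) (mv g ?r) = \<one>" using D_mv[OF c(2) t(1) r] tr' c by simp
    also have "D (mv g ?r) t = D ?r t" using e ts t r by (intro D_cong) auto
    finally show ?thesis using rt c by (simp add: Ker_def)
  qed
  hence H'K: "cnj_set H' (inv n) \<subseteq> Ker t" by blast
  have Kc: "Ker t \<subseteq> carrier G" using subgroup_Ker[OF t(1)] by (rule subgroup.subset)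
  have K: "X = Ker t" if X: "subgroup X G" "X \<subseteq> Ker t" "X <#> N = carrier G" for X
  proof -
    have "Ker t = Ker t \<inter> (X <#> N)" using X(3) Kc by auto
    also have "\<dots> = X <#> (Ker t \<inter> N)"
      using X subgroup_Ker[OF t(1)] sN by (intro dedekind) (auto simp: subgroup.subset)
    also have "\<dots> = X" using Ker_N[OF t(1)] subgroup.subset[OF X(1)] by (force simp: set_mult_def)
    finally show ?thesis ..
  qed
  have nc: "n \<in> carrier G" using n by (simp add: Nc)
  have sw: "X <#> N = carrier G" if "subgroup X G" "N <#> X = carrier G" for X
    using normal_in_join(2)[OF nN that(1)] that subgroup.subset by auto
  have "H = Ker t" using K[OF H(1) HK sw[OF H(1,3)]] .
  moreover have "cnj_set H' (inv n) = Ker t"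
  proof (rule K[OF subgroup_cnj_set[OF H'(1)] H'K sw[OF subgroup_cnj_set[OF H'(1)]]])
    have "N <#> cnj_set H' (inv n) = cnj_set N (inv n) <#> cnj_set H' (inv n)"
      using normal_in_cnj_set[OF nN, of "inv n"] nc by simp
    also have "\<dots> = cnj_set (carrier G) (inv n)" using cnj_set_set_mult[of "inv n" N H'] nc H' Hc sN
      by (simp add: subgroup.subset)
    finally show "N <#> cnj_set H' (inv n) = carrier G" using cnj_set_self[OF subgroup_self, of "inv n"] nc by simp
  qed (use nc in auto)
  ultimately have "cnj_set H' (inv n) = H" by simp
  thus ?thesis using n sN by (intro bexI[of _ "inv n"]) (auto simp: subgroup.m_inv_closed)
qed

end

section \<open>Complements in sections X/M\<close>

context fin_group
begin

text \<open>Says that T/M is a complement of Y/M in X/M, in terms of preimages.\<close>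

definition complement :: "'a set \<Rightarrow> 'a set \<Rightarrow> 'a set \<Rightarrow> 'a set \<Rightarrow> bool" where
  "complement M Y X T \<longleftrightarrow> subgroup T G \<and> M \<subseteq> T \<and> T \<subseteq> X \<and> T \<inter> Y = M \<and> Y <#> T = X"

lemma complement_index:
  assumes "normal_in Y X" "complement M Y X T" "subgroup M G"
  shows "index T M = index X Y" "index X T = index Y M"
proof -
  have s: "subgroup Y G" "subgroup X G" "subgroup T G" "Y \<subseteq> X" "T \<subseteq> X" "M \<subseteq> T" "M \<subseteq> Y"
    using assms by (auto simp: normal_in_def complement_def)
  have 1: "card X * card M = card Y * card T"
    using card_set_mult[OF s(1,3)] assms by (simp add: complement_def Int_commute)
  have T: "card T = index T M * card M" "card X = index X Y * card Y" "card X = index X T * card T" "card Y = index Y M * card M"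
    using s assms(3) by (auto intro: index_mult)
  have p: "card M > 0" "card Y > 0" "card T > 0" using s assms card_sub_pos by auto
  have "index X Y * (card Y * card M) = index T M * (card Y * card M)"
    using 1 by (subst (asm) T(2), subst (asm) T(1)) (simp add: ac_simps)
  thus "index T M = index X Y" using p by simp
  have "index X T * (card T * card M) = index Y M * (card T * card M)"
    using 1 by (subst (asm) T(3), subst (asm) T(4)) (simp add: ac_simps)
  thus "index X T = index Y M" using p by simp
qed

lemma complement_cnj_set:
  assumes "normal_in M L" "normal_in Y L" "normal_in X L" "complement M Y X T" "x \<in> L" shows "complement M Y X (cnj_set T x)"
proof -
  have s: "subgroup Y G" "subgroup X G" "subgroup T G" "T \<subseteq> X" "M \<subseteq> T" "subgroup L G"
    using assms by (auto simp: normal_in_def complement_def)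
  have xc: "x \<in> carrier G" using s assms sub_carr by blast
  have c: "T \<subseteq> carrier G" "Y \<subseteq> carrier G" using s by (auto simp: subgroup.subset)
  have e: "cnj_set M x = M" "cnj_set Y x = Y" "cnj_set X x = X" using assms normal_in_cnj_set by auto
  have "M \<subseteq> cnj_set T x" using cnj_set_mono[OF s(5), of x] e by simp
  moreover have "cnj_set T x \<subseteq> X" using cnj_set_mono[OF s(4), of x] e by simp
  moreover have "cnj_set T x \<inter> Y = M" using cnj_set_Int[OF xc c] e assms by (simp add: complement_def)
  moreover have "Y <#> cnj_set T x = X" using cnj_set_set_mult[OF xc c(2,1)] e assms by (simp add: complement_def)
  ultimately show ?thesis using s subgroup_cnj_set xc by (simp add: complement_def)
qed

text \<open>The dictionary between cosets of M and elements of X, for arguments that have to be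
  carried out in X/M.\<close>

lemma quotient_context:
  assumes "normal_in M X"
  shows "fin_group (G\<lparr>carrier := X\<rparr> Mod M)"
    and "\<And>x. x \<in> X \<Longrightarrow> M #> x \<in> carrier (G\<lparr>carrier := X\<rparr> Mod M)"
    and "\<And>c. c \<in> carrier (G\<lparr>carrier := X\<rparr> Mod M) \<Longrightarrow> \<exists>x\<in>X. c = M #> x"
    and "\<And>x y. x \<in> X \<Longrightarrow> y \<in> X \<Longrightarrow> (M #> x) \<otimes>\<^bsub>G\<lparr>carrier := X\<rparr> Mod M\<^esub> (M #> y) = M #> (x \<otimes> y)"
    and "\<And>x. x \<in> X \<Longrightarrow> inv\<^bsub>G\<lparr>carrier := X\<rparr> Mod M\<^esub> (M #> x) = M #> inv x"
    and "\<And>x. x \<in> X \<Longrightarrow> M #> x = \<one>\<^bsub>G\<lparr>carrier := X\<rparr> Mod M\<^esub> \<longleftrightarrow> x \<in> M"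
proof -
  have L: "subgroup X G" "subgroup M G" "M \<subseteq> X" using assms by (auto simp: normal_in_def)
  let ?X = "G\<lparr>carrier := X\<rparr>"
  let ?Q = "?X Mod M"
  interpret L: group ?X using L by (simp add: subgroup_imp_group)
  have nN: "M \<lhd> ?X" using assms normal_iff_normal_in L by blast
  interpret N: normal M ?X by (fact nN)
  interpret Q: group ?Q by (rule N.factorgroup_is_group)
  show "fin_group ?Q" using L by unfold_locales (auto simp: carrier_FactGroup)
  show C: "\<And>x. x \<in> X \<Longrightarrow> M #> x \<in> carrier ?Q" by (auto simp: carrier_FactGroup)
  show "\<And>c. c \<in> carrier ?Q \<Longrightarrow> \<exists>x\<in>X. c = M #> x" by (auto simp: carrier_FactGroup)
  show m: "(M #> x) \<otimes>\<^bsub>?Q\<^esub> (M #> y) = M #> (x \<otimes> y)" if "x \<in> X" "y \<in> X" for x y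
    using N.rcos_sum[of x y] that by simp
  show one: "M #> x = \<one>\<^bsub>?Q\<^esub> \<longleftrightarrow> x \<in> M" if "x \<in> X" for x
  proof
    assume "M #> x = \<one>\<^bsub>?Q\<^esub>"
    thus "x \<in> M" using rcos_self[OF _ L(2), of x] that L by (simp add: sub_carr)
  next
    assume "x \<in> M"
    thus "M #> x = \<one>\<^bsub>?Q\<^esub>" using coset_join2[OF _ L(2), of x] that L by (simp add: sub_carr)
  qed
  show "inv\<^bsub>?Q\<^esub> (M #> x) = M #> inv x" if x: "x \<in> X" for x
  proof (rule Q.inv_equality)
    have "inv x \<in> X" using x L by (simp add: subgroup.m_inv_closed)
    thus "M #> inv x \<in> carrier ?Q" "M #> x \<in> carrier ?Q" using C x by auto
    show "(M #> inv x) \<otimes>\<^bsub>?Q\<^esub> (M #> x) = \<one>\<^bsub>?Q\<^esub>"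
      using m[OF \<open>inv x \<in> X\<close> x] x L one[of \<one>] by (simp add: sub_carr subgroup.one_closed)
  qed
qed

lemma quotient_subgroup:
  assumes "normal_in M X" "subgroup H (G\<lparr>carrier := X\<rparr> Mod M)"
  shows "subgroup {x \<in> X. M #> x \<in> H} G"
proof (rule subgroupI)
  note q = quotient_context[OF assms(1)]
  have L: "subgroup X G" "subgroup M G" "M \<subseteq> X" using assms by (auto simp: normal_in_def)
  show "{x \<in> X. M #> x \<in> H} \<subseteq> carrier G" using L by (auto simp: sub_carr)
  have "M #> \<one> \<in> H" using q(6)[of \<one>] L subgroup.one_closed[OF assms(2)]
    by (auto simp: subgroup.one_closed)
  thus "{x \<in> X. M #> x \<in> H} \<noteq> {}" using L by (auto intro: subgroup.one_closed)
  show "inv a \<in> {x \<in> X. M #> x \<in> H}" if "a \<in> {x \<in> X. M #> x \<in> H}" for a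
    using that q(5)[of a] subgroup.m_inv_closed[OF assms(2), of "M #> a"] L
    by (auto simp: subgroup.m_inv_closed)
  show "a \<otimes> b \<in> {x \<in> X. M #> x \<in> H}" if "a \<in> {x \<in> X. M #> x \<in> H}" "b \<in> {x \<in> X. M #> x \<in> H}" for a b
    using that q(4)[of a b] subgroup.m_closed[OF assms(2), of "M #> a" "M #> b"] L
    by (auto simp: subgroup.m_closed)
qed

lemma quotient_image:
  assumes "normal_in M X" "subgroup T G" "T \<subseteq> X"
  shows "subgroup ((\<lambda>x. M #> x) ` T) (G\<lparr>carrier := X\<rparr> Mod M)"
proof -
  note q = quotient_context[OF assms(1)]
  interpret Q: fin_group "G\<lparr>carrier := X\<rparr> Mod M" by (rule q(1))
  show ?thesis
  proof (rule Q.subgroupI)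
    show "(\<lambda>x. M #> x) ` T \<subseteq> carrier (G\<lparr>carrier := X\<rparr> Mod M)" using q(2) assms by auto
    show "(\<lambda>x. M #> x) ` T \<noteq> {}" using subgroup.one_closed[OF assms(2)] by auto
    show "inv\<^bsub>G\<lparr>carrier := X\<rparr> Mod M\<^esub> a \<in> (\<lambda>x. M #> x) ` T" if "a \<in> (\<lambda>x. M #> x) ` T" for a
      using that q(5) assms by (auto simp: subset_iff subgroup.m_inv_closed)
    show "a \<otimes>\<^bsub>G\<lparr>carrier := X\<rparr> Mod M\<^esub> b \<in> (\<lambda>x. M #> x) ` T"
      if "a \<in> (\<lambda>x. M #> x) ` T" "b \<in> (\<lambda>x. M #> x) ` T" for a b
    proof -
      from that obtain x y where "x \<in> T" "y \<in> T" "a = M #> x" "b = M #> y" by blast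
      thus ?thesis using q(4)[of x y] assms by (auto simp: subgroup.m_closed subset_iff)
    qed
  qed
qed

lemma quotient_image_mem:
  assumes "normal_in M X" "subgroup T G" "M \<subseteq> T" "T \<subseteq> X" "x \<in> X" "M #> x \<in> (\<lambda>x. M #> x) ` T"
  shows "x \<in> T"
proof -
  obtain t where t: "t \<in> T" "M #> x = M #> t" using assms by blast
  have "x \<in> M #> x" using assms by (intro rcos_self) (auto simp: normal_in_def sub_carr)
  then obtain m where "m \<in> M" "x = m \<otimes> t" using t by (auto simp: r_coset_def)
  thus ?thesis using t assms by (auto simp: subgroup.m_closed)
qed

lemma quotient_abelian:
  assumes M: "normal_in M X" and Y: "normal_in Y X" "M \<subseteq> Y" and ab: "\<And>a b. a \<in> Y \<Longrightarrow> b \<in> Y \<Longrightarrow> commut a b \<in> M"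
    and cop: "coprime (index Y M) (index X Y)"
  shows "coprime_abelian_normal (G\<lparr>carrier := X\<rparr> Mod M) ((\<lambda>x. M #> x) ` Y)"
proof -
  note q = quotient_context[OF M]
  let ?Q = "G\<lparr>carrier := X\<rparr> Mod M"
  interpret Q: fin_group ?Q by (rule q(1))
  have s: "subgroup Y G" "subgroup X G" "subgroup M G" "Y \<subseteq> X" "M \<subseteq> X"
    using assms by (auto simp: normal_in_def)
  have MY: "normal_in M Y" using normal_in_sub[OF M s(1) Y(2) s(4)] .
  have cX: "card (carrier ?Q) = index X M" using order_Mod[OF M] by (simp add: order_def)
  have "(\<lambda>x. M #> x) ` Y = carrier (G\<lparr>carrier := Y\<rparr> Mod M)" by (auto simp: carrier_FactGroup)
  hence cY: "card ((\<lambda>x. M #> x) ` Y) = index Y M" using order_Mod[OF MY] by (simp add: order_def)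
  have "index X M = index X Y * index Y M" using s Y by (intro index_trans) auto
  hence iQ: "Q.index (carrier ?Q) ((\<lambda>x. M #> x) ` Y) = index X Y"
    using cX cY index_pos[OF s(3,1) Y(2)] by (simp add: Q.index_def)
  have sY: "subgroup ((\<lambda>x. M #> x) ` Y) ?Q" using quotient_image[OF M s(1,4)] .
  show ?thesis
  proof (unfold coprime_abelian_normal_def coprime_abelian_normal_axioms_def, intro conjI allI impI)
    show "fin_group ?Q" by (rule q(1))
    show "Q.normal_in ((\<lambda>x. M #> x) ` Y) (carrier ?Q)"
    proof (rule Q.nrmI[OF sY Q.subgroup_self subgroup.subset[OF sY]])
      fix c assume "c \<in> carrier ?Q"
      then obtain x where x: "x \<in> X" "c = M #> x" using q(3) by blast
      have "Q.cnj c (M #> y) \<in> (\<lambda>x. M #> x) ` Y" if y: "y \<in> Y" for y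
      proof -
        have i: "inv x \<in> X" "y \<in> X" "inv x \<otimes> y \<in> X"
          using x y s by (auto simp: subgroup.m_inv_closed subgroup.m_closed subset_iff)
        have "Q.cnj c (M #> y) = M #> cnj x y" unfolding Q.cnj_def cnj_def
          using x q(5)[OF x(1)] q(4)[OF i(1,2)] q(4)[OF i(3) x(1)] by (simp del: mult_FactGroup)
        thus ?thesis using normal_in_cnj[OF Y(1) x(1) y] by auto
      qed
      thus "conj_set ?Q ((\<lambda>x. M #> x) ` Y) c \<subseteq> (\<lambda>x. M #> x) ` Y"
        by (auto simp: Q.cnj_set_def)
    qed
    show "coprime (card ((\<lambda>x. M #> x) ` Y)) (Q.index (carrier ?Q) ((\<lambda>x. M #> x) ` Y))"
      using cop cY iQ by simp
    fix a b assume "a \<in> (\<lambda>x. M #> x) ` Y" "b \<in> (\<lambda>x. M #> x) ` Y"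
    then obtain x y where xy: "x \<in> Y" "y \<in> Y" "a = M #> x" "b = M #> y" by blast
    have c: "x \<in> carrier G" "y \<in> carrier G" "x \<in> X" "y \<in> X" using xy s by (auto simp: sub_carr)
    have "cnj (inv (y \<otimes> x)) (commut x y) \<in> M"
      using normal_in_cnj[OF MY _ ab[OF xy(1,2)]] xy s by (auto simp: subgroup.m_closed subgroup.m_inv_closed)
    hence "x \<otimes> y \<otimes> inv (y \<otimes> x) \<in> M" using c by (simp add: cnj_def commut_def m_assoc inv_mult_group)
    hence "M #> (x \<otimes> y) = M #> (y \<otimes> x)" using coset_eq_iff[OF s(3)] c by simp
    thus "a \<otimes>\<^bsub>?Q\<^esub> b = b \<otimes>\<^bsub>?Q\<^esub> a" using xy q(4)[OF c(3,4)] q(4)[OF c(4,3)] by simp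
  qed
qed

lemma complement_ex_abelian:
  assumes M: "normal_in M X" and Y: "normal_in Y X" "M \<subseteq> Y" and ab: "\<And>a b. a \<in> Y \<Longrightarrow> b \<in> Y \<Longrightarrow> commut a b \<in> M"
    and cop: "coprime (index Y M) (index X Y)"
  shows "\<exists>T. complement M Y X T"
proof -
  note q = quotient_context[OF M]
  let ?Q = "G\<lparr>carrier := X\<rparr> Mod M"
  interpret Q: coprime_abelian_normal ?Q "(\<lambda>x. M #> x) ` Y" by (rule quotient_abelian[OF assms])
  have s: "subgroup Y G" "subgroup X G" "subgroup M G" "Y \<subseteq> X" "M \<subseteq> X"
    using assms by (auto simp: normal_in_def)
  obtain H where H: "subgroup H ?Q" "H \<inter> (\<lambda>x. M #> x) ` Y = {\<one>\<^bsub>?Q\<^esub>}"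
    "(\<lambda>x. M #> x) ` Y <#>\<^bsub>?Q\<^esub> H = carrier ?Q" using Q.complement_exists by blast
  let ?T = "{x \<in> X. M #> x \<in> H}"
  have T: "subgroup ?T G" using quotient_subgroup[OF M H(1)] .
  have MT: "M \<subseteq> ?T"
  proof
    fix m assume "m \<in> M"
    hence "M #> m = \<one>\<^bsub>?Q\<^esub>" "m \<in> X" using q(6)[of m] s by auto
    thus "m \<in> ?T" using subgroup.one_closed[OF H(1)] by simp
  qed
  have TY: "?T \<inter> Y \<subseteq> M"
  proof
    fix x assume x: "x \<in> ?T \<inter> Y"
    hence "M #> x \<in> H \<inter> (\<lambda>x. M #> x) ` Y" by blast
    hence "M #> x = \<one>\<^bsub>?Q\<^esub>" using H(2) by blast
    thus "x \<in> M" using q(6)[of x] x by blast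
  qed
  have "X \<subseteq> Y <#> ?T"
  proof
    fix x assume x: "x \<in> X"
    have "M #> x \<in> (\<lambda>x. M #> x) ` Y <#>\<^bsub>?Q\<^esub> H" using q(2)[OF x] unfolding H(3) .
    then obtain y h where y: "y \<in> Y" "h \<in> H" "M #> x = (M #> y) \<otimes>\<^bsub>?Q\<^esub> h"
      by (elim Q.set_multE) blast
    have i: "inv y \<in> X" "y \<in> X" "y \<in> carrier G" "x \<in> carrier G" using y x s by (auto simp: subgroup.m_inv_closed sub_carr subset_iff)
    have "h \<in> carrier ?Q" using y(2) H(1) by (rule subgroup.mem_carrier[rotated])
    hence "h = inv\<^bsub>?Q\<^esub> (M #> y) \<otimes>\<^bsub>?Q\<^esub> (M #> x)"
      using y(3) q(2)[OF i(2)] by (simp del: mult_FactGroup)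
    hence "h = M #> (inv y \<otimes> x)" using q(5)[OF i(2)] q(4)[OF i(1) x] by simp
    hence "inv y \<otimes> x \<in> ?T" using y i x s by (simp add: subgroup.m_closed)
    moreover have "x = y \<otimes> (inv y \<otimes> x)" using i by simp
    ultimately show "x \<in> Y <#> ?T" using y set_multI by metis
  qed
  moreover have "Y <#> ?T \<subseteq> X" using s by (intro set_mult_least) auto
  ultimately have "complement M Y X ?T" using T MT TY Y by (auto simp: complement_def)
  thus ?thesis by blast
qed

lemma complement_quotient:
  assumes M: "normal_in M X" and Y: "normal_in Y X" and T: "complement M Y X T"
  defines "Q \<equiv> G\<lparr>carrier := X\<rparr> Mod M"
  shows "subgroup ((\<lambda>x. M #> x) ` T) Q" "(\<lambda>x. M #> x) ` T \<inter> (\<lambda>x. M #> x) ` Y = {\<one>\<^bsub>Q\<^esub>}"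
    "(\<lambda>x. M #> x) ` Y <#>\<^bsub>Q\<^esub> (\<lambda>x. M #> x) ` T = carrier Q"
proof -
  note q = quotient_context[OF M, folded Q_def]
  interpret Q: fin_group Q by (rule q(1))
  have s: "subgroup Y G" "subgroup X G" "subgroup M G" "Y \<subseteq> X" "M \<subseteq> X" "subgroup T G" "T \<subseteq> X" "M \<subseteq> T" "M \<subseteq> Y"
    using assms by (auto simp: normal_in_def complement_def)
  show sT: "subgroup ((\<lambda>x. M #> x) ` T) Q" using quotient_image[OF M s(6,7)] by (simp add: Q_def)
  have sY: "subgroup ((\<lambda>x. M #> x) ` Y) Q" using quotient_image[OF M s(1,4)] by (simp add: Q_def)
  have "c = \<one>\<^bsub>Q\<^esub>" if "c \<in> (\<lambda>x. M #> x) ` T \<inter> (\<lambda>x. M #> x) ` Y" for c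
  proof -
    from that obtain t where t: "t \<in> T" "c = M #> t" "M #> t \<in> (\<lambda>x. M #> x) ` Y" by blast
    hence "t \<in> Y" using quotient_image_mem[OF M s(1,9,4), of t] s by blast
    hence "t \<in> M" using t T by (auto simp: complement_def)
    thus ?thesis using q(6)[of t] t s by blast
  qed
  thus "(\<lambda>x. M #> x) ` T \<inter> (\<lambda>x. M #> x) ` Y = {\<one>\<^bsub>Q\<^esub>}"
    using subgroup.one_closed[OF sT] subgroup.one_closed[OF sY] by blast
  show "(\<lambda>x. M #> x) ` Y <#>\<^bsub>Q\<^esub> (\<lambda>x. M #> x) ` T = carrier Q"
  proof
    show "(\<lambda>x. M #> x) ` Y <#>\<^bsub>Q\<^esub> (\<lambda>x. M #> x) ` T \<subseteq> carrier Q"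
      using sT sY by (intro Q.setmult_subset_G) (auto dest: subgroup.subset)
    show "carrier Q \<subseteq> (\<lambda>x. M #> x) ` Y <#>\<^bsub>Q\<^esub> (\<lambda>x. M #> x) ` T"
    proof
      fix c assume "c \<in> carrier Q"
      then obtain x where x: "x \<in> X" "c = M #> x" using q(3) by blast
      then obtain y t where yt: "y \<in> Y" "t \<in> T" "x = y \<otimes> t" using T unfolding complement_def
        by (metis set_multE)
      have "y \<in> X" "t \<in> X" using yt s by auto
      hence "c = (M #> y) \<otimes>\<^bsub>Q\<^esub> (M #> t)" using q(4)[of y t] x yt by simp
      thus "c \<in> (\<lambda>x. M #> x) ` Y <#>\<^bsub>Q\<^esub> (\<lambda>x. M #> x) ` T"
        using Q.set_multI[OF imageI[OF yt(1)] imageI[OF yt(2)]] by simp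
    qed
  qed
qed

lemma complement_conj_abelian:
  assumes M: "normal_in M X" and Y: "normal_in Y X" "M \<subseteq> Y" and ab: "\<And>a b. a \<in> Y \<Longrightarrow> b \<in> Y \<Longrightarrow> commut a b \<in> M"
    and cop: "coprime (index Y M) (index X Y)" and T: "complement M Y X T" "complement M Y X T'"
  shows "\<exists>y\<in>Y. cnj_set T' y = T"
proof -
  note q = quotient_context[OF M]
  let ?Q = "G\<lparr>carrier := X\<rparr> Mod M"
  interpret Q: coprime_abelian_normal ?Q "(\<lambda>x. M #> x) ` Y" by (rule quotient_abelian[OF assms(1-5)])
  have s: "subgroup Y G" "subgroup X G" "subgroup M G" "Y \<subseteq> X" "M \<subseteq> X" "subgroup T G" "T \<subseteq> X" "M \<subseteq> T"
     "subgroup T' G" "T' \<subseteq> X" "M \<subseteq> T'"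
    using assms by (auto simp: normal_in_def complement_def)
  obtain c where "c \<in> (\<lambda>x. M #> x) ` Y" "conj_set ?Q ((\<lambda>x. M #> x) ` T') c = (\<lambda>x. M #> x) ` T"
    using Q.complements_conjugate[OF complement_quotient[OF M Y(1) T(1)] complement_quotient[OF M Y(1) T(2)]] by blast
  then obtain y where y: "y \<in> Y" "conj_set ?Q ((\<lambda>x. M #> x) ` T') (M #> y) = (\<lambda>x. M #> x) ` T" by blast
  have yc: "y \<in> X" "y \<in> carrier G" "inv y \<in> X" using y s by (auto simp: sub_carr subgroup.m_inv_closed subset_iff)
  have "cnj y t \<in> T" if t: "t \<in> T'" for t
  proof -
    have i: "t \<in> X" "inv y \<otimes> t \<in> X" "cnj y t \<in> X"
      using t yc s by (auto simp: subgroup.m_inv_closed subgroup.m_closed subset_iff cnj_def)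
    have "Q.cnj (M #> y) (M #> t) = M #> cnj y t" unfolding Q.cnj_def cnj_def
      using q(5)[OF yc(1)] q(4)[OF yc(3) i(1)] q(4)[OF i(2) yc(1)] by (simp del: mult_FactGroup)
    moreover have "Q.cnj (M #> y) (M #> t) \<in> (\<lambda>x. M #> x) ` T" using y(2) t unfolding Q.cnj_set_def by blast
    ultimately show ?thesis using quotient_image_mem[OF M s(6,8,7) i(3)] by simp
  qed
  hence "cnj_set T' y \<subseteq> T" by (auto simp: cnj_set_def)
  moreover have "card (cnj_set T' y) = card T"
  proof -
    have "card T' = card T"
      using complement_index[OF Y(1) T(1) s(3)] complement_index[OF Y(1) T(2) s(3)] s
      by (metis index_mult)
    thus ?thesis using card_cnj_set[OF yc(2)] s by (simp add: subgroup.subset)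
  qed
  ultimately have "cnj_set T' y = T" using s by (intro card_subset_eq) auto
  thus ?thesis using y by blast
qed

text \<open>Modulo M, the q-group coming from P meets the q'-group Y/M trivially, and comparing
  indices shows that together they give X. A complement containing P contains
  \<open>M <#> P\<close>, with an index that is both a q-number and a q'-number.\<close>

lemma complement_sylow:
  assumes M: "normal_in M X" and Y: "normal_in Y X" "M \<subseteq> Y" and q: "prime q" "pi_num {q} (index X Y)" "pi_num (-{q}) (index Y M)"
    and P: "sylow_in q X P"
  shows "complement M Y X (M <#> P)"
    and "complement M Y X T \<Longrightarrow> P \<subseteq> T \<Longrightarrow> T = M <#> P"
proof -
  have s: "subgroup Y G" "subgroup X G" "subgroup M G" "Y \<subseteq> X" "M \<subseteq> X" "subgroup P G" "P \<subseteq> X"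
    using assms by (auto simp: normal_in_def sylow_in_def)
  note j = normal_in_join[OF M s(6,7)]
  note k = normal_in_join[OF Y(1) s(6,7)]
  have iP: "pi_num {q} (index (M <#> P) M)"
  proof -
    have "card (M <#> P) * card (M \<inter> P) = card M * card P" using card_set_mult s by blast
    moreover have "card (M <#> P) = index (M <#> P) M * card M" using j s by (intro index_mult) auto
    ultimately have "index (M <#> P) M * card (M \<inter> P) = card P" using card_sub_pos[OF s(3)] by simp
    thus ?thesis using P pi_num_dvd unfolding sylow_in_def by (metis dvd_triv_left)
  qed
  have "(M <#> P) \<inter> Y = M"
  proof (rule index_1[symmetric])
    show "subgroup M G" "subgroup ((M <#> P) \<inter> Y) G" "M \<subseteq> (M <#> P) \<inter> Y"
      using s j Y by (auto intro: subgroups_Inter_pair)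
    hence "index (M <#> P) M = index (M <#> P) ((M <#> P) \<inter> Y) * index ((M <#> P) \<inter> Y) M"
      "index Y M = index Y ((M <#> P) \<inter> Y) * index ((M <#> P) \<inter> Y) M"
      using j s by (auto intro!: index_trans)
    hence "pi_num {q} (index ((M <#> P) \<inter> Y) M)" "pi_num (-{q}) (index ((M <#> P) \<inter> Y) M)"
      using iP q(3) by (simp_all add: pi_num_mult)
    thus "index ((M <#> P) \<inter> Y) M = 1" by (rule pi_num_both)
  qed
  moreover have "Y <#> (M <#> P) = X"
  proof -
    have "Y <#> (M <#> P) = Y <#> P"
    proof -
      have "Y <#> (M <#> P) = (Y <#> M) <#> P" using s by (intro set_mult_assoc[symmetric]) (auto simp: subgroup.subset)
      moreover have "Y <#> M = Y" using Y s subgroup_incl[OF s(3) s(1) Y(2)] by (intro set_mult_subgroup_idem)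
      ultimately show ?thesis by simp
    qed
    also have "Y <#> P = X"
    proof (rule index_1[OF k(1) s(2) k(5)])
      have "index X Y = index X (Y <#> P) * index (Y <#> P) Y" "index X P = index X (Y <#> P) * index (Y <#> P) P"
        using k s by (auto intro!: index_trans)
      hence "pi_num {q} (index X (Y <#> P))" "pi_num (-{q}) (index X (Y <#> P))"
        using q P by (simp_all add: sylow_in_def pi_num_mult)
      thus "index X (Y <#> P) = 1" by (rule pi_num_both)
    qed
    finally show ?thesis .
  qed
  ultimately show "complement M Y X (M <#> P)" using j by (simp add: complement_def)
  show "T = M <#> P" if T: "complement M Y X T" "P \<subseteq> T"
  proof -
    have sT: "subgroup T G" "M \<subseteq> T" "T \<subseteq> X" using T by (auto simp: complement_def)
    have MT: "M <#> P \<subseteq> T" using T sT by (intro set_mult_least) auto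
    have "index T M = index T (M <#> P) * index (M <#> P) M" "index X P = index X T * index T P"
       "index T P = index T (M <#> P) * index (M <#> P) P"
      using MT j s sT T by (auto intro!: index_trans)
    hence "pi_num {q} (index T (M <#> P))" "pi_num (-{q}) (index T (M <#> P))"
      using q P complement_index(1)[OF Y(1) T(1) s(3)] by (simp_all add: sylow_in_def pi_num_mult)
    hence "index T (M <#> P) = 1" by (rule pi_num_both)
    thus ?thesis using index_1[OF j(1) sT(1) MT] by simp
  qed
qed

text \<open>The two complements contain Sylow q-subgroups of X; these are conjugate, and each
  determines its complement.\<close>

lemma complement_conj_sylow:
  assumes M: "normal_in M X" and Y: "normal_in Y X" "M \<subseteq> Y" and q: "prime q" "pi_num {q} (index X Y)" "pi_num (-{q}) (index Y M)"
    and T: "complement M Y X T" "complement M Y X T'"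
  shows "\<exists>y\<in>Y. cnj_set T' y = T"
proof -
  have s: "subgroup Y G" "subgroup X G" "subgroup M G" "Y \<subseteq> X" "M \<subseteq> X" "subgroup T G" "T \<subseteq> X" "M \<subseteq> T"
     "subgroup T' G" "T' \<subseteq> X" "M \<subseteq> T'"
    using assms by (auto simp: normal_in_def complement_def)
  have ex: "\<exists>P. sylow_in q X P \<and> P \<subseteq> S" if "complement M Y X S" for S
  proof -
    have S: "subgroup S G" "S \<subseteq> X" using that by (auto simp: complement_def)
    obtain P where P: "sylow_in q S P" using sylow_in_ex q S by blast
    have "index X P = index X S * index S P" using S P s by (intro index_trans) (auto simp: sylow_in_def)
    hence "pi_num (-{q}) (index X P)" using P complement_index(2)[OF Y(1) that s(3)] q by (simp add: sylow_in_def pi_num_mult)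
    thus ?thesis using P S by (auto simp: sylow_in_def)
  qed
  obtain P P' where P: "sylow_in q X P" "P \<subseteq> T" "sylow_in q X P'" "P' \<subseteq> T'" using ex T by metis
  obtain x where x: "x \<in> X" "cnj_set P' x = P" using sylow_in_conj[OF s(2) q(1) P(3,1)] by blast
  have xc: "x \<in> carrier G" using x s sub_carr by blast
  have "cnj_set T' x = T"
  proof -
    have "complement M Y X (cnj_set T' x)" using complement_cnj_set[OF M Y(1) normal_in_self[OF s(2)] T(2) x(1)] .
    moreover have "P \<subseteq> cnj_set T' x" using cnj_set_mono[OF P(4), of x] x by simp
    ultimately have "cnj_set T' x = M <#> P" using complement_sylow(2)[OF M Y q P(1)] by blast
    thus ?thesis using complement_sylow(2)[OF M Y q P(1) T(1) P(2)] by simp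
  qed
  \<comment> \<open>Write x = t y with t in T'. As t normalizes T', the factor y in Y alone carries
    T' to T.\<close>
  moreover have "x \<in> T' <#> Y"
    using normal_in_join(2)[OF Y(1) s(9,10)] x T by (simp add: complement_def)
  then obtain t y where ty: "t \<in> T'" "y \<in> Y" "x = t \<otimes> y" by (rule set_multE)
  moreover have "cnj_set T' (t \<otimes> y) = cnj_set (cnj_set T' t) y"
    using ty s by (intro cnj_set_cnj_set[symmetric]) (auto simp: sub_carr subgroup.subset)
  ultimately show ?thesis using cnj_set_self[OF s(9) ty(1)] by auto
qed

text \<open>Either Y/M is abelian and the argument with transversals applies, or X/Y is a q-group
  and a Sylow subgroup gives the complement.\<close>

lemma complement_ex:
  assumes M: "normal_in M X" and Y: "normal_in Y X" "M \<subseteq> Y" and p: "pi_num \<sigma> (index X Y)" "pi_num (-\<sigma>) (index Y M)"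
    and c: "(\<forall>a\<in>Y. \<forall>b\<in>Y. commut a b \<in> M) \<or> (\<exists>q. prime q \<and> \<sigma> = {q})"
  shows "\<exists>T. complement M Y X T"
proof (cases "\<exists>q. prime q \<and> \<sigma> = {q}")
  case True
  then obtain q where q: "prime q" "\<sigma> = {q}" by blast
  have "subgroup X G" using M by (simp add: normal_in_def)
  then obtain P where "sylow_in q X P" using sylow_in_ex[OF q(1)] by blast
  thus ?thesis using complement_sylow(1)[OF M Y q(1)] p q by blast
next
  case False
  thus ?thesis using complement_ex_abelian[OF M Y] c pi_num_coprime[OF p] by (auto simp: coprime_commute)
qed

lemma complement_conj:
  assumes M: "normal_in M X" and Y: "normal_in Y X" "M \<subseteq> Y" and p: "pi_num \<sigma> (index X Y)" "pi_num (-\<sigma>) (index Y M)"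
    and c: "(\<forall>a\<in>Y. \<forall>b\<in>Y. commut a b \<in> M) \<or> (\<exists>q. prime q \<and> \<sigma> = {q})"
    and T: "complement M Y X T" "complement M Y X T'"
  shows "\<exists>y\<in>Y. cnj_set T' y = T"
proof (cases "\<exists>q. prime q \<and> \<sigma> = {q}")
  case True
  thus ?thesis using complement_conj_sylow[OF M Y _ _ _ T] p by blast
next
  case False
  thus ?thesis using complement_conj_abelian[OF M Y _ _ T] c pi_num_coprime[OF p] by (auto simp: coprime_commute)
qed

lemma ex_max_subgroup:
  assumes "P M" "\<And>X. P X \<Longrightarrow> subgroup X G"
  shows "\<exists>B. P B \<and> (\<forall>Y. P Y \<longrightarrow> card Y \<le> card B)"
proof (rule ex_has_greatest_nat[of P M card "Suc (card (carrier G))", OF assms(1)])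
  show "\<forall>Y. P Y \<longrightarrow> card Y < Suc (card (carrier G))"
    using assms(2) by (auto simp: less_Suc_eq_le intro!: card_mono dest: subgroup.subset)
qed

subsection \<open>The residual\<close>

text \<open>A finite group belongs to \<open>\<NN>\<^sup>\<pi>\<close> iff for every prime \<open>q\<close> outside \<open>\<pi>\<close> its \<open>q\<close>-elements commute with
  its \<open>q'\<close>-elements. So the subgroup generated by the corresponding commutators is the
  residual, and it is monotone in \<open>L\<close> by construction.\<close>

definition npi_comms :: "nat set \<Rightarrow> 'a set \<Rightarrow> 'a set" where
  "npi_comms \<pi> L = {commut x y | x y. x \<in> L \<and> y \<in> L \<and> (\<exists>q. prime q \<and> q \<notin> \<pi> \<and> pi_elem {q} x \<and> pi_elem (-{q}) y)}"

definition npi_res :: "nat set \<Rightarrow> 'a set \<Rightarrow> 'a set" where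
  "npi_res \<pi> L = generate G (npi_comms \<pi> L)"

lemma RsetI: "x \<in> L \<Longrightarrow> y \<in> L \<Longrightarrow> prime q \<Longrightarrow> q \<notin> \<pi> \<Longrightarrow> pi_elem {q} x \<Longrightarrow> pi_elem (-{q}) y \<Longrightarrow> commut x y \<in> npi_comms \<pi> L"
  by (auto simp: npi_comms_def)

lemma npi_comms_sub: "subgroup L G \<Longrightarrow> npi_comms \<pi> L \<subseteq> L"
  by (auto simp: npi_comms_def commut_in)

lemma npi_comms_carrier: "subgroup L G \<Longrightarrow> npi_comms \<pi> L \<subseteq> carrier G"
  using npi_comms_sub subgroup.subset by blast

lemma subgroup_npi_res: "subgroup L G \<Longrightarrow> subgroup (npi_res \<pi> L) G"
  unfolding npi_res_def by (intro generate_is_subgroup npi_comms_carrier)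

lemma npi_res_sub: "subgroup L G \<Longrightarrow> npi_res \<pi> L \<subseteq> L"
  unfolding npi_res_def by (intro generate_subgroup_incl npi_comms_sub)

lemma npi_res_mono: "A \<subseteq> B \<Longrightarrow> npi_res \<pi> A \<subseteq> npi_res \<pi> B"
  unfolding npi_res_def by (intro mono_generate) (auto simp: npi_comms_def)

lemma cnj_set_npi_res: assumes "x \<in> carrier G" "subgroup L G" shows "cnj_set (npi_res \<pi> L) x = npi_res \<pi> (cnj_set L x)"
proof -
  have *: "cnj_set (npi_comms \<pi> L) x \<subseteq> npi_comms \<pi> (cnj_set L x)" if "x \<in> carrier G" "subgroup L G" for x L
  proof
    fix z assume "z \<in> cnj_set (npi_comms \<pi> L) x"
    then obtain a b q where ab: "z = cnj x (commut a b)" "a \<in> L" "b \<in> L" "prime q" "q \<notin> \<pi>" "pi_elem {q} a" "pi_elem (-{q}) b"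
      by (auto simp: cnj_set_def npi_comms_def)
    have "z = commut (cnj x a) (cnj x b)" using ab that by (simp add: cnj_of_commut sub_carr)
    moreover have "cnj x a \<in> cnj_set L x" "cnj x b \<in> cnj_set L x" using ab by (auto simp: cnj_set_def)
    moreover have "pi_elem {q} (cnj x a)" "pi_elem (-{q}) (cnj x b)" using ab that pi_elem_cnj by blast+
    ultimately show "z \<in> npi_comms \<pi> (cnj_set L x)" using RsetI ab by metis
  qed
  have "npi_comms \<pi> (cnj_set L x) = cnj_set (cnj_set (npi_comms \<pi> (cnj_set L x)) (inv x)) x"
    using assms by (simp add: npi_comms_carrier subgroup_cnj_set)
  also have "\<dots> \<subseteq> cnj_set (npi_comms \<pi> (cnj_set (cnj_set L x) (inv x))) x"
    using assms by (intro cnj_set_mono *) (auto simp: subgroup_cnj_set)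
  also have "\<dots> = cnj_set (npi_comms \<pi> L) x" using assms by (simp add: subgroup.subset)
  finally have "npi_comms \<pi> (cnj_set L x) = cnj_set (npi_comms \<pi> L) x" using *[OF assms] by blast
  thus ?thesis unfolding npi_res_def using assms by (simp add: cnj_set_generate npi_comms_carrier)
qed

lemma normal_in_npi_res: "subgroup L G \<Longrightarrow> normal_in (npi_res \<pi> L) L"
  by (rule nrmI) (auto simp: subgroup_npi_res npi_res_sub cnj_set_npi_res sub_carr cnj_set_self dest: subsetD[OF npi_res_sub])

lemma npi_res_least: "subgroup M G \<Longrightarrow> (\<And>x y q. x \<in> L \<Longrightarrow> y \<in> L \<Longrightarrow> prime q \<Longrightarrow> q \<notin> \<pi> \<Longrightarrow> pi_elem {q} x \<Longrightarrow> pi_elem (-{q}) y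
    \<Longrightarrow> commut x y \<in> M) \<Longrightarrow> npi_res \<pi> L \<subseteq> M"
  unfolding npi_res_def by (rule generate_subgroup_incl) (auto simp: npi_comms_def)

lemma npi_res_commut: "x \<in> L \<Longrightarrow> y \<in> L \<Longrightarrow> prime q \<Longrightarrow> q \<notin> \<pi> \<Longrightarrow> pi_elem {q} x \<Longrightarrow> pi_elem (-{q}) y \<Longrightarrow> commut x y \<in> npi_res \<pi> L"
  unfolding npi_res_def by (intro generate.incl RsetI)

lemma coset_self_mem: "subgroup W G \<Longrightarrow> x \<in> carrier G \<Longrightarrow> W #> x = W #> y \<Longrightarrow> x \<in> W #> y"
  using rcos_self by blast

lemma quotient_commut:
  assumes W: "normal_in W X" and "a \<in> X" "b \<in> X"
  shows "W #> commut a b = group.commut (G\<lparr>carrier := X\<rparr> Mod W) (W #> a) (W #> b)"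
proof -
  note q = quotient_context[OF W]
  interpret Q: fin_group "G\<lparr>carrier := X\<rparr> Mod W" by (rule q(1))
  have X: "subgroup X G" using W by (simp add: normal_in_def)
  have i: "inv a \<in> X" "inv b \<in> X" "inv a \<otimes> inv b \<in> X" "inv a \<otimes> inv b \<otimes> a \<in> X"
    using assms X by (auto simp: subgroup.m_inv_closed subgroup.m_closed)
  show ?thesis unfolding commut_def Q.commut_def
    using q(5)[OF assms(2)] q(5)[OF assms(3)] q(4)[OF i(1,2)] q(4)[OF i(3) assms(2)] q(4)[OF i(4) assms(3)]
    by (simp del: mult_FactGroup)
qed

lemma commut_coset:
  assumes W: "normal_in W X" and x: "x \<in> X" "x' \<in> X" "W #> x = W #> x'" and y: "y \<in> X" "y' \<in> X" "W #> y = W #> y'"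
  shows "W #> commut x y = W #> commut x' y'"
  using quotient_commut[OF W x(1) y(1)] quotient_commut[OF W x(2) y(2)] x(3) y(3) by simp

lemma pow_coset:
  assumes W: "normal_in W X" and x: "x \<in> X" "x' \<in> X" "W #> x = W #> x'"
  shows "W #> x [^] (k::nat) = W #> x' [^] k"
proof (induction k)
  case (Suc k)
  note q = quotient_context[OF W]
  have X: "subgroup X G" using W by (simp add: normal_in_def)
  show ?case using q(4)[OF subgroup_pow[OF X x(1), of k] x(1)] q(4)[OF subgroup_pow[OF X x(2), of k] x(2)] Suc x(3)
    by simp
qed simp

lemma coset_mult_left: "subgroup W G \<Longrightarrow> w \<in> W \<Longrightarrow> x \<in> carrier G \<Longrightarrow> W #> (w \<otimes> x) = W #> x"
  by (subst coset_eq_iff) (simp_all add: sub_carr m_assoc)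

lemma coset_mem_iff: "normal_in W X \<Longrightarrow> x \<in> X \<Longrightarrow> y \<in> X \<Longrightarrow> W #> x = W #> y \<Longrightarrow> x \<in> W \<longleftrightarrow> y \<in> W"
  using quotient_context(6)[of W X x] quotient_context(6)[of W X y] by simp

text \<open>Raising x and l to the exponent of \<open>pi_elem_exp\<close> keeps them congruent
  modulo W, leaves x unchanged and turns l into a \<sigma>-element.\<close>

lemma pi_elem_lift:
  assumes W: "normal_in W X" and L: "subgroup L G" "L \<subseteq> X" and x: "x \<in> W <#> L" "pi_elem \<sigma> x"
  shows "\<exists>l\<in>L. pi_elem \<sigma> l \<and> W #> x = W #> l"
proof -
  obtain w l where wl: "w \<in> W" "l \<in> L" "x = w \<otimes> l" using x by (elim set_multE)
  obtain k :: nat where k: "\<forall>x\<in>carrier G. pi_elem \<sigma> (x [^] k)" "\<forall>x. pi_elem \<sigma> x \<longrightarrow> x [^] k = x" using pi_elem_exp by blast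
  have c: "l \<in> carrier G" "l \<in> X" "x \<in> X" "subgroup W G" using wl W L by (auto simp: normal_in_def sub_carr subgroup.m_closed subset_iff)
  have "W #> x = W #> l" using coset_mult_left[OF c(4) wl(1) c(1)] wl by simp
  hence "W #> x [^] k = W #> l [^] k" by (rule pow_coset[OF W c(3,2)])
  thus ?thesis using k x c subgroup_pow[OF L(1) wl(2), of k] by auto
qed

text \<open>The two entries of a defining commutator of \<open>W <#> L\<close> are congruent modulo
  W to elements of L of the same types, hence so are the commutators.\<close>

lemma npi_res_join:
  assumes W: "normal_in W X" and L: "subgroup L G" "L \<subseteq> X"
  shows "npi_res \<pi> (W <#> L) \<subseteq> W <#> npi_res \<pi> L"
proof (rule npi_res_least)
  have RL: "npi_res \<pi> L \<subseteq> X" using npi_res_sub[OF L(1)] L by blast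
  show "subgroup (W <#> npi_res \<pi> L) G" using normal_in_join(1)[OF W subgroup_npi_res[OF L(1)] RL] .
  fix x y q assume xy: "x \<in> W <#> L" "y \<in> W <#> L" "prime q" "q \<notin> \<pi>" "pi_elem {q} x" "pi_elem (-{q}) y"
  obtain l where l: "l \<in> L" "pi_elem {q} l" "W #> x = W #> l" using pi_elem_lift[OF W L xy(1,5)] by blast
  obtain m where m: "m \<in> L" "pi_elem (-{q}) m" "W #> y = W #> m" using pi_elem_lift[OF W L xy(2,6)] by blast
  have X: "x \<in> X" "y \<in> X" "l \<in> X" "m \<in> X" using xy l m L normal_in_join(5)[OF W L] by auto
  have sX: "subgroup X G" "subgroup W G" using W by (auto simp: normal_in_def)
  have "W #> commut x y = W #> commut l m" using commut_coset[OF W X(1,3) l(3) X(2,4) m(3)] .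
  hence "commut x y \<in> W #> commut l m" using coset_self_mem[OF sX(2)] X sX by (simp add: sub_carr)
  moreover have "commut l m \<in> npi_res \<pi> L" using npi_res_commut[OF l(1) m(1) xy(3,4) l(2) m(2)] .
  ultimately show "commut x y \<in> W <#> npi_res \<pi> L" by (auto simp: r_coset_def set_mult_def)
qed

text \<open>Modulo M this is O^(\<sigma>')(L/M), the smallest normal subgroup of L/M with a
  \<sigma>'-quotient, described by generators.\<close>

definition pi_hull :: "nat set \<Rightarrow> 'a set \<Rightarrow> 'a set \<Rightarrow> 'a set" where
  "pi_hull \<sigma> M L = generate G (M \<union> {x \<in> L. pi_elem \<sigma> x})"

lemma pi_hull_normal_in: assumes "normal_in M L"
  shows "normal_in (pi_hull \<sigma> M L) L" "M \<subseteq> pi_hull \<sigma> M L" "\<And>x. x \<in> L \<Longrightarrow> pi_elem \<sigma> x \<Longrightarrow> x \<in> pi_hull \<sigma> M L"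
proof -
  have s: "subgroup M G" "subgroup L G" "M \<subseteq> L" using assms by (auto simp: normal_in_def)
  let ?S = "M \<union> {x \<in> L. pi_elem \<sigma> x}"
  have c: "?S \<subseteq> L" "?S \<subseteq> carrier G" using s by (auto simp: sub_carr)
  show "M \<subseteq> pi_hull \<sigma> M L" "\<And>x. x \<in> L \<Longrightarrow> pi_elem \<sigma> x \<Longrightarrow> x \<in> pi_hull \<sigma> M L"
    unfolding pi_hull_def by (auto intro: generate.incl)
  show "normal_in (pi_hull \<sigma> M L) L"
  proof (rule nrmI)
    show "subgroup (pi_hull \<sigma> M L) G" "pi_hull \<sigma> M L \<subseteq> L" unfolding pi_hull_def
      using generate_is_subgroup[OF c(2)] generate_subgroup_incl[OF c(1) s(2)] by auto
    fix x assume x: "x \<in> L"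
    have xc: "x \<in> carrier G" using x s sub_carr by blast
    have "cnj_set ?S x \<subseteq> ?S"
      using normal_in_cnj[OF assms x] normal_in_cnj[OF normal_in_self[OF s(2)] x] pi_elem_cnj[OF _ xc] by (auto simp: cnj_set_def)
    thus "cnj_set (pi_hull \<sigma> M L) x \<subseteq> pi_hull \<sigma> M L" unfolding pi_hull_def cnj_set_generate[OF xc c(2)] by (rule mono_generate)
  qed (use s in auto)
qed

lemma pi_hull_least: "subgroup T G \<Longrightarrow> M \<subseteq> T \<Longrightarrow> (\<And>x. x \<in> L \<Longrightarrow> pi_elem \<sigma> x \<Longrightarrow> x \<in> T) \<Longrightarrow> pi_hull \<sigma> M L \<subseteq> T"
  unfolding pi_hull_def by (rule generate_subgroup_incl) auto

lemma subgroup_pi_hull: "normal_in M L \<Longrightarrow> subgroup (pi_hull \<sigma> M L) G" using pi_hull_normal_in(1) normal_in_subgroup(1) by blast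

lemma pi_hull_index: assumes M: "normal_in M L" shows "pi_num (-\<sigma>) (index L (pi_hull \<sigma> M L))"
  using pi_hull_normal_in(1)[OF M] pi_hull_normal_in(3)[OF M] by (intro index_pi_elem) (auto simp: normal_in_def)

lemma pi_hull_mono: "\<sigma> \<subseteq> \<tau> \<Longrightarrow> pi_hull \<sigma> M L \<subseteq> pi_hull \<tau> M L"
  unfolding pi_hull_def by (rule mono_generate) (auto intro: pi_elem_mono)

lemma index_dvd1: "subgroup A G \<Longrightarrow> subgroup B G \<Longrightarrow> subgroup C G \<Longrightarrow> A \<subseteq> B \<Longrightarrow> B \<subseteq> C \<Longrightarrow> index B A dvd index C A"
  using index_trans[of A B C] by simp

lemma index_dvd2: "subgroup A G \<Longrightarrow> subgroup B G \<Longrightarrow> subgroup C G \<Longrightarrow> A \<subseteq> B \<Longrightarrow> B \<subseteq> C \<Longrightarrow> index C B dvd index C A"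
  using index_trans[of A B C] by simp

lemma index_set_mult:
  assumes "subgroup A G" "subgroup B G" "subgroup (A <#> B) G"
  shows "index (A <#> B) A = index B (A \<inter> B)"
proof -
  have i: "subgroup (A \<inter> B) G" using assms by (intro subgroups_Inter_pair)
  have "A \<subseteq> A <#> B" using subgroup.one_closed[OF assms(2)] subgroup.subset[OF assms(1)]
    by (force simp: set_mult_def)
  hence "card (A <#> B) = index (A <#> B) A * card A" using assms by (intro index_mult)
  moreover have "card B = index B (A \<inter> B) * card (A \<inter> B)" using assms i by (intro index_mult) auto
  ultimately have "index (A <#> B) A * (card A * card (A \<inter> B)) = index B (A \<inter> B) * (card A * card (A \<inter> B))"
    using card_set_mult[OF assms(1,2)] by (simp add: ac_simps)
  thus ?thesis using card_sub_pos[OF assms(1)] card_sub_pos[OF i] by simp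
qed

text \<open>B/M is the radical O_\<sigma>(L/M): the product of two normal \<sigma>-subgroups is
  again one.\<close>

lemma greatest_sigma:
  assumes M: "normal_in M L"
  shows "\<exists>B. normal_in B L \<and> M \<subseteq> B \<and> pi_num \<sigma> (index B M) \<and>
    (\<forall>Y. normal_in Y L \<longrightarrow> M \<subseteq> Y \<longrightarrow> pi_num \<sigma> (index Y M) \<longrightarrow> Y \<subseteq> B)"
proof -
  have s: "subgroup M G" using M by (simp add: normal_in_def)
  define F where "F B \<longleftrightarrow> normal_in B L \<and> M \<subseteq> B \<and> pi_num \<sigma> (index B M)" for B
  have "F M" using M index_self[OF s] by (simp add: F_def)
  then obtain B where B: "F B" "\<forall>Y. F Y \<longrightarrow> card Y \<le> card B"
    using ex_max_subgroup[of F M] normal_in_subgroup(1) unfolding F_def by blast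
  have "Y \<subseteq> B" if Y: "normal_in Y L" "M \<subseteq> Y" "pi_num \<sigma> (index Y M)" for Y
  proof -
    have sB: "subgroup B G" "M \<subseteq> B" "normal_in B L" "pi_num \<sigma> (index B M)" and sY: "subgroup Y G" "Y \<subseteq> L" using B(1) Y by (auto simp: normal_in_def F_def)
    note j = normal_in_join[OF sB(3) sY]
    have n: "normal_in (B <#> Y) L" using normal_in_normal_in_join[OF sB(3) Y(1)] .
    have "index (B <#> Y) B = index Y (B \<inter> Y)" using index_set_mult[OF sB(1) sY(1) j(1)] .
    moreover have "index Y (B \<inter> Y) dvd index Y M" using s sB sY Y by (intro index_dvd2 subgroups_Inter_pair) auto
    ultimately have "pi_num \<sigma> (index (B <#> Y) B)" using Y(3) pi_num_dvd by simp
    moreover have "index (B <#> Y) M = index (B <#> Y) B * index B M" using s sB j by (intro index_trans) auto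
    ultimately have "F (B <#> Y)" using n sB j by (auto simp: F_def pi_num_mult)
    hence "card (B <#> Y) \<le> card B" using B by blast
    hence "B = B <#> Y" using j by (intro card_seteq) auto
    thus ?thesis using j by blast
  qed
  thus ?thesis using B(1) unfolding F_def by blast
qed

text \<open>Modulo M, \<open>C\<close> is the centralizer of the image of the set R.\<close>

lemma subgroup_rel_centralizer:
  assumes M: "normal_in M L" and R: "R \<subseteq> L"
  defines "C \<equiv> {x \<in> L. \<forall>r\<in>R. commut r x \<in> M}"
  shows "subgroup C G"
proof -
  have s: "subgroup M G" "subgroup L G" using M by (auto simp: normal_in_def)
  have Lc: "\<And>x. x \<in> L \<Longrightarrow> x \<in> carrier G" using s sub_carr by blast
  have Rc: "\<And>x. x \<in> R \<Longrightarrow> x \<in> carrier G" using R Lc by blast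
  show "subgroup C G"
  proof (rule subgroupI)
    show "C \<subseteq> carrier G" using Lc by (auto simp: C_def)
    have "commut r \<one> = \<one>" if "r \<in> R" for r using Rc[OF that] by (simp add: commut_def)
    hence "\<one> \<in> C" using s by (simp add: C_def subgroup.one_closed)
    thus "C \<noteq> {}" by blast
    fix a assume a: "a \<in> C"
    hence ac: "a \<in> carrier G" "a \<in> L" "inv a \<in> L" using Lc s by (auto simp: C_def subgroup.m_inv_closed)
    have "commut r (inv a) \<in> M" if r: "r \<in> R" for r
    proof -
      have "cnj (inv a) (commut a r) \<in> M"
        using normal_in_cnj[OF M ac(3)] a r commut_sym_in[OF s(1) Rc[OF r] ac(1)] by (simp add: C_def)
      also have "cnj (inv a) (commut a r) = commut r (inv a)" using ac Rc[OF r] by (simp add: cnj_def commut_def m_assoc)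
      finally show ?thesis .
    qed
    thus "inv a \<in> C" using ac by (simp add: C_def)
    fix b assume b: "b \<in> C"
    hence bc: "b \<in> carrier G" "b \<in> L" using Lc by (auto simp: C_def)
    have "commut r (a \<otimes> b) \<in> M" if r: "r \<in> R" for r
    proof -
      have "commut r b \<otimes> cnj b (commut r a) \<in> M"
        using normal_in_cnj[OF M bc(2)] a b r s by (intro subgroup.m_closed) (auto simp: C_def)
      also have "commut r b \<otimes> cnj b (commut r a) = commut r (a \<otimes> b)"
        using ac bc Rc[OF r] by (simp add: cnj_def commut_def m_assoc inv_mult_group)
      finally show ?thesis .
    qed
    thus "a \<otimes> b \<in> C" using ac bc s by (simp add: C_def subgroup.m_closed)
  qed
qed

section \<open>Structure of L/M when M contains the residual of L\<close>

context
  fixes \<pi> M L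
  assumes M: "normal_in M L" and RM: "npi_res \<pi> L \<subseteq> M"
begin

lemma M_facts: "subgroup M G" "subgroup L G" "M \<subseteq> L"
  using M by (auto simp: normal_in_def)

text \<open>The q'-elements centralize P modulo M, so the normalizer of \<open>M <#> P\<close>
  contains P and all q'-elements; by \<open>gen_q\<close> it is L.\<close>

lemma normal_in_sylow_join:
  assumes q: "prime q" "q \<notin> \<pi>" and P: "sylow_in q L P"
  shows "normal_in (M <#> P) L" "pi_num {q} (index (M <#> P) M)" "pi_num (-{q}) (index L (M <#> P))"
proof -
  have sP: "subgroup P G" "P \<subseteq> L" using P by (auto simp: sylow_in_def)
  note s = M_facts
  note j = normal_in_join[OF M sP]
  have c: "M <#> P \<subseteq> carrier G" using j by (simp add: subgroup.subset)
  have "normalizer_in L (M <#> P) = L"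
  proof (rule gen_q[OF subgroup_normalizer_in[OF s(2) c] s(2) normalizer_in_sub P _ q(1)])
    show "P \<subseteq> normalizer_in L (M <#> P)" using sP j cnj_set_self[OF j(1)] by (auto simp: normalizer_in_def)
    fix y assume y: "y \<in> L" "pi_elem (-{q}) y"
    have yc: "y \<in> carrier G" using y s sub_carr by blast
    have "cnj_set (M <#> P) y \<subseteq> M <#> P"
    proof -
      have "cnj y p \<in> M <#> P" if p: "p \<in> P" for p
      proof -
        have pc: "p \<in> carrier G" using p sP sub_carr by blast
        have "pi_elem {q} p" using pi_elem_card[OF sP(1) _ p] P by (simp add: sylow_in_def)
        hence "commut p y \<in> M" using npi_res_commut[of p L y q \<pi>] p sP y q RM by blast
        hence "p \<otimes> commut p y \<in> P <#> M" using p set_multI by blast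
        thus ?thesis using cnj_commut[OF pc yc] j(2) by simp
      qed
      hence "cnj_set P y \<subseteq> M <#> P" by (auto simp: cnj_set_def)
      moreover have "cnj_set (M <#> P) y = M <#> cnj_set P y"
        using cnj_set_set_mult[OF yc] s sP normal_in_cnj_set[OF M y(1)] by (simp add: subgroup.subset)
      ultimately show ?thesis using set_mult_least[OF j(1) j(3)] by simp
    qed
    moreover have "finite (M <#> P)" "card (cnj_set (M <#> P) y) = card (M <#> P)"
      using j(1) yc c by (auto simp: card_cnj_set)
    ultimately have "cnj_set (M <#> P) y = M <#> P" using card_subset_eq by blast
    thus "y \<in> normalizer_in L (M <#> P)" using y by (simp add: normalizer_in_def)
  qed
  thus "normal_in (M <#> P) L" using normal_in_normalizer_in[OF s(2) j(1,5)] by simp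
  have "index (M <#> P) M = index P (M \<inter> P)" using index_set_mult[OF s(1) sP(1) j(1)] .
  moreover have "index P (M \<inter> P) dvd card P"
    using index_mult[of "M \<inter> P" P] s sP by (auto simp: subgroups_Inter_pair)
  ultimately show "pi_num {q} (index (M <#> P) M)" using P pi_num_dvd[of "{q}" "card P"] by (simp add: sylow_in_def)
  have "index L (M <#> P) dvd index L P" using j sP s by (intro index_dvd2) auto
  thus "pi_num (-{q}) (index L (M <#> P))" using P pi_num_dvd[of "-{q}" "index L P"] by (simp add: sylow_in_def)
qed

lemma pi_hull_q: assumes q: "prime q" "q \<notin> \<pi>" shows "pi_num {q} (index (pi_hull {q} M L) M)"
proof -
  note s = M_facts
  obtain P where P: "sylow_in q L P" using sylow_in_ex[OF q(1) s(2)] by blast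
  note R = normal_in_sylow_join[OF q P]
  have sP: "subgroup P G" "P \<subseteq> L" using P by (auto simp: sylow_in_def)
  note j = normal_in_join[OF M sP]
  have sub: "pi_hull {q} M L \<subseteq> M <#> P" using pi_elem_in[OF R(1)] R(3) by (intro pi_hull_least j(1,3)) auto
  have "index (pi_hull {q} M L) M dvd index (M <#> P) M"
    using sub s j subgroup_pi_hull[OF M] pi_hull_normal_in(2)[OF M] by (intro index_dvd1) auto
  thus ?thesis using R(2) pi_num_dvd by blast
qed

lemma sylow_join_commutes:
  assumes q: "prime q" "q \<notin> \<pi>" and P: "sylow_in q L P" and r: "r \<in> M <#> P" and y: "y \<in> L" "pi_elem (-{q}) y"
  shows "commut r y \<in> M"
proof -
  note s = M_facts
  have sP: "subgroup P G" "P \<subseteq> L" using P by (auto simp: sylow_in_def)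
  note j = normal_in_join[OF M sP]
  obtain m p where mp: "m \<in> M" "p \<in> P" "r = m \<otimes> p" using r by (rule set_multE)
  have c: "p \<in> L" "r \<in> L" "p \<in> carrier G" using mp r sP j sub_carr by blast+
  have "pi_elem {q} p" using pi_elem_card[OF sP(1) _ mp(2)] P by (simp add: sylow_in_def)
  hence *: "commut p y \<in> M" using npi_res_commut[of p L y q \<pi>] c y q RM by blast
  have "M #> r = M #> p" using coset_mult_left[OF s(1) mp(1) c(3)] mp by simp
  hence "M #> commut r y = M #> commut p y" by (rule commut_coset[OF M c(2,1) _ y(1) y(1) refl])
  thus ?thesis using coset_mem_iff[OF M commut_in[OF s(2) c(2) y(1)] commut_in[OF s(2) c(1) y(1)]] * by blast
qed

text \<open>The q'-elements centralize the normal Sylow q-subgroup R/M. Its centralizer C/M has the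
  central Sylow q-subgroup Y/M and splits over it; the complement D/M is a normal q'-subgroup
  containing all q'-elements.\<close>

lemma pi_hull_q': assumes q: "prime q" "q \<notin> \<pi>" shows "pi_num (-{q}) (index (pi_hull (-{q}) M L) M)"
proof -
  note s = M_facts
  obtain P where P: "sylow_in q L P" using sylow_in_ex[OF q(1) s(2)] by blast
  note R' = normal_in_sylow_join[OF q P]
  have sP: "subgroup P G" "P \<subseteq> L" using P by (auto simp: sylow_in_def)
  note j = normal_in_join[OF M sP]
  define R where "R = M <#> P"
  note R = R'[folded R_def]
  have sR: "subgroup R G" "R \<subseteq> L" "M \<subseteq> R" using j by (auto simp: R_def)
  define C where "C = {x \<in> L. \<forall>r\<in>R. commut r x \<in> M}"
  have Lc: "\<And>x. x \<in> L \<Longrightarrow> x \<in> carrier G" using s sub_carr by blast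
  have Rc: "\<And>x. x \<in> R \<Longrightarrow> x \<in> carrier G" using sR sub_carr by blast
  have sC: "subgroup C G" unfolding C_def using subgroup_rel_centralizer[OF M sR(2)] .
  have CL: "C \<subseteq> L" by (auto simp: C_def)
  have MC: "M \<subseteq> C"
  proof
    fix m assume m: "m \<in> M"
    have "commut r m \<in> M" if "r \<in> R" for r using commut_normal_in(2)[OF M m] that sR by blast
    thus "m \<in> C" using m s by (auto simp: C_def)
  qed
  have nMC: "normal_in M C" using normal_in_sub[OF M sC MC CL] .
  have elC: "y \<in> C" if y: "y \<in> L" "pi_elem (-{q}) y" for y
  proof -
    have "commut r y \<in> M" if "r \<in> R" for r using sylow_join_commutes[OF q P] that y by (simp add: R_def)
    thus ?thesis using y by (simp add: C_def)
  qed
  define Y where "Y = R \<inter> C"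
  have nY: "normal_in Y C" unfolding Y_def using normal_in_Int[OF R(1) sC CL] .
  have sY: "subgroup Y G" "M \<subseteq> Y" "Y \<subseteq> R" "Y \<subseteq> C" using nY sR MC by (auto simp: normal_in_def Y_def)
  have "index (R <#> C) R = index C Y"
    unfolding Y_def using sR sC normal_in_join(1)[OF R(1) sC CL] by (intro index_set_mult)
  moreover have "index (R <#> C) R dvd index L R"
    using normal_in_join[OF R(1) sC CL] sR s by (intro index_dvd1) auto
  ultimately have pC: "pi_num (-{q}) (index C Y)" using R(3) pi_num_dvd by simp
  have "index Y M dvd index R M" using sY sR s by (intro index_dvd1) auto
  hence pY: "pi_num (-(-{q})) (index Y M)" using R(2) pi_num_dvd by simp
  have abY: "\<forall>a\<in>Y. \<forall>b\<in>Y. commut a b \<in> M" by (auto simp: Y_def C_def)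
  obtain D where D: "complement M Y C D" using complement_ex[OF nMC nY sY(2) pC pY] abY by blast
  have sD: "subgroup D G" "M \<subseteq> D" "D \<subseteq> C" "Y <#> D = C" using D by (auto simp: complement_def)
  \<comment> \<open>C = Y D, and Y is central in C modulo M, so conjugation by Y changes elements of
    D only by factors in M.\<close>
  have nD: "normal_in D C"
  proof (rule nrmI[OF sD(1) sC sD(3)])
    fix x assume "x \<in> C"
    then obtain y d where yd: "y \<in> Y" "d \<in> D" "x = y \<otimes> d" unfolding sD(4)[symmetric] by (rule set_multE)
    have yc: "y \<in> carrier G" "d \<in> carrier G" using yd sY sD sub_carr by blast+
    have "cnj_set D y \<subseteq> D"
    proof (unfold cnj_set_def, rule image_subsetI)
      fix e assume e: "e \<in> D"
      have ec: "e \<in> carrier G" using e sD sub_carr by blast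
      have "commut y e \<in> M" using e sD yd by (auto simp: C_def Y_def)
      hence "commut e y \<in> D" using commut_sym_in[OF s(1) yc(1) ec] sD by blast
      thus "cnj y e \<in> D" using cnj_commut[OF ec yc(1)] e sD by (simp add: subgroup.m_closed)
    qed
    hence "cnj_set (cnj_set D y) d \<subseteq> cnj_set D d" by (rule cnj_set_mono)
    also have "\<dots> = D" using cnj_set_self[OF sD(1) yd(2)] .
    also have "cnj_set (cnj_set D y) d = cnj_set D x" using yd yc cnj_set_cnj_set sD by (simp add: subgroup.subset)
    finally show "cnj_set D x \<subseteq> D" .
  qed
  have iD: "index D M = index C Y" "index C D = index Y M" using complement_index[OF nY D s(1)] by auto
  have sub: "pi_hull (-{q}) M L \<subseteq> D"
    using pi_elem_in[OF nD, of "-{q}"] pY iD elC by (intro pi_hull_least sD) auto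
  have "index (pi_hull (-{q}) M L) M dvd index D M"
    using sub s sD subgroup_pi_hull[OF M] pi_hull_normal_in(2)[OF M] by (intro index_dvd1) auto
  thus ?thesis using pC iD pi_num_dvd by simp
qed

text \<open>For q outside \<pi> every \<pi>-element is a q'-element, so \<open>pi_hull_q'\<close>
  excludes q from the index.\<close>

lemma pi_hull_pi: "pi_num \<pi> (index (pi_hull \<pi> M L) M)"
proof -
  note s = M_facts
  have sO: "subgroup (pi_hull \<sigma> M L) G" "M \<subseteq> pi_hull \<sigma> M L" for \<sigma> using subgroup_pi_hull[OF M] pi_hull_normal_in(2)[OF M] by auto
  have "q \<in> \<pi>" if q: "prime q" "q dvd index (pi_hull \<pi> M L) M" for q
  proof (rule ccontr)
    assume n: "q \<notin> \<pi>"
    have "pi_hull \<pi> M L \<subseteq> pi_hull (-{q}) M L" using n by (intro pi_hull_mono) auto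
    hence "index (pi_hull \<pi> M L) M dvd index (pi_hull (-{q}) M L) M" using s sO by (intro index_dvd1) auto
    hence "pi_num (-{q}) (index (pi_hull \<pi> M L) M)" using pi_hull_q'[OF q(1) n] pi_num_dvd by blast
    thus False using q by (auto simp: pi_num_def)
  qed
  thus ?thesis using index_pos[OF s(1) sO(1) sO(2)] by (auto simp: pi_num_def)
qed

text \<open>O_(\<pi>')(L/M) contains the normal Sylow subgroups for all primes outside \<pi>, so its
  quotient is a \<pi>-group and it absorbs all \<pi>'-elements.\<close>

lemma pi_hull_pi': "pi_num (-\<pi>) (index (pi_hull (-\<pi>) M L) M)"
proof -
  note s = M_facts
  obtain B where B: "normal_in B L" "M \<subseteq> B" "pi_num (-\<pi>) (index B M)"
    "\<forall>Y. normal_in Y L \<longrightarrow> M \<subseteq> Y \<longrightarrow> pi_num (-\<pi>) (index Y M) \<longrightarrow> Y \<subseteq> B" using greatest_sigma[OF M] by blast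
  have sB: "subgroup B G" "B \<subseteq> L" using B by (auto simp: normal_in_def)
  have "q \<in> \<pi>" if q: "prime q" "q dvd index L B" for q
  proof (rule ccontr)
    assume n: "q \<notin> \<pi>"
    obtain P where P: "sylow_in q L P" using sylow_in_ex[OF q(1) s(2)] by blast
    note R = normal_in_sylow_join[OF q(1) n P]
    have sP: "subgroup P G" "P \<subseteq> L" using P by (auto simp: sylow_in_def)
    note j = normal_in_join[OF M sP]
    have "pi_num (-\<pi>) (index (M <#> P) M)" using R(2) n by (auto elim!: pi_num_mono)
    hence "M <#> P \<subseteq> B" using B(4) R(1) j(3) by blast
    hence "index L B dvd index L (M <#> P)" using j sB s by (intro index_dvd2) auto
    hence "pi_num (-{q}) (index L B)" using R(3) pi_num_dvd by blast
    thus False using q by (auto simp: pi_num_def)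
  qed
  hence "pi_num (-(-\<pi>)) (index L B)" using index_pos[OF sB(1) s(2) sB(2)] by (auto simp: pi_num_def)
  hence "pi_hull (-\<pi>) M L \<subseteq> B" using pi_elem_in[OF B(1), of "-\<pi>"] by (intro pi_hull_least sB B) auto
  hence "index (pi_hull (-\<pi>) M L) M dvd index B M"
    using s sB subgroup_pi_hull[OF M] pi_hull_normal_in(2)[OF M] by (intro index_dvd1) auto
  thus ?thesis using B(3) pi_num_dvd by blast
qed

end

subsection \<open>Chief factors and Hall subgroups\<close>

text \<open>A subnormal series suffices here and, unlike composition series, it needs no quotient groups.\<close>

definition npi_soluble :: "nat set \<Rightarrow> bool" where
  "npi_soluble \<pi> \<longleftrightarrow> (\<exists>n S. S 0 = {\<one>} \<and> S n = carrier G \<and> (\<forall>i<n. normal_in (S i) (S (Suc i)) \<and>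
     (pi_num \<pi> (index (S (Suc i)) (S i)) \<or> (\<exists>p. prime p \<and> p \<notin> \<pi> \<and> pi_num {p} (index (S (Suc i)) (S i))))))"

text \<open>C/M is the centre of N/M, which L leaves invariant because it normalizes N and
  M.\<close>

lemma normal_in_rel_center:
  assumes M: "normal_in M L" and N: "normal_in N L" and MnN: "normal_in M N"
  defines "C \<equiv> {z \<in> N. \<forall>n\<in>N. commut z n \<in> M}"
  shows "normal_in C L"
proof -
  have s: "subgroup M G" "subgroup N G" "subgroup L G" "N \<subseteq> L" using M N by (auto simp: normal_in_def)
  have Nc: "\<And>x. x \<in> N \<Longrightarrow> x \<in> carrier G" using s sub_carr by blast
  have sC: "subgroup C G"
  proof (rule subgroupI)
    show "C \<subseteq> carrier G" using Nc by (auto simp: C_def)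
    have "commut \<one> r = \<one>" if "r \<in> N" for r using Nc[OF that] by (simp add: commut_def)
    hence "\<one> \<in> C" using s by (simp add: C_def subgroup.one_closed)
    thus "C \<noteq> {}" by blast
    fix a assume a: "a \<in> C"
    hence ac: "a \<in> carrier G" "a \<in> N" "inv a \<in> N" using Nc s by (auto simp: C_def subgroup.m_inv_closed)
    have "commut (inv a) r \<in> M" if r: "r \<in> N" for r
    proof -
      have "cnj (inv a) (commut r a) \<in> M"
        using normal_in_cnj[OF MnN ac(3)] a r commut_sym_in[OF s(1) ac(1) Nc[OF r]] by (simp add: C_def)
      also have "cnj (inv a) (commut r a) = commut (inv a) r" using ac Nc[OF r] by (simp add: cnj_def commut_def m_assoc)
      finally show ?thesis .
    qed
    thus "inv a \<in> C" using ac by (simp add: C_def)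
    fix b assume b: "b \<in> C"
    hence bc: "b \<in> carrier G" "b \<in> N" using Nc by (auto simp: C_def)
    have "commut (a \<otimes> b) r \<in> M" if r: "r \<in> N" for r
    proof -
      have "cnj b (commut a r) \<otimes> commut b r \<in> M"
        using normal_in_cnj[OF MnN bc(2)] a b r s by (intro subgroup.m_closed) (auto simp: C_def)
      also have "cnj b (commut a r) \<otimes> commut b r = commut (a \<otimes> b) r"
        using ac bc Nc[OF r] by (simp add: cnj_def commut_def m_assoc inv_mult_group)
      finally show ?thesis .
    qed
    thus "a \<otimes> b \<in> C" using ac bc s by (simp add: C_def subgroup.m_closed)
  qed
  show "normal_in C L"
  proof (rule nrmI[OF sC s(3)])
    show "C \<subseteq> L" using s by (auto simp: C_def)
    fix x assume x: "x \<in> L"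
    have xc: "x \<in> carrier G" "inv x \<in> L" using x s by (auto simp: sub_carr subgroup.m_inv_closed)
    have "cnj x a \<in> C" if a: "a \<in> C" for a
    proof -
      have aN: "a \<in> N" "a \<in> carrier G" using a Nc by (auto simp: C_def)
      have "commut (cnj x a) r \<in> M" if r: "r \<in> N" for r
      proof -
        have "cnj (inv x) r \<in> N" using normal_in_cnj[OF N xc(2) r] .
        hence "cnj x (commut a (cnj (inv x) r)) \<in> M" using a normal_in_cnj[OF M x] by (simp add: C_def)
        thus ?thesis using xc aN Nc[OF r] by (simp add: cnj_of_commut)
      qed
      thus ?thesis using normal_in_cnj[OF N x aN(1)] by (simp add: C_def)
    qed
    thus "cnj_set C x \<subseteq> C" by (auto simp: cnj_set_def)
  qed
qed

text \<open>The series of G, cut down to N and multiplied by M, is subnormal in N/M. Its first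
  nontrivial term is a \<rho>-group with \<rho> = \<pi> or \<rho> = {p}; O_\<rho> of each later term
  stays nontrivial, and at the top it is L-invariant, hence all of N/M. For \<rho> = {p} the
  nontrivial centre is L-invariant too, so N/M is abelian.\<close>

lemma chief_factor:
  assumes ps: "npi_soluble \<pi>" and M: "normal_in M L" and N: "normal_in N L" and MN: "M \<subseteq> N" "M \<noteq> N"
    and min: "\<And>X. normal_in X L \<Longrightarrow> M \<subseteq> X \<Longrightarrow> X \<subseteq> N \<Longrightarrow> X = M \<or> X = N"
  shows "pi_num \<pi> (index N M) \<or> (\<exists>p. prime p \<and> p \<notin> \<pi> \<and> pi_num {p} (index N M) \<and> (\<forall>a\<in>N. \<forall>b\<in>N. commut a b \<in> M))"
proof -
  obtain n S where S: "S 0 = {\<one>}" "S n = carrier G" "\<forall>i<n. normal_in (S i) (S (Suc i)) \<and>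
     (pi_num \<pi> (index (S (Suc i)) (S i)) \<or> (\<exists>p. prime p \<and> p \<notin> \<pi> \<and> pi_num {p} (index (S (Suc i)) (S i))))"
    using ps by (auto simp: npi_soluble_def)
  have s: "subgroup M G" "subgroup N G" "subgroup L G" "N \<subseteq> L" using M N by (auto simp: normal_in_def)
  have MnN: "normal_in M N" using normal_in_sub[OF M s(2) MN(1) s(4)] .
  have sS: "subgroup (S i) G" if "i \<le> n" for i
    using that S triv_subgroup by (cases i) (auto simp: normal_in_def)
  define B where "B i = N \<inter> S i" for i
  define A where "A i = M <#> B i" for i
  have sB: "subgroup (B i) G" "B i \<subseteq> N" if "i \<le> n" for i using sS[OF that] s by (auto simp: B_def subgroups_Inter_pair)
  have sA: "subgroup (A i) G" "M \<subseteq> A i" "B i \<subseteq> A i" "A i \<subseteq> N" if "i \<le> n" for i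
    using normal_in_join[OF MnN sB[OF that]] by (auto simp: A_def)
  have nB: "normal_in (B i) (B (Suc i))" if "i < n" for i
  proof -
    have SS: "normal_in (S i) (S (Suc i))" using S that by blast
    have "normal_in (S i \<inter> B (Suc i)) (B (Suc i))" using sB[of "Suc i"] that by (intro normal_in_Int[OF SS]) (auto simp: B_def)
    moreover have "S i \<inter> B (Suc i) = B i" using SS by (auto simp: B_def normal_in_def)
    ultimately show ?thesis by simp
  qed
  have nA: "normal_in (A i) (A (Suc i))" if i: "i < n" for i
  proof (rule nrmI)
    have BB: "B i \<subseteq> B (Suc i)" using nB[OF i] by (simp add: normal_in_def)
    show "subgroup (A i) G" "subgroup (A (Suc i)) G" using sA i by auto
    show "A i \<subseteq> A (Suc i)" unfolding A_def using BB by (rule mono_set_mult[OF subset_refl])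
    fix x assume "x \<in> A (Suc i)"
    then obtain m b where mb: "m \<in> M" "b \<in> B (Suc i)" "x = m \<otimes> b" unfolding A_def by (rule set_multE)
    have c: "m \<in> carrier G" "b \<in> carrier G" "b \<in> N" "A i \<subseteq> carrier G" "B i \<subseteq> carrier G"
      using mb s sB[of "Suc i"] sA[of i] sB[of i] i sub_carr by (auto dest: subgroup.subset)
    have "cnj_set (A i) x = cnj_set (cnj_set (A i) m) b" using mb c by (simp add: cnj_set_cnj_set)
    also have "cnj_set (A i) m = A i" using sA[of i] i mb by (intro cnj_set_self) auto
    also have "cnj_set (A i) b = cnj_set M b <#> cnj_set (B i) b" unfolding A_def using c s by (intro cnj_set_set_mult) (auto simp: subgroup.subset)
    also have "\<dots> = A i" using normal_in_cnj_set[OF MnN c(3)] normal_in_cnj_set[OF nB[OF i] mb(2)] by (simp add: A_def)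
    finally show "cnj_set (A i) x \<subseteq> A i" by simp
  qed
  have iA: "index (A (Suc i)) (A i) dvd index (S (Suc i)) (S i)" if i: "i < n" for i
  proof -
    have BB: "B i \<subseteq> B (Suc i)" using nB[OF i] by (simp add: normal_in_def)
    have sb: "subgroup (B (Suc i)) G" "B (Suc i) \<subseteq> A (Suc i)" using sB[of "Suc i"] sA[of "Suc i"] i by auto
    note j = normal_in_join[OF nA[OF i] sb]
    have "A (Suc i) = A i <#> B (Suc i)"
    proof
      have "M \<subseteq> A i <#> B (Suc i)" using sA(2)[of i] j(3) i by auto
      thus "A (Suc i) \<subseteq> A i <#> B (Suc i)" unfolding A_def[of "Suc i"] using set_mult_least[OF j(1) _ j(4)] by simp
    qed (rule j(5))
    hence "index (A (Suc i)) (A i) = index (B (Suc i)) (A i \<inter> B (Suc i))"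
      using index_set_mult[OF _ sb(1) j(1)] sA[of i] i by simp
    moreover have "index (B (Suc i)) (A i \<inter> B (Suc i)) dvd index (B (Suc i)) (B i)"
      using BB sA[of i] sB[of i] sb i by (intro index_dvd2) (auto simp: subgroups_Inter_pair)
    moreover have "index (B (Suc i)) (B i) dvd index (S (Suc i)) (S i)"
    proof -
      have SS: "normal_in (S i) (S (Suc i))" using S i by blast
      have sub: "B (Suc i) \<subseteq> S (Suc i)" by (auto simp: B_def)
      note k = normal_in_join[OF SS sb(1) sub]
      have "S i \<inter> B (Suc i) = B i" using SS by (auto simp: B_def normal_in_def)
      hence "index (S i <#> B (Suc i)) (S i) = index (B (Suc i)) (B i)"
        using index_set_mult[OF _ sb(1) k(1)] sS[of i] i by simp
      moreover have "index (S i <#> B (Suc i)) (S i) dvd index (S (Suc i)) (S i)"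
        using k SS by (intro index_dvd1) (auto simp: normal_in_def)
      ultimately show ?thesis by simp
    qed
    ultimately show ?thesis by (metis dvd_trans)
  qed
  have A0: "A 0 = M"
  proof -
    have "B 0 = {\<one>}" using S s subgroup.one_closed by (auto simp: B_def)
    thus ?thesis using subgroup.subset[OF s(1)] by (force simp: A_def set_mult_def)
  qed
  have An: "A n = N"
  proof -
    have "B n = N" using S subgroup.subset[OF s(2)] by (auto simp: B_def)
    thus ?thesis using sA[of n] by auto
  qed
  \<comment> \<open>The first term that differs from M; its predecessor is M, so one factor of the
    series bounds \<open>index (A k) M\<close>.\<close>
  define k where "k = (LEAST k. A k \<noteq> M)"
  have kA: "A k \<noteq> M" unfolding k_def by (rule LeastI[of _ n]) (use An MN in auto)
  have kl: "A i = M" if "i < k" for i using not_less_Least[of i "\<lambda>k. A k \<noteq> M"] that by (auto simp: k_def)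
  have kn: "k \<le> n" unfolding k_def by (rule Least_le) (use An MN in auto)
  have "k \<noteq> 0" using kA A0 by metis
  then obtain i where i: "k = Suc i" "i < n" using kn by (cases k) auto
  define good where "good \<rho> \<longleftrightarrow> \<rho> = \<pi> \<or> (\<exists>p. prime p \<and> p \<notin> \<pi> \<and> \<rho> = {p})" for \<rho>
  obtain \<rho> where \<rho>: "good \<rho>" "pi_num \<rho> (index (S (Suc i)) (S i))" using S(3) i unfolding good_def by blast
  have pk: "pi_num \<rho> (index (A k) M)" using \<rho>(2) iA[OF i(2)] kl[of i] i pi_num_dvd by auto
  have ex: "\<exists>X. normal_in X (A j) \<and> M \<subseteq> X \<and> M \<noteq> X \<and> pi_num \<rho> (index X M)" if "k \<le> j" "j \<le> n" for j
    using that
  proof (induction j rule: dec_induct)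
    case base
    thus ?case using pk kA sA[OF kn] normal_in_self by (intro exI[of _ "A k"]) auto
  next
    case (step j)
    then obtain X where X: "normal_in X (A j)" "M \<subseteq> X" "M \<noteq> X" "pi_num \<rho> (index X M)" by auto
    have jn: "j < n" "j \<le> n" using step by auto
    have MA: "normal_in M (A j)" using normal_in_sub[OF MnN sA(1,2,4)[OF jn(2)]] .
    obtain Z where Z: "normal_in Z (A j)" "M \<subseteq> Z" "pi_num \<rho> (index Z M)"
      "\<forall>Y. normal_in Y (A j) \<longrightarrow> M \<subseteq> Y \<longrightarrow> pi_num \<rho> (index Y M) \<longrightarrow> Y \<subseteq> Z" using greatest_sigma[OF MA] by blast
    have "X \<subseteq> Z" using Z(4) X by blast
    hence "M \<noteq> Z" using X by blast
    \<comment> \<open>Z/M is the largest normal \<rho>-subgroup of \<open>A j\<close> modulo M, so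
      every element normalizing \<open>A j\<close> and M preserves it.\<close>
    moreover have "normal_in Z (A (Suc j))"
    proof (rule nrmI)
      show "subgroup Z G" "subgroup (A (Suc j)) G" "Z \<subseteq> A (Suc j)" using Z nA[OF jn(1)] by (auto simp: normal_in_def)
      fix x assume x: "x \<in> A (Suc j)"
      have xN: "x \<in> N" "x \<in> carrier G" using x sA[of "Suc j"] jn s sub_carr by auto
      have "normal_in (cnj_set Z x) (cnj_set (A j) x)" using normal_in_cnj_set_cnj_set[OF Z(1) xN(2)] .
      hence "normal_in (cnj_set Z x) (A j)" using normal_in_cnj_set[OF nA[OF jn(1)] x] by simp
      moreover have "M \<subseteq> cnj_set Z x" using cnj_set_mono[OF Z(2), of x] normal_in_cnj_set[OF MnN xN(1)] by simp
      moreover have "index (cnj_set Z x) M = index Z M" using Z(1) xN by (simp add: index_def card_cnj_set normal_in_def subgroup.subset)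
      ultimately show "cnj_set Z x \<subseteq> Z" using Z by metis
    qed
    ultimately show ?case using Z by blast
  qed
  obtain X where X: "normal_in X N" "M \<subseteq> X" "M \<noteq> X" "pi_num \<rho> (index X M)" using ex[OF kn le_refl] An by auto
  obtain Z where Z: "normal_in Z N" "M \<subseteq> Z" "pi_num \<rho> (index Z M)"
      "\<forall>Y. normal_in Y N \<longrightarrow> M \<subseteq> Y \<longrightarrow> pi_num \<rho> (index Y M) \<longrightarrow> Y \<subseteq> Z" using greatest_sigma[OF MnN] by blast
  have "X \<subseteq> Z" using Z(4) X by blast
  hence MZ: "M \<noteq> Z" using X by blast
  have "normal_in Z L"
  proof (rule nrmI)
    show "subgroup Z G" "subgroup L G" "Z \<subseteq> L" using Z s by (auto simp: normal_in_def)
    fix x assume x: "x \<in> L"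
    have xc: "x \<in> carrier G" using x s sub_carr by blast
    have "normal_in (cnj_set Z x) N" using normal_in_cnj_set_cnj_set[OF Z(1) xc] normal_in_cnj_set[OF N x] by simp
    moreover have "M \<subseteq> cnj_set Z x" using cnj_set_mono[OF Z(2), of x] normal_in_cnj_set[OF M x] by simp
    moreover have "index (cnj_set Z x) M = index Z M" using Z(1) xc by (simp add: index_def card_cnj_set normal_in_def subgroup.subset)
    ultimately show "cnj_set Z x \<subseteq> Z" using Z by metis
  qed
  hence "Z = N" using min[of Z] Z MZ by (auto simp: normal_in_def)
  hence pN: "pi_num \<rho> (index N M)" using Z by simp
  show ?thesis
  proof (cases "\<rho> = \<pi>")
    case True thus ?thesis using pN by simp
  next
    case False
    then obtain p where p: "prime p" "p \<notin> \<pi>" "\<rho> = {p}" using \<rho>(1) by (auto simp: good_def)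
    obtain z where z: "z \<in> N" "z \<notin> M" "\<forall>n\<in>N. commut z n \<in> M" using rel_center[OF p(1) MnN MN(2)] pN p by blast
    define C where "C = {z \<in> N. \<forall>n\<in>N. commut z n \<in> M}"
    have "normal_in C L" unfolding C_def using normal_in_rel_center[OF M N MnN] .
    moreover have "M \<subseteq> C" using commut_normal_in(1)[OF MnN] MN by (auto simp: C_def)
    moreover have "C \<subseteq> N" by (auto simp: C_def)
    ultimately have "C = N" using min[of C] z by (auto simp: C_def)
    hence "\<forall>a\<in>N. \<forall>b\<in>N. commut a b \<in> M" by (auto simp: C_def)
    thus ?thesis using p pN by blast
  qed
qed

lemma ex_chief_above:
  assumes M: "normal_in M L" "M \<noteq> L"
  shows "\<exists>N. normal_in N L \<and> M \<subseteq> N \<and> M \<noteq> N \<and> (\<forall>X. normal_in X L \<longrightarrow> M \<subseteq> X \<longrightarrow> X \<subseteq> N \<longrightarrow> X = M \<or> X = N)"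
proof -
  define F where "F N \<longleftrightarrow> normal_in N L \<and> M \<subseteq> N \<and> M \<noteq> N" for N
  have "F L" using M normal_in_self[of L] by (auto simp: normal_in_def F_def)
  then obtain N where N: "F N" "\<forall>Y. F Y \<longrightarrow> card N \<le> card Y" using ex_has_least_nat[of F L card] by blast
  have "X = M \<or> X = N" if X: "normal_in X L" "M \<subseteq> X" "X \<subseteq> N" for X
  proof (rule disjCI)
    assume "X \<noteq> N"
    moreover have "finite N" using N(1) by (auto simp: F_def normal_in_def)
    ultimately have "card X < card N" using X by (intro psubset_card_mono) auto
    hence "\<not> F X" using N(2) by auto
    thus "X = M" using X by (auto simp: F_def)
  qed
  thus ?thesis using N(1) unfolding F_def by blast
qed

lemma ex_chief_below:
  assumes N: "normal_in N L" "N \<noteq> {\<one>}"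
  shows "\<exists>M. normal_in M L \<and> M \<subseteq> N \<and> M \<noteq> N \<and> (\<forall>X. normal_in X L \<longrightarrow> M \<subseteq> X \<longrightarrow> X \<subseteq> N \<longrightarrow> X = M \<or> X = N)"
proof -
  define F where "F M \<longleftrightarrow> normal_in M L \<and> M \<subseteq> N \<and> M \<noteq> N" for M
  have "F {\<one>}" using N normal_in_one[of L] by (auto simp: normal_in_def F_def subgroup.one_closed)
  then obtain M where M: "F M" "\<forall>Y. F Y \<longrightarrow> card Y \<le> card M"
    using ex_max_subgroup[of F "{\<one>}"] normal_in_subgroup(1) unfolding F_def by blast
  have "X = M \<or> X = N" if X: "normal_in X L" "M \<subseteq> X" "X \<subseteq> N" for X
  proof (rule disjCI)
    assume "X \<noteq> N"
    hence "card X \<le> card M" using X M(2) by (simp add: F_def)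
    moreover have "finite X" using X by (auto simp: normal_in_def)
    ultimately show "X = M" using X by (intro card_seteq[symmetric])
  qed
  thus ?thesis using M(1) unfolding F_def by blast
qed

text \<open>Induction through the chief factors above M. A \<pi>-factor N/M is simply absorbed. For
  an abelian p-factor with p outside \<pi>, R/M splits over N/M with complement T/M; U and
  \<open>T \<inter> (N <#> U)\<close> both complement N/M in \<open>N <#> U\<close>, so some
  conjugate of T under N contains U.\<close>

lemma hall_dominance:
  assumes ps: "npi_soluble \<pi>" and M: "normal_in M X" and U: "subgroup U G" "M \<subseteq> U" "U \<subseteq> X" "pi_num \<pi> (index U M)"
  shows "\<exists>R. subgroup R G \<and> U \<subseteq> R \<and> R \<subseteq> X \<and> pi_num \<pi> (index R M) \<and> pi_num (-\<pi>) (index X R)"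
  using M U
proof (induction "index X M" arbitrary: M U rule: less_induct)
  case less
  have s: "subgroup M G" "subgroup X G" "M \<subseteq> X" using less.prems by (auto simp: normal_in_def)
  show ?case
  proof (cases "M = X")
    case True
    hence "U = X" using less.prems by auto
    thus ?thesis using less.prems index_self[OF s(2)] s by (intro exI[of _ X]) auto
  next
    case False
    obtain N where N: "normal_in N X" "M \<subseteq> N" "M \<noteq> N" "\<forall>Z. normal_in Z X \<longrightarrow> M \<subseteq> Z \<longrightarrow> Z \<subseteq> N \<longrightarrow> Z = M \<or> Z = N"
      using ex_chief_above[OF less.prems(1) False] by blast
    have sN: "subgroup N G" "N \<subseteq> X" using N by (auto simp: normal_in_def)
    note j = normal_in_join[OF N(1) less.prems(2,4)]
    have "index X M = index X N * index N M" using s sN N by (intro index_trans) auto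
    moreover have "index N M \<noteq> 1" using index_1[OF s(1) sN(1) N(2)] N(3) by blast
    ultimately have lt: "index X N < index X M" using index_pos[OF s(1) sN(1) N(2)] index_pos[OF sN(1) s(2) sN(2)]
      by (cases "index N M") auto
    have "index (N <#> U) N = index U (N \<inter> U)" using index_set_mult[OF sN(1) less.prems(2) j(1)] .
    moreover have "index U (N \<inter> U) dvd index U M"
      using less.prems sN s N by (intro index_dvd2) (auto simp: subgroups_Inter_pair)
    ultimately have "pi_num \<pi> (index (N <#> U) N)" using less.prems(5) pi_num_dvd by simp
    from less.hyps[OF lt N(1) j(1,3,5) this] obtain R where R: "subgroup R G" "N <#> U \<subseteq> R" "R \<subseteq> X"
      "pi_num \<pi> (index R N)" "pi_num (-\<pi>) (index X R)" by blast
    have NR: "N \<subseteq> R" "U \<subseteq> R" using R j by auto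
    have iR: "index R M = index R N * index N M" using s sN N R NR by (intro index_trans) auto
    show ?thesis
    proof (cases "pi_num \<pi> (index N M)")
      case True
      thus ?thesis using R iR NR by (intro exI[of _ R]) (auto simp: pi_num_mult)
    next
      case False
      have mn: "\<And>Z. normal_in Z X \<Longrightarrow> M \<subseteq> Z \<Longrightarrow> Z \<subseteq> N \<Longrightarrow> Z = M \<or> Z = N" using N(4) by blast
      obtain p where p: "prime p" "p \<notin> \<pi>" "pi_num {p} (index N M)" "\<forall>a\<in>N. \<forall>b\<in>N. commut a b \<in> M"
        using chief_factor[OF ps less.prems(1) N(1-3) mn] False by blast
      have pN: "pi_num (-\<pi>) (index N M)" using p by (auto elim!: pi_num_mono)
      have nMR: "normal_in M R" using normal_in_sub[OF less.prems(1) R(1) _ R(3)] N NR by blast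
      have nNR: "normal_in N R" using normal_in_sub[OF N(1) R(1) NR(1) R(3)] .
      obtain T where T: "complement M N R T" using complement_ex[OF nMR nNR N(2) R(4) pN] p by blast
      have sT: "subgroup T G" "M \<subseteq> T" "T \<subseteq> R" "N <#> T = R" "T \<inter> N = M" using T by (auto simp: complement_def)
      let ?Z = "N <#> U"
      have nMZ: "normal_in M ?Z" using normal_in_sub[OF less.prems(1) j(1) _ j(5)] N j(3) by blast
      have nNZ: "normal_in N ?Z" using j(6) .
      have cU: "complement M N ?Z U"
      proof -
        have i: "subgroup (U \<inter> N) G" using less.prems sN by (simp add: subgroups_Inter_pair)
        have "index (U \<inter> N) M dvd index U M" "index (U \<inter> N) M dvd index N M"
          using less.prems i N sN s by (auto intro!: index_dvd1)
        hence "index (U \<inter> N) M = 1" using pi_num_both less.prems(5) pN pi_num_dvd by meson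
        hence "U \<inter> N = M" using index_1[OF s(1) i] less.prems(3) N(2) by blast
        thus ?thesis using less.prems j by (auto simp: complement_def)
      qed
      have cT: "complement M N ?Z (T \<inter> ?Z)"
      proof -
        have "N <#> (?Z \<inter> T) = ?Z \<inter> (N <#> T)"
          using sN j sT by (intro dedekind[symmetric]) (auto simp: subgroup.subset)
        also have "\<dots> = ?Z" using R(2) sT by auto
        finally have "N <#> (T \<inter> ?Z) = ?Z" by (simp add: Int_commute)
        moreover have "(T \<inter> ?Z) \<inter> N = M" using sT j N by auto
        ultimately show ?thesis using sT j N subgroups_Inter_pair by (auto simp: complement_def)
      qed
      have iZ: "pi_num \<pi> (index ?Z N)" by fact
      obtain y where y: "y \<in> N" "cnj_set (T \<inter> ?Z) y = U" using complement_conj[OF nMZ nNZ N(2) iZ pN _ cU cT] p by blast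
      have yc: "y \<in> carrier G" "y \<in> R" using y sN NR sub_carr by auto
      have cc: "complement M N R (cnj_set T y)" using complement_cnj_set[OF nMR nNR normal_in_self[OF R(1)] T yc(2)] .
      have i: "index (cnj_set T y) M = index R N" "index R (cnj_set T y) = index N M" using complement_index[OF nNR cc s(1)] by auto
      have sc: "subgroup (cnj_set T y) G" "cnj_set T y \<subseteq> R" using cc by (auto simp: complement_def)
      have "U \<subseteq> cnj_set T y" using y(2) cnj_set_mono[of "T \<inter> ?Z" T y] by auto
      moreover have "index X (cnj_set T y) = index X R * index R (cnj_set T y)" using sc R s by (intro index_trans) auto
      ultimately show ?thesis using sc R i pN by (intro exI[of _ "cnj_set T y"]) (auto simp: pi_num_mult)
    qed
  qed
qed

subsection \<open>Covering subgroups\<close>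

text \<open>Covering subgroups are projectors, and unlike the definition of a projector
  this one passes to all intermediate subgroups.\<close>

definition covering :: "nat set \<Rightarrow> 'a set \<Rightarrow> 'a set \<Rightarrow> bool" where
  "covering \<pi> P L \<longleftrightarrow> subgroup P G \<and> subgroup L G \<and> P \<subseteq> L \<and> npi_res \<pi> P = {\<one>} \<and>
     (\<forall>L'. subgroup L' G \<longrightarrow> P \<subseteq> L' \<longrightarrow> L' \<subseteq> L \<longrightarrow> L' \<subseteq> P <#> npi_res \<pi> L')"

lemma covD:
  assumes "covering \<pi> P L"
  shows "subgroup P G" "subgroup L G" "P \<subseteq> L" "npi_res \<pi> P = {\<one>}"
  "\<And>L'. subgroup L' G \<Longrightarrow> P \<subseteq> L' \<Longrightarrow> L' \<subseteq> L \<Longrightarrow> L' \<subseteq> P <#> npi_res \<pi> L'"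
  using assms by (auto simp: covering_def)

lemma covering_sub: "covering \<pi> P L \<Longrightarrow> subgroup E G \<Longrightarrow> P \<subseteq> E \<Longrightarrow> E \<subseteq> L \<Longrightarrow> covering \<pi> P E"
  unfolding covering_def by (meson order_trans)

lemma covering_eq: assumes "covering \<pi> P L" shows "P <#> npi_res \<pi> L = L"
proof
  show "P <#> npi_res \<pi> L \<subseteq> L"
    using covD[OF assms] npi_res_sub[of L \<pi>] by (intro set_mult_least) auto
  show "L \<subseteq> P <#> npi_res \<pi> L" using covD[OF assms] by simp
qed

lemma set_mult_one: "A \<subseteq> carrier G \<Longrightarrow> A <#> {\<one>} = A"
  by (force simp: set_mult_def)

lemma covering_self: "subgroup L G \<Longrightarrow> npi_res \<pi> L = {\<one>} \<Longrightarrow> covering \<pi> L L"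
  by (auto simp: covering_def set_mult_one subgroup.subset)

lemma covering_unique: "covering \<pi> P L \<Longrightarrow> npi_res \<pi> L = {\<one>} \<Longrightarrow> P = L"
  using covering_eq[of \<pi> P L] by (simp add: set_mult_one covD subgroup.subset)

lemma covering_cnj_set: assumes P: "covering \<pi> P L" and x: "x \<in> carrier G" shows "covering \<pi> (cnj_set P x) (cnj_set L x)"
proof -
  note p = covD[OF P]
  have c: "P \<subseteq> carrier G" "L \<subseteq> carrier G" using p by (auto dest: subgroup.subset)
  have "L' \<subseteq> cnj_set P x <#> npi_res \<pi> L'" if L': "subgroup L' G" "cnj_set P x \<subseteq> L'" "L' \<subseteq> cnj_set L x" for L'
  proof -
    have "P \<subseteq> cnj_set L' (inv x)" using cnj_set_mono[OF L'(2), of "inv x"] c x by simp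
    moreover have "cnj_set L' (inv x) \<subseteq> L" using cnj_set_mono[OF L'(3), of "inv x"] c x by simp
    ultimately have "cnj_set L' (inv x) \<subseteq> P <#> npi_res \<pi> (cnj_set L' (inv x))" using p(5) subgroup_cnj_set[OF L'(1)] x by simp
    hence "cnj_set (cnj_set L' (inv x)) x \<subseteq> cnj_set (P <#> npi_res \<pi> (cnj_set L' (inv x))) x" by (rule cnj_set_mono)
    also have "\<dots> = cnj_set P x <#> cnj_set (npi_res \<pi> (cnj_set L' (inv x))) x"
      using x c L' by (intro cnj_set_set_mult) (auto simp: subgroup_cnj_set subgroup_npi_res subgroup.subset)
    also have "cnj_set (npi_res \<pi> (cnj_set L' (inv x))) x = npi_res \<pi> L'"
      using x L' by (simp add: cnj_set_npi_res subgroup_cnj_set subgroup.subset)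
    finally show ?thesis using x L' by (simp add: subgroup.subset)
  qed
  moreover have "npi_res \<pi> (cnj_set P x) = {\<one>}" using cnj_set_npi_res[OF x p(1), of \<pi>] p(4) x by (simp add: cnj_set_def)
  ultimately show ?thesis using p x by (auto simp: covering_def subgroup_cnj_set intro: subsetD[OF cnj_set_mono])
qed

text \<open>An element of L' lies in \<open>W <#> L'\<close>, so it factors into elements of
  \<open>W <#> P\<close>, of W and of the residual of L'. The first two combine to an element of
  \<open>L' \<inter> (W <#> P)\<close>, a subgroup of N in which P is covering.\<close>

lemma covering_lift:
  assumes W: "normal_in W L" and N: "subgroup N G" "W \<subseteq> N" "N \<subseteq> L" and P: "covering \<pi> P N"
    and rel: "\<And>L'. subgroup L' G \<Longrightarrow> W <#> P \<subseteq> L' \<Longrightarrow> L' \<subseteq> L \<Longrightarrow> L' \<subseteq> (W <#> P) <#> npi_res \<pi> L'"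
  shows "covering \<pi> P L"
proof -
  note p = covD[OF P]
  have PL: "P \<subseteq> L" using p N by blast
  note C = normal_in_join[OF W p(1) PL]
  have sW: "subgroup W G" "subgroup L G" using W by (auto simp: normal_in_def)
  have "L' \<subseteq> P <#> npi_res \<pi> L'" if L': "subgroup L' G" "P \<subseteq> L'" "L' \<subseteq> L" for L'
  proof
    note k = normal_in_join[OF W L'(1,3)]
    fix l assume l: "l \<in> L'"
    have "W <#> P \<subseteq> W <#> L'" using L'(2) by (intro mono_set_mult) auto
    hence "W <#> L' \<subseteq> (W <#> P) <#> npi_res \<pi> (W <#> L')" using rel[OF k(1) _ k(5)] by simp
    hence "l \<in> (W <#> P) <#> npi_res \<pi> (W <#> L')" using l k(4) by blast
    then obtain c r where cr: "c \<in> W <#> P" "r \<in> npi_res \<pi> (W <#> L')" "l = c \<otimes> r" by (rule set_multE)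
    obtain w t where wt: "w \<in> W" "t \<in> npi_res \<pi> L'" "r = w \<otimes> t"
      using subsetD[OF npi_res_join[OF W L'(1,3)] cr(2)] by (rule set_multE)
    have tL: "t \<in> L'" using wt npi_res_sub[OF L'(1)] by blast
    have cc: "c \<in> carrier G" "w \<in> carrier G" "t \<in> carrier G"
      using cr wt tL C(1) sW L' sub_carr by blast+
    have cw: "c \<otimes> w \<in> W <#> P" using cr wt C(1,3) by (simp add: subgroup.m_closed subset_iff)
    have le: "l = (c \<otimes> w) \<otimes> t" using cr wt cc by (simp add: m_assoc)
    hence "c \<otimes> w = l \<otimes> inv t" using cc by (simp add: m_assoc)
    hence "c \<otimes> w \<in> L'" using l tL L' by (simp add: subgroup.m_closed subgroup.m_inv_closed)
    hence d: "c \<otimes> w \<in> L' \<inter> (W <#> P)" using cw by simp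
    have WN: "W <#> P \<subseteq> N" using N p by (intro set_mult_least) auto
    have "L' \<inter> (W <#> P) \<subseteq> P <#> npi_res \<pi> (L' \<inter> (W <#> P))"
      using L' C WN by (intro p(5) subgroups_Inter_pair) auto
    also have "\<dots> \<subseteq> P <#> npi_res \<pi> L'" by (intro mono_set_mult npi_res_mono) auto
    finally have "c \<otimes> w \<in> P <#> npi_res \<pi> L'" using d by (rule subsetD)
    then obtain a b where ab: "a \<in> P" "b \<in> npi_res \<pi> L'" "c \<otimes> w = a \<otimes> b" by (rule set_multE)
    have "a \<in> carrier G" "b \<in> carrier G" using ab p subgroup_npi_res[OF L'(1)] sub_carr by blast+
    hence "l = a \<otimes> (b \<otimes> t)" using le ab cc by (simp add: m_assoc)
    moreover have "b \<otimes> t \<in> npi_res \<pi> L'" using ab wt subgroup_npi_res[OF L'(1)] by (simp add: subgroup.m_closed)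
    ultimately show "l \<in> P <#> npi_res \<pi> L'" using ab set_multI by blast
  qed
  thus ?thesis using p PL sW by (auto simp: covering_def)
qed

lemma normal_in_le: "normal_in A L \<Longrightarrow> normal_in B L \<Longrightarrow> A \<subseteq> B \<Longrightarrow> normal_in A B"
  by (auto simp: normal_in_def)

text \<open>The Frattini argument: the conjugate of T by g is another complement, brought back to T
  by an element of Y.\<close>

lemma frattini_complement:
  assumes M: "normal_in M L" and Y: "normal_in Y L" "M \<subseteq> Y" "Y \<subseteq> X" and X: "normal_in X L"
    and p: "pi_num \<sigma> (index X Y)" "pi_num (-\<sigma>) (index Y M)"
    and c: "(\<forall>a\<in>Y. \<forall>b\<in>Y. commut a b \<in> M) \<or> (\<exists>q. prime q \<and> \<sigma> = {q})"
    and T: "complement M Y X T" and g: "g \<in> L"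
  shows "\<exists>z\<in>Y. g \<otimes> z \<in> normalizer_in L T"
proof -
  have MX: "normal_in M X" "normal_in Y X" using assms by (auto intro: normal_in_le)
  obtain z where z: "z \<in> Y" "cnj_set (cnj_set T g) z = T"
    using complement_conj[OF MX Y(2) p c T complement_cnj_set[OF M Y(1) X T g]] by blast
  have s: "subgroup L G" "Y \<subseteq> L" "subgroup T G" using Y T by (auto simp: normal_in_def complement_def)
  have "g \<in> carrier G" "z \<in> carrier G" using g z s sub_carr by blast+
  hence "cnj_set T (g \<otimes> z) = T" using z s cnj_set_cnj_set by (simp add: subgroup.subset)
  thus ?thesis using z g s by (intro bexI[of _ z]) (auto simp: normalizer_in_def subgroup.m_closed subset_iff)
qed

text \<open>If \<open>S/M\<close> is a chief factor of \<open>L\<close> below the residual \<open>S\<close>, then for suitable \<open>\<sigma>\<close> the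
  \<open>\<sigma>\<close>-hull \<open>T/S\<close> of \<open>L/S\<close> is not covered by a normal \<open>\<sigma>\<close>-subgroup of \<open>L/M\<close>. The normalizer of a
  complement \<open>T0\<close> of \<open>S/M\<close> in \<open>T/M\<close> is then a proper subgroup, and by the Frattini argument it
  inherits and controls the covering subgroups of \<open>L\<close>.\<close>

lemma covering_reduction_rel:
  assumes M: "normal_in M L" and S: "S = npi_res \<pi> L" "M \<subseteq> S"
    and \<sigma>: "prime q" "q \<notin> \<pi>" "\<sigma> = {q} \<or> \<sigma> = -{q}" and p: "pi_num (-\<sigma>) (index S M)"
    and c: "(\<forall>a\<in>S. \<forall>b\<in>S. commut a b \<in> M) \<or> (\<exists>q. prime q \<and> \<sigma> = {q})"
    and T: "T = pi_hull \<sigma> S L" and T0: "complement M S T T0" and P: "covering \<pi> P (normalizer_in L T0)"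
    and X: "subgroup X G" "M <#> P \<subseteq> X" "X \<subseteq> L"
  shows "X \<subseteq> (M <#> P) <#> npi_res \<pi> X"
proof -
  have sL: "subgroup L G" "subgroup M G" "M \<subseteq> L" using M by (auto simp: normal_in_def)
  have nS: "normal_in S L" using normal_in_npi_res[OF sL(1)] S by simp
  have sS: "subgroup S G" "S \<subseteq> L" using nS by (auto simp: normal_in_def)
  note OT = pi_hull_normal_in[OF nS, where \<sigma>=\<sigma>, folded T]
  have nT: "normal_in T L" by (rule OT(1))
  have sT: "subgroup T G" "T \<subseteq> L" using nT by (auto simp: normal_in_def)
  have pT: "pi_num \<sigma> (index T S)" using pi_hull_q[OF nS _ \<sigma>(1,2)] pi_hull_q'[OF nS _ \<sigma>(1,2)] \<sigma>(3) S(1) T by auto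
  have sT0: "subgroup T0 G" "M \<subseteq> T0" "T0 \<subseteq> T" "T0 \<inter> S = M" "S <#> T0 = T" using T0 by (auto simp: complement_def)
  have iT0: "index T0 M = index T S" using complement_index(1)[OF normal_in_le[OF nS nT OT(2)] T0 sL(2)] .
  define E where "E = normalizer_in L T0"
  have sE: "subgroup E G" "E \<subseteq> L" "normal_in T0 E"
    using subgroup_normalizer_in[OF sL(1)] normalizer_in_sub normal_in_normalizer_in[OF sL(1) sT0(1)] sT0 sT by (auto simp: E_def subgroup.subset)
  have TE: "T0 \<subseteq> E" using sE by (auto simp: normal_in_def)
  note cP = covD[OF P, folded E_def]
  have ME: "M \<subseteq> E" using sT0 TE by blast
  have nME: "normal_in M E" using normal_in_sub[OF M sE(1) ME sE(2)] .
  define C where "C = M <#> P"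
  note jC = normal_in_join[OF nME cP(1,3), folded C_def]
  have CX: "C \<subseteq> X" using X by (simp add: C_def)
  \<comment> \<open>P is covering in E, so E is the product of C and \<open>S \<inter> E\<close>;
    hence the index of C divides that of M in S.\<close>
  have iEC: "pi_num (-\<sigma>) (index E C)"
  proof -
    define B where "B = S \<inter> E"
    have nB: "normal_in B E" unfolding B_def using normal_in_Int[OF nS sE(1,2)] .
    have sB: "subgroup B G" "M \<subseteq> B" "B \<subseteq> E" using nB ME S by (auto simp: normal_in_def B_def)
    note k = normal_in_join[OF nB jC(1,5)]
    have RB: "npi_res \<pi> E \<subseteq> B" using npi_res_sub[OF sE(1)] npi_res_mono[OF sE(2)] S by (auto simp: B_def)
    have "E \<subseteq> P <#> npi_res \<pi> E" using cP(5)[OF sE(1) cP(3)] by simp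
    also have "\<dots> \<subseteq> C <#> B" using jC(4) RB by (intro mono_set_mult)
    finally have CB: "C <#> B = E" using k by auto
    have "index E C = index B (C \<inter> B)" using index_set_mult[OF jC(1) sB(1)] CB sE by simp
    also have "\<dots> dvd index B M" using jC sB sL by (intro index_dvd2 subgroups_Inter_pair) auto
    also have "\<dots> dvd index S M" using sB sS sL by (intro index_dvd1) (auto simp: B_def)
    finally show ?thesis using p pi_num_dvd by blast
  qed
  \<comment> \<open>\<open>T0\<close> is normal in E with \<sigma>-index over M, whereas C contains
    M and has \<sigma>'-index in E.\<close>
  have TC: "T0 \<subseteq> C"
  proof -
    note k = normal_in_join[OF sE(3) jC(1,5)]
    have i: "subgroup (C \<inter> T0) G" using jC sT0 subgroups_Inter_pair by blast
    have "index T0 (C \<inter> T0) = index (C <#> T0) C" using index_set_mult[OF jC(1) sT0(1)] k by simp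
    also have "\<dots> dvd index E C" using k jC sE by (intro index_dvd1) auto
    finally have "pi_num (-\<sigma>) (index T0 (C \<inter> T0))" using iEC pi_num_dvd by blast
    moreover have "index T0 (C \<inter> T0) dvd index T0 M" using i sT0 sL jC by (intro index_dvd2) auto
    hence "pi_num \<sigma> (index T0 (C \<inter> T0))" using pT iT0 pi_num_dvd by simp
    ultimately have "index T0 (C \<inter> T0) = 1" using pi_num_both by blast
    thus ?thesis using index_1[OF i sT0(1)] by blast
  qed
  have TX: "T0 \<subseteq> X" using TC CX by blast
  define Y where "Y = npi_res \<pi> X"
  have nY: "normal_in Y X" using normal_in_npi_res[OF X(1)] by (simp add: Y_def)
  have YS: "Y \<subseteq> S" "Y \<subseteq> X" using npi_res_mono[OF X(3)] npi_res_sub[OF X(1)] S by (auto simp: Y_def)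
  have MX: "normal_in M X" using normal_in_sub[OF M X(1) _ X(3)] jC(3) CX by blast
  \<comment> \<open>Inside X, \<open>Z\<close> takes the part of S and \<open>D\<close> that of T:
    the same \<open>T0\<close> turns out to be a complement of Z/M in D/M, so the Frattini argument
    works in X.\<close>
  define Z where "Z = M <#> Y"
  have sY: "subgroup Y G" using nY by (simp add: normal_in_def)
  note jZ = normal_in_join[OF MX sY YS(2), folded Z_def]
  have nZ: "normal_in Z X" unfolding Z_def using normal_in_normal_in_join[OF MX nY] .
  have ZS: "Z \<subseteq> S" unfolding Z_def using S YS sS by (intro set_mult_least) auto
  define D where "D = pi_hull \<sigma> Z X"
  note OD = pi_hull_normal_in[OF nZ, where \<sigma>=\<sigma>, folded D_def]
  have sD: "subgroup D G" "D \<subseteq> X" using OD by (auto simp: normal_in_def)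
  have RZ: "npi_res \<pi> X \<subseteq> Z" using jZ(4) by (simp add: Y_def)
  have pD: "pi_num \<sigma> (index D Z)" using pi_hull_q[OF nZ RZ \<sigma>(1,2)] pi_hull_q'[OF nZ RZ \<sigma>(1,2)] \<sigma>(3) D_def by auto
  have pXD: "pi_num (-\<sigma>) (index X D)" using pi_hull_index[OF nZ] by (simp add: D_def)
  have TD: "T0 \<subseteq> D"
  proof -
    note k = normal_in_join[OF OD(1) sT0(1) TX]
    have i: "subgroup (D \<inter> T0) G" using sD sT0 subgroups_Inter_pair by blast
    have "index T0 (D \<inter> T0) = index (D <#> T0) D" using index_set_mult[OF sD(1) sT0(1) k(1)] by simp
    also have "\<dots> dvd index X D" using k sD X by (intro index_dvd1) auto
    finally have "pi_num (-\<sigma>) (index T0 (D \<inter> T0))" using pXD pi_num_dvd by blast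
    moreover have "M \<subseteq> D" using jZ(3) OD(2) by blast
    hence "index T0 (D \<inter> T0) dvd index T0 M" using i sT0 sL by (intro index_dvd2) auto
    hence "pi_num \<sigma> (index T0 (D \<inter> T0))" using pT iT0 pi_num_dvd by simp
    ultimately have "index T0 (D \<inter> T0) = 1" using pi_num_both by blast
    thus ?thesis using index_1[OF i sT0(1)] by blast
  qed
  have pZ: "pi_num (-\<sigma>) (index Z M)"
    using p pi_num_dvd index_dvd1[OF sL(2) jZ(1) sS(1) jZ(3) ZS] by blast
  have DS: "D \<inter> S = Z"
  proof -
    have i: "subgroup (D \<inter> S) G" using sD sS subgroups_Inter_pair by blast
    have ZDS: "Z \<subseteq> D \<inter> S" using OD(2) ZS by blast
    have "index (D \<inter> S) Z dvd index D Z" using i sD jZ ZDS by (intro index_dvd1) auto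
    hence 1: "pi_num \<sigma> (index (D \<inter> S) Z)" using pD pi_num_dvd by blast
    have "index (D \<inter> S) Z dvd index S Z" using i sS jZ ZDS by (intro index_dvd1) auto
    also have "\<dots> dvd index S M" using sS sL jZ ZS by (intro index_dvd2) auto
    finally have "pi_num (-\<sigma>) (index (D \<inter> S) Z)" using p pi_num_dvd by blast
    hence "index (D \<inter> S) Z = 1" using 1 pi_num_both by blast
    thus ?thesis using index_1[OF jZ(1) i ZDS] by simp
  qed
  have DT: "D \<subseteq> T" unfolding D_def using OT(2,3) ZS X by (intro pi_hull_least sT) auto
  have cD: "complement M Z D T0"
  proof -
    have "T0 <#> S = T" using normal_in_join(2)[OF nS sT0(1)] sT0 sT by auto
    hence "D = D \<inter> (T0 <#> S)" using DT by auto
    also have "\<dots> = T0 <#> (D \<inter> S)" using sT0 sD TD sS by (intro dedekind) (auto simp: subgroup.subset)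
    finally have "T0 <#> Z = D" using DS by simp
    hence "Z <#> T0 = D" using normal_in_join(2)[OF nZ sT0(1) TX] by simp
    moreover have "T0 \<inter> Z = M" using sT0 ZS jZ(3) by blast
    ultimately show ?thesis using sT0 TD by (simp add: complement_def)
  qed
  have c': "(\<forall>a\<in>Z. \<forall>b\<in>Z. commut a b \<in> M) \<or> (\<exists>q. prime q \<and> \<sigma> = {q})" using c ZS by blast
  show ?thesis
  proof
    fix g assume g: "g \<in> X"
    obtain z where z: "z \<in> Z" "g \<otimes> z \<in> normalizer_in X T0"
      using frattini_complement[OF MX nZ jZ(3) OD(2) OD(1) pD pZ c' cD g] by blast
    \<comment> \<open>The Frattini factor of g normalizes \<open>T0\<close>, hence lies in this
      intersection, where P is covering.\<close>
    define F where "F = E \<inter> X"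
    have sF: "subgroup F G" "F \<subseteq> E" "P \<subseteq> F" using sE X cP jC CX subgroups_Inter_pair by (auto simp: F_def)
    have "normalizer_in X T0 \<subseteq> F" using X by (auto simp: normalizer_in_def F_def E_def)
    hence gz: "g \<otimes> z \<in> P <#> npi_res \<pi> F" using z cP(5)[OF sF(1,3,2)] by blast
    have "npi_res \<pi> F \<subseteq> Y" unfolding Y_def by (rule npi_res_mono) (simp add: F_def)
    with gz obtain a b where ab: "a \<in> P" "b \<in> Y" "g \<otimes> z = a \<otimes> b" by (elim set_multE) blast
    note k = normal_in_join[OF nY jC(1) CX]
    have in_: "a \<in> Y <#> C" "b \<in> Y <#> C" using ab jC(4) k(3,4) by auto
    have "Z \<subseteq> Y <#> C" unfolding Z_def using k jC(3) by (intro set_mult_least) auto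
    hence "inv z \<in> Y <#> C" using z k(1) by (simp add: subgroup.m_inv_closed subset_iff)
    hence "a \<otimes> b \<otimes> inv z \<in> Y <#> C" using in_ k(1) by (simp add: subgroup.m_closed)
    moreover have "g = a \<otimes> b \<otimes> inv z"
    proof -
      have "g \<in> carrier G" "z \<in> carrier G" using g X z jZ sub_carr by blast+
      thus ?thesis using ab(3)[symmetric] by (simp add: m_assoc)
    qed
    ultimately show "g \<in> (M <#> P) <#> npi_res \<pi> X" using k(2) by (simp add: C_def Y_def)
  qed
qed

text \<open>The \<sigma>-elements of P generate a normal \<sigma>-subgroup U of P. As L = S P, the
  product M U is a complement of S/M in T/M, and P normalizes it; carrying it to \<open>T0\<close>
  by an element of S moves P into the normalizer of \<open>T0\<close>.\<close>

lemma covering_reduction_conj: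
  assumes M: "normal_in M L" and S: "S = npi_res \<pi> L" "M \<subseteq> S"
    and \<sigma>: "prime q" "q \<notin> \<pi>" "\<sigma> = {q} \<or> \<sigma> = -{q}" and p: "pi_num (-\<sigma>) (index S M)"
    and c: "(\<forall>a\<in>S. \<forall>b\<in>S. commut a b \<in> M) \<or> (\<exists>q. prime q \<and> \<sigma> = {q})"
    and T: "T = pi_hull \<sigma> S L" and T0: "complement M S T T0" and P: "covering \<pi> P L"
  shows "\<exists>s\<in>S. cnj_set P s \<subseteq> normalizer_in L T0"
proof -
  have sL: "subgroup L G" "subgroup M G" "M \<subseteq> L" using M by (auto simp: normal_in_def)
  have nS: "normal_in S L" using normal_in_npi_res[OF sL(1)] S by simp
  have sS: "subgroup S G" "S \<subseteq> L" using nS by (auto simp: normal_in_def)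
  note OT = pi_hull_normal_in[OF nS, where \<sigma>=\<sigma>, folded T]
  have sT: "subgroup T G" "T \<subseteq> L" using OT by (auto simp: normal_in_def)
  have pT: "pi_num \<sigma> (index T S)" using pi_hull_q[OF nS _ \<sigma>(1,2)] pi_hull_q'[OF nS _ \<sigma>(1,2)] \<sigma>(3) S(1) T by auto
  note cP = covD[OF P]
  have n1: "normal_in {\<one>} P" using normal_in_one[OF cP(1)] .
  define U where "U = pi_hull \<sigma> {\<one>} P"
  note OU = pi_hull_normal_in[OF n1, where \<sigma>=\<sigma>, folded U_def]
  have sU: "subgroup U G" "U \<subseteq> P" "U \<subseteq> L" using OU cP by (auto simp: normal_in_def)
  have "npi_res \<pi> P \<subseteq> {\<one>}" using cP by simp
  hence pU: "pi_num \<sigma> (index U {\<one>})" using pi_hull_q[OF n1 _ \<sigma>(1,2)] pi_hull_q'[OF n1 _ \<sigma>(1,2)] \<sigma>(3) U_def by auto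
  define T1 where "T1 = M <#> U"
  note j = normal_in_join[OF M sU(1,3), folded T1_def]
  have UT: "U \<subseteq> T" unfolding U_def
    using OT(3) cP(3) sT subgroup.one_closed[OF sT(1)] by (intro pi_hull_least) auto
  have T1T: "T1 \<subseteq> T" unfolding T1_def using UT S OT(2) sT by (intro set_mult_least) auto
  have c1: "complement M S T T1"
  proof -
    have i: "subgroup (T1 \<inter> S) G" using j sS subgroups_Inter_pair by blast
    have "index T1 M = index U (M \<inter> U)" unfolding T1_def using index_set_mult[OF sL(2) sU(1)] j by (simp add: T1_def)
    also have "\<dots> dvd index U {\<one>}" using sL sU triv_subgroup by (intro index_dvd2 subgroups_Inter_pair) (auto simp: subgroup.one_closed)
    finally have a: "pi_num \<sigma> (index T1 M)" using pU pi_num_dvd by blast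
    have "index (T1 \<inter> S) M dvd index T1 M" "index (T1 \<inter> S) M dvd index S M"
      using i sL j sS S by (auto intro!: index_dvd1)
    hence "index (T1 \<inter> S) M = 1" using a p pi_num_both pi_num_dvd by meson
    hence "T1 \<inter> S = M" using index_1[OF sL(2) i] j(3) S(2) by blast
    moreover have "S <#> T1 = T"
    proof -
      note k = normal_in_join[OF nS j(1,5)]
      have "T \<subseteq> S <#> T1" unfolding T
      proof (rule pi_hull_least[OF k(1,3)])
        fix y assume y: "y \<in> L" "pi_elem \<sigma> y"
        have "S <#> P = L" using covering_eq[OF P] normal_in_join(2)[OF nS cP(1,3)] S by simp
        then obtain l where l: "l \<in> P" "pi_elem \<sigma> l" "S #> y = S #> l"
          using pi_elem_lift[OF nS cP(1,3) _ y(2)] y by auto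
        have "y \<in> S #> l" using coset_self_mem[OF sS(1) _ l(3)] y sL sub_carr by blast
        moreover have "l \<in> T1" using OU(3)[OF l(1,2)] j(4) by blast
        ultimately show "y \<in> S <#> T1" by (auto simp: r_coset_def set_mult_def)
      qed
      moreover have "S <#> T1 \<subseteq> T" using OT(2) T1T sT by (intro set_mult_least) auto
      ultimately show ?thesis by blast
    qed
    ultimately show ?thesis using j T1T by (simp add: complement_def)
  qed
  obtain s where s: "s \<in> S" "cnj_set T1 s = T0"
    using complement_conj[OF normal_in_sub[OF M sT(1) _ sT(2)] normal_in_sub[OF nS sT(1) OT(2) sT(2)] S(2) pT p c T0 c1] S(2) OT(2) by blast
  have sc: "s \<in> carrier G" "s \<in> L" using s sS sub_carr by blast+
  have "cnj s a \<in> normalizer_in L T0" if a: "a \<in> P" for a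
  proof -
    have ac: "a \<in> carrier G" "a \<in> L" using a cP sub_carr by blast+
    have Tc: "T1 \<subseteq> carrier G" "M \<subseteq> carrier G" "U \<subseteq> carrier G" using j sL sU by (auto simp: subgroup.subset)
    have T1a: "cnj_set T1 a = T1" unfolding T1_def
      using cnj_set_set_mult[OF ac(1) Tc(2,3)] normal_in_cnj_set[OF M ac(2)] normal_in_cnj_set[OF OU(1) a] by simp
    have "cnj_set T0 (cnj s a) = cnj_set T1 (s \<otimes> cnj s a)" using s(2) sc ac Tc cnj_set_cnj_set[of s "cnj s a" T1] by simp
    also have "s \<otimes> cnj s a = a \<otimes> s" using sc ac by (simp add: cnj_def m_assoc)
    also have "cnj_set T1 (a \<otimes> s) = cnj_set (cnj_set T1 a) s" using sc ac Tc by (simp add: cnj_set_cnj_set)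
    also have "\<dots> = T0" using T1a s by simp
    finally have "cnj_set T0 (cnj s a) = T0" .
    moreover have "cnj s a \<in> L" using normal_in_cnj[OF normal_in_self[OF sL(1)] sc(2) ac(2)] .
    ultimately show ?thesis by (simp add: normalizer_in_def)
  qed
  hence "cnj_set P s \<subseteq> normalizer_in L T0" by (auto simp: cnj_set_def)
  thus ?thesis using s by blast
qed

text \<open>The induction step common to existence and conjugacy: covering subgroups ascend from the
  proper subgroup E to L, and those of L can be conjugated into E.\<close>

lemma covering_reduction:
  assumes ps: "npi_soluble \<pi>" and L: "subgroup L G" and ne: "npi_res \<pi> L \<noteq> {\<one>}"
  shows "\<exists>E. subgroup E G \<and> E \<subseteq> L \<and> E \<noteq> L \<and> (\<forall>P. covering \<pi> P E \<longrightarrow> covering \<pi> P L) \<and>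
     (\<forall>P. covering \<pi> P L \<longrightarrow> (\<exists>x\<in>npi_res \<pi> L. cnj_set P x \<subseteq> E))"
proof -
  define S where "S = npi_res \<pi> L"
  have nS: "normal_in S L" using normal_in_npi_res[OF L] by (simp add: S_def)
  have sS: "subgroup S G" "S \<subseteq> L" using nS by (auto simp: normal_in_def)
  obtain M where M: "normal_in M L" "M \<subseteq> S" "M \<noteq> S"
    "\<And>X. normal_in X L \<Longrightarrow> M \<subseteq> X \<Longrightarrow> X \<subseteq> S \<Longrightarrow> X = M \<or> X = S"
    using ex_chief_below[OF nS] ne unfolding S_def by metis
  have sM: "subgroup M G" using M by (simp add: normal_in_def)
  have "\<not> npi_res \<pi> L \<subseteq> M" using M S_def by blast
  \<comment> \<open>M misses part of the residual, so some commutator of a q-element with a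
    q'-element lies outside M.\<close>
  then obtain x y q where xy: "x \<in> L" "y \<in> L" "prime q" "q \<notin> \<pi>" "pi_elem {q} x" "pi_elem (-{q}) y" "commut x y \<notin> M"
    using npi_res_least[OF sM, of L \<pi>] by blast
  have xyc: "x \<in> carrier G" "y \<in> carrier G" using xy L sub_carr by blast+
  have xyS: "commut x y \<in> S" unfolding S_def using npi_res_commut xy by blast
  have yx: "commut y x \<in> S" "commut y x \<notin> M" using commut_sym_in sS sM xy xyc xyS by blast+
  \<comment> \<open>\<sigma> has to avoid the order of S/M: it is {q} if q does not divide this
    order; otherwise S/M is an abelian q-group and \<sigma> is -{q}. The \<sigma>-entry w of the
    commutator will show that \<open>T0\<close> is not normal.\<close>
  have "\<exists>\<sigma> w v. (\<sigma> = {q} \<or> \<sigma> = -{q}) \<and> pi_elem \<sigma> w \<and> w \<in> L \<and> v \<in> L \<and> commut w v \<in> S \<and> commut w v \<notin> M \<and> pi_num (-\<sigma>) (index S M) \<and>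
    ((\<forall>a\<in>S. \<forall>b\<in>S. commut a b \<in> M) \<or> (\<exists>q. prime q \<and> \<sigma> = {q}))"
  proof (cases "pi_num (-{q}) (index S M)")
    case True
    thus ?thesis using xy xyS by (intro exI[of _ "{q}"] exI[of _ x] exI[of _ y]) auto
  next
    case False
    have "\<not> pi_num \<pi> (index S M)" using False xy(4) by (auto elim!: contrapos_nn pi_num_mono)
    then obtain p where p: "prime p" "p \<notin> \<pi>" "pi_num {p} (index S M)" "\<forall>a\<in>S. \<forall>b\<in>S. commut a b \<in> M"
      using chief_factor[OF ps M(1) nS M(2,3,4)] by blast
    have "p = q" using False p(3) pi_num_mono[of "{p}" "index S M" "-{q}"] by auto
    thus ?thesis using xy yx p by (intro exI[of _ "-{q}"] exI[of _ y] exI[of _ x]) auto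
  qed
  then obtain \<sigma> w v where \<sigma>: "\<sigma> = {q} \<or> \<sigma> = -{q}" and w: "pi_elem \<sigma> w" "w \<in> L" "v \<in> L" "commut w v \<in> S" "commut w v \<notin> M"
    and p: "pi_num (-\<sigma>) (index S M)" and c: "(\<forall>a\<in>S. \<forall>b\<in>S. commut a b \<in> M) \<or> (\<exists>q. prime q \<and> \<sigma> = {q})" by blast
  define T where "T = pi_hull \<sigma> S L"
  note OT = pi_hull_normal_in[OF nS, where \<sigma>=\<sigma>, folded T_def]
  have sT: "subgroup T G" "T \<subseteq> L" using OT by (auto simp: normal_in_def)
  have pT: "pi_num \<sigma> (index T S)" using pi_hull_q[OF nS _ xy(3,4)] pi_hull_q'[OF nS _ xy(3,4)] \<sigma> T_def S_def by auto
  have nT: "normal_in M T" "normal_in S T" using normal_in_le[OF M(1) OT(1)] normal_in_le[OF nS OT(1)] M(2) OT(2) by auto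
  obtain T0 where T0: "complement M S T T0" using complement_ex[OF nT M(2) pT p c] by blast
  have sT0: "subgroup T0 G" "T0 \<subseteq> T" "M \<subseteq> T0" "T0 \<inter> S = M" using T0 by (auto simp: complement_def)
  define E where "E = normalizer_in L T0"
  have sE: "subgroup E G" "E \<subseteq> L" "normal_in T0 E"
    using subgroup_normalizer_in[OF L] normalizer_in_sub normal_in_normalizer_in[OF L sT0(1)] sT0 sT by (auto simp: E_def subgroup.subset)
  \<comment> \<open>If \<open>T0\<close> were normal in L, it would contain the \<sigma>-element w,
    and the commutator of w and v would lie in \<open>T0 \<inter> S = M\<close>.\<close>
  have "E \<noteq> L"
  proof
    assume "E = L"
    hence nT0: "normal_in T0 L" using sE by simp
    have "pi_num (-\<sigma>) (index T T0)" using complement_index(2)[OF nT(2) T0 sM] p by simp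
    hence "w \<in> T0" using pi_elem_in[OF normal_in_le[OF nT0 OT(1) sT0(2)]] OT(3) w by blast
    hence "commut w v \<in> T0" using commut_normal_in(1)[OF nT0] w by blast
    thus False using w sT0 by blast
  qed
  moreover have "covering \<pi> P L" if P: "covering \<pi> P E" for P
  proof (rule covering_lift[OF M(1) sE(1) _ sE(2) P])
    show "M \<subseteq> E" using sT0 sE by (auto simp: normal_in_def)
    fix X assume "subgroup X G" "M <#> P \<subseteq> X" "X \<subseteq> L"
    thus "X \<subseteq> (M <#> P) <#> npi_res \<pi> X"
      using covering_reduction_rel[OF M(1) S_def M(2) xy(3,4) \<sigma> p c T_def T0 P[unfolded E_def]] by blast
  qed
  moreover have "\<exists>x\<in>npi_res \<pi> L. cnj_set P x \<subseteq> E" if P: "covering \<pi> P L" for P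
    using covering_reduction_conj[OF M(1) S_def M(2) xy(3,4) \<sigma> p c T_def T0 P] by (simp add: S_def E_def)
  ultimately show ?thesis using sE by blast
qed

theorem covering_ex: "npi_soluble \<pi> \<Longrightarrow> subgroup L G \<Longrightarrow> \<exists>P. covering \<pi> P L"
proof (induction "card L" arbitrary: L rule: less_induct)
  case less
  show ?case
  proof (cases "npi_res \<pi> L = {\<one>}")
    case True thus ?thesis using covering_self less by blast
  next
    case False
    obtain E where E: "subgroup E G" "E \<subseteq> L" "E \<noteq> L" "\<forall>P. covering \<pi> P E \<longrightarrow> covering \<pi> P L"
      using covering_reduction[OF less.prems False] by blast
    have "card E < card L" using E less.prems by (intro psubset_card_mono) auto
    thus ?thesis using less.hyps[OF _ less.prems(1) E(1)] E by blast
  qed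
qed

theorem covering_conj: "npi_soluble \<pi> \<Longrightarrow> covering \<pi> P L \<Longrightarrow> covering \<pi> P' L \<Longrightarrow> \<exists>x\<in>npi_res \<pi> L. cnj_set P' x = P"
proof (induction "card L" arbitrary: L P P' rule: less_induct)
  case less
  have L: "subgroup L G" using covD(2)[OF less.prems(2)] .
  have c: "P \<subseteq> carrier G" "P' \<subseteq> carrier G" using covD(1)[OF less.prems(2)] covD(1)[OF less.prems(3)] by (auto simp: subgroup.subset)
  show ?case
  proof (cases "npi_res \<pi> L = {\<one>}")
    case True
    hence "P = L" "P' = L" using covering_unique less.prems by blast+
    thus ?thesis using c by (auto simp: True)
  next
    case False
    obtain E where E: "subgroup E G" "E \<subseteq> L" "E \<noteq> L"
      "\<forall>P. covering \<pi> P L \<longrightarrow> (\<exists>x\<in>npi_res \<pi> L. cnj_set P x \<subseteq> E)"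
      using covering_reduction[OF less.prems(1) L False] by blast
    have lt: "card E < card L" using E L by (intro psubset_card_mono) auto
    have sR: "subgroup (npi_res \<pi> L) G" using subgroup_npi_res[OF L] .
    obtain a where a: "a \<in> npi_res \<pi> L" "cnj_set P a \<subseteq> E" using E less.prems by blast
    obtain b where b: "b \<in> npi_res \<pi> L" "cnj_set P' b \<subseteq> E" using E less.prems by blast
    have ac: "a \<in> carrier G" "b \<in> carrier G" "a \<in> L" "b \<in> L" using a b sR npi_res_sub[OF L] sub_carr by blast+
    have "covering \<pi> (cnj_set P a) E" "covering \<pi> (cnj_set P' b) E"
      using covering_sub[OF covering_cnj_set[OF less.prems(2) ac(1)] E(1) a(2)] covering_sub[OF covering_cnj_set[OF less.prems(3) ac(2)] E(1) b(2)]
        E(2) cnj_set_self[OF L ac(3)] cnj_set_self[OF L ac(4)] by auto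
    from less.hyps[OF lt less.prems(1) this] obtain e where e: "e \<in> npi_res \<pi> E" "cnj_set (cnj_set P' b) e = cnj_set P a" by blast
    have eR: "e \<in> npi_res \<pi> L" using e npi_res_mono[OF E(2)] by blast
    have ec: "e \<in> carrier G" using eR sR sub_carr by blast
    \<comment> \<open>Into E by b, inside E by the inductive conjugator e, and back by
      \<open>inv a\<close>; all three lie in the residual of L.\<close>
    have "cnj_set P' (b \<otimes> e \<otimes> inv a) = cnj_set (cnj_set (cnj_set P' b) e) (inv a)"
      using ac ec c by (simp add: cnj_set_cnj_set m_assoc)
    also have "\<dots> = P" using e ac c by simp
    finally show ?thesis using a b eR sR
      by (intro bexI[of _ "b \<otimes> e \<otimes> inv a"]) (auto simp: subgroup.m_closed subgroup.m_inv_closed)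
  qed
qed

subsection \<open>Dnormal subgroups and Fitting sets\<close>

lemma pi_group_Mod:
  assumes "normal_in N H"
  shows "pi_group \<pi> (G\<lparr>carrier := H\<rparr> Mod N) \<longleftrightarrow> pi_num \<pi> (index H N)"
proof -
  interpret Q: fin_group "G\<lparr>carrier := H\<rparr> Mod N" by (rule quotient_context(1)[OF assms])
  have "index H N > 0" using assms by (intro index_pos) (auto simp: normal_in_def)
  thus ?thesis using order_Mod[OF assms] by (auto simp: pi_group_def pi_num_def Q.is_group)
qed

text \<open>The \<pi>'-elements lie in every normal subgroup with \<pi>-quotient, and the subgroup
  they generate has \<pi>-index.\<close>

lemma O_upper_eq:
  assumes H: "subgroup H G"
  shows "O_upper \<pi> (G\<lparr>carrier := H\<rparr>) = pi_hull (-\<pi>) {\<one>} H"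
  unfolding O_upper_def residual_def
proof (rule Least_equality)
  have n1: "normal_in {\<one>} H" using normal_in_one[OF H] .
  have n: "normal_in (pi_hull (-\<pi>) {\<one>} H) H" using pi_hull_normal_in(1)[OF n1] .
  thus "pi_hull (-\<pi>) {\<one>} H \<lhd> G\<lparr>carrier := H\<rparr> \<and> pi_group \<pi> (G\<lparr>carrier := H\<rparr> Mod pi_hull (-\<pi>) {\<one>} H)"
    using pi_hull_index[OF n1, of "-\<pi>"] normal_iff_normal_in[OF H] pi_group_Mod[OF n] by simp
  fix N assume N: "N \<lhd> G\<lparr>carrier := H\<rparr> \<and> pi_group \<pi> (G\<lparr>carrier := H\<rparr> Mod N)"
  hence nN: "normal_in N H" using normal_iff_normal_in[OF H] by simp
  hence "pi_num (-(-\<pi>)) (index H N)" using N pi_group_Mod by simp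
  thus "pi_hull (-\<pi>) {\<one>} H \<subseteq> N" using pi_elem_in[OF nN, of "-\<pi>"] nN
    by (intro pi_hull_least) (auto simp: normal_in_def subgroup.one_closed)
qed

lemma normal_in_pi_hull_one: assumes "normal_in H X" shows "normal_in (pi_hull \<sigma> {\<one>} H) X"
proof (rule nrmI)
  have s: "subgroup H G" "subgroup X G" "H \<subseteq> X" using assms by (auto simp: normal_in_def)
  note n = pi_hull_normal_in[OF normal_in_one[OF s(1)], where \<sigma> = \<sigma>]
  show "subgroup (pi_hull \<sigma> {\<one>} H) G" "subgroup X G" "pi_hull \<sigma> {\<one>} H \<subseteq> X" using n(1) s by (auto simp: normal_in_def)
  fix x assume x: "x \<in> X"
  have xc: "x \<in> carrier G" using x s sub_carr by blast
  let ?S = "{\<one>} \<union> {x \<in> H. pi_elem \<sigma> x}"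
  have "cnj_set ?S x \<subseteq> ?S" using normal_in_cnj[OF assms x] pi_elem_cnj xc by (auto simp: cnj_set_def)
  moreover have "?S \<subseteq> carrier G" using s by (auto simp: sub_carr)
  ultimately show "cnj_set (pi_hull \<sigma> {\<one>} H) x \<subseteq> pi_hull \<sigma> {\<one>} H" unfolding pi_hull_def using cnj_set_generate[OF xc] mono_generate by metis
qed

text \<open>\<open>normalizer\<close> is the stabilizer under g H g^-1, while \<open>cnj_set\<close>
  conjugates by the inverse; the stabilizers agree.\<close>

lemma normalizer_eq_normalizer_in:
  assumes X: "subgroup X G" and H: "H \<subseteq> X"
  shows "normalizer (G\<lparr>carrier := X\<rparr>) H = normalizer_in X H"
proof -
  have Hc: "H \<subseteq> carrier G" using H X subgroup.subset by blast
  have "g <# H #> inv g = cnj_set H (inv g)" if "g \<in> carrier G" for g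
    using that Hc by (auto simp: l_coset_def r_coset_def cnj_set_def cnj_def)
  moreover have "inv\<^bsub>G\<lparr>carrier := X\<rparr>\<^esub> g = inv g" if "g \<in> X" for g using m_inv_consistent[OF X that] .
  moreover have "cnj_set H (inv g) = H \<longleftrightarrow> cnj_set H g = H" "g \<in> carrier G" if "g \<in> X" for g
    using cnj_set_inv_cancel[OF sub_carr[OF X that] Hc] sub_carr[OF X that] by metis+
  ultimately have "(g <# H #> inv\<^bsub>G\<lparr>carrier := X\<rparr>\<^esub> g = H) = (cnj_set H g = H)" if "g \<in> X" for g using that by simp
  thus ?thesis using H unfolding normalizer_def stabilizer_def normalizer_in_def by (auto simp del: restrict_apply simp: restrict_def)
qed

lemma normal_in_normalizer_in_eq: "normal_in H X \<Longrightarrow> normalizer_in X H = X"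
  by (auto simp: normal_in_def normalizer_in_def)

lemma sylow_subgroup_sub: "subgroup X G \<Longrightarrow> sylow_subgroup p (G\<lparr>carrier := X\<rparr>) P \<Longrightarrow>
    subgroup P G \<and> P \<subseteq> X \<and> card P = p ^ multiplicity p (card X)"
  unfolding sylow_subgroup_def order_def using incl_subgroup[of X P] subgroup.subset[of P] by fastforce

text \<open>The condition is asked of all Sylow subgroups, so that \<open>reduces_into\<close>
  disappears, and O^\<pi>(H) is required to be normal in the whole of X.\<close>

lemma dnormalI:
  assumes X: "subgroup X G" and H: "subgroup H G" "H \<subseteq> X"
    and 1: "\<And>p P. p \<in> prime_compl \<pi> \<Longrightarrow> subgroup P G \<Longrightarrow> P \<subseteq> X \<Longrightarrow> card P = p ^ multiplicity p (card X) \<Longrightarrow> P \<subseteq> normalizer_in X H"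
    and 2: "\<And>p. \<pi> = {p} \<Longrightarrow> normal_in H X"
    and 3: "normal_in (pi_hull (-\<pi>) {\<one>} H) X"
  shows "npi_dnormal \<pi> (G\<lparr>carrier := X\<rparr>) H"
proof -
  have "pi_hull (-\<pi>) {\<one>} H \<subseteq> X" using 3 by (simp add: normal_in_def)
  hence n: "normalizer (G\<lparr>carrier := X\<rparr>) (pi_hull (-\<pi>) {\<one>} H) = X" using normalizer_eq_normalizer_in[OF X] normal_in_normalizer_in_eq[OF 3] by simp
  show ?thesis unfolding npi_dnormal_def
  proof (intro conjI allI impI)
    show "subgroup H (G\<lparr>carrier := X\<rparr>)" using subgroup_incl[OF H(1) X H(2)] .
    show "P \<subseteq> normalizer (G\<lparr>carrier := X\<rparr>) H" if "p \<in> prime_compl \<pi>" "sylow_subgroup p (G\<lparr>carrier := X\<rparr>) P" for p P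
      using 1 that sylow_subgroup_sub[OF X that(2)] normalizer_eq_normalizer_in[OF X H(2)] by auto
    show "P \<subseteq> normalizer (G\<lparr>carrier := X\<rparr>) H" if "\<pi> = {p}" "sylow_subgroup p (G\<lparr>carrier := X\<rparr>) P" for p P
      using normal_in_normalizer_in_eq[OF 2[OF that(1)]] sylow_subgroup_sub[OF X that(2)] normalizer_eq_normalizer_in[OF X H(2)] by auto
    show "P \<subseteq> normalizer (G\<lparr>carrier := X\<rparr>) (O_upper \<pi> (G\<lparr>carrier := X\<rparr>\<lparr>carrier := H\<rparr>))"
      if "sylow_subgroup p (G\<lparr>carrier := X\<rparr>) P" for p P
      using sylow_subgroup_sub[OF X that] n O_upper_eq[OF H(1)] by simp
  qed
qed

lemma dnormal_normal:
  assumes "normal_in H X" shows "npi_dnormal \<pi> (G\<lparr>carrier := X\<rparr>) H"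
  using assms normal_in_pi_hull_one[OF assms, of "-\<pi>"] normal_in_normalizer_in_eq[OF assms] by (intro dnormalI) (auto simp: normal_in_def)

text \<open>Sylow subgroups for primes outside \<pi> consist of \<pi>'-elements and so lie in H;
  moreover O^\<pi>(H) = O^\<pi>(X) is normal in X.\<close>

lemma dnormal_pi:
  assumes X: "subgroup X G" and H: "subgroup H G" "H \<subseteq> X" and e: "\<And>x. x \<in> X \<Longrightarrow> pi_elem (-\<pi>) x \<Longrightarrow> x \<in> H"
    and c: "infinite \<pi> \<or> card \<pi> \<ge> 2"
  shows "npi_dnormal \<pi> (G\<lparr>carrier := X\<rparr>) H"
proof (rule dnormalI[OF X H])
  fix p P assume p: "p \<in> prime_compl \<pi>" "subgroup P G" "P \<subseteq> X" "card P = p ^ multiplicity p (card X)"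
  have "prime p" "p \<notin> \<pi>" using p by (auto simp: prime_compl_def)
  hence "pi_num (-\<pi>) (card P)" using p(4) pi_num_mono[OF pi_num_power, of p "-\<pi>"] by auto
  hence "P \<subseteq> H" using pi_elem_card[OF p(2)] e p(3) by blast
  thus "P \<subseteq> normalizer_in X H" using H cnj_set_self[OF H(1)] by (auto simp: normalizer_in_def)
next
  fix p assume "\<pi> = {p}" thus "normal_in H X" using c by auto
next
  have "{x \<in> H. pi_elem (-\<pi>) x} = {x \<in> X. pi_elem (-\<pi>) x}" using e H by auto
  hence "pi_hull (-\<pi>) {\<one>} H = pi_hull (-\<pi>) {\<one>} X" by (simp add: pi_hull_def)
  thus "normal_in (pi_hull (-\<pi>) {\<one>} H) X" using pi_hull_normal_in(1)[OF normal_in_one[OF X]] by simp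
qed

text \<open>Some Sylow q-subgroup Q of L meets M in a Sylow q-subgroup R of M that is smaller than
  Q. An element of Q outside R normalizing R also conjugates the q'-elements of M into M, hence all
  of M by \<open>gen_q\<close>.\<close>

lemma normalizer_growth:
  assumes L: "subgroup L G" and M: "subgroup M G" "M \<subseteq> L" and q: "prime q"
    and ns: "\<And>P. sylow_in q L P \<Longrightarrow> \<not> P \<subseteq> M"
    and h: "\<And>x y. x \<in> L \<Longrightarrow> y \<in> M \<Longrightarrow> pi_elem {q} x \<Longrightarrow> pi_elem (-{q}) y \<Longrightarrow> cnj x y \<in> M"
  shows "\<exists>x\<in>L. x \<notin> M \<and> cnj_set M x = M"
proof -
  obtain Q' where Q': "sylow_in q M Q'" using sylow_in_ex q M by blast
  obtain P where P: "sylow_in q L P" using sylow_in_ex q L by blast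
  have sQ': "subgroup Q' G" "Q' \<subseteq> M" "pi_num {q} (card Q')" "pi_num (-{q}) (index M Q')" using Q' by (auto simp: sylow_in_def)
  have "Q' \<subseteq> L" using sQ' M by blast
  then obtain a where a: "a \<in> L" "Q' \<subseteq> cnj_set P a" using sylow_in_dom[OF L q P sQ'(1)] sQ' by blast
  define Q where "Q = cnj_set P a"
  have Q: "sylow_in q L Q" unfolding Q_def using sylow_in_cnj_set[OF P a(1) L] .
  have sQ: "subgroup Q G" "Q \<subseteq> L" "pi_num {q} (card Q)" using Q by (auto simp: sylow_in_def)
  define R where "R = Q \<inter> M"
  have sR: "subgroup R G" "R \<subseteq> M" "Q' \<subseteq> R" using sQ M sQ' a subgroups_Inter_pair by (auto simp: R_def Q_def)
  have "index M R dvd index M Q'" using sR sQ' M by (intro index_dvd2) auto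
  hence "pi_num (-{q}) (index M R)" using sQ' pi_num_dvd by blast
  moreover have "card R dvd card Q" using sR sQ by (intro card_dvd) (auto simp: R_def)
  hence "pi_num {q} (card R)" using sQ pi_num_dvd by blast
  ultimately have R: "sylow_in q M R" using sR by (simp add: sylow_in_def)
  have "R \<subset> Q" using ns[OF Q] by (auto simp: R_def)
  then obtain x where x: "x \<in> Q" "x \<notin> R" "cnj_set R x = R" using p_growth[OF q sQ(1,3) sR(1)] by blast
  have xq: "pi_elem {q} x" using pi_elem_card[OF sQ(1,3) x(1)] .
  have xc: "x \<in> carrier G" "x \<in> L" using x sQ sub_carr by auto
  have Mc: "M \<subseteq> carrier G" using M by (simp add: subgroup.subset)
  \<comment> \<open>The elements of M that x conjugates into M.\<close>
  define D where "D = M \<inter> cnj_set M (inv x)"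
  have D: "d \<in> D" if "d \<in> M" "cnj x d \<in> M" for d
  proof -
    have "cnj (inv x) (cnj x d) \<in> cnj_set M (inv x)" using that by (auto simp: cnj_set_def)
    thus ?thesis using that xc Mc by (auto simp: D_def)
  qed
  have "D = M"
  proof (rule gen_q[OF _ M(1) _ R _ q])
    show "subgroup D G" "D \<subseteq> M" using M xc subgroup_cnj_set[of M "inv x"] subgroups_Inter_pair by (auto simp: D_def)
    have "cnj x r \<in> M" if "r \<in> R" for r using x(3) that sR by (auto simp: cnj_set_def)
    thus "R \<subseteq> D" using D sR by blast
    show "y \<in> D" if "y \<in> M" "pi_elem (-{q}) y" for y using D that h[OF xc(2) _ xq] by blast
  qed
  hence "M \<subseteq> cnj_set M (inv x)" by (auto simp: D_def)
  hence "cnj_set M x \<subseteq> M" using cnj_set_mono[of M "cnj_set M (inv x)" x] xc Mc by simp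
  hence "cnj_set M x = M" using card_cnj_set[OF xc(1) Mc] M by (intro card_subset_eq) auto
  moreover have "x \<notin> M" using x by (auto simp: R_def)
  ultimately show ?thesis using xc by blast
qed

lemma pi_elem_UNIV: "x \<in> carrier G \<Longrightarrow> pi_elem UNIV x"
  using pow_order_eq_1[of x] order_gt_0_iff_finite by (auto simp: pi_elem_def pi_num_def intro!: exI[of _ "order G"])

end

section \<open>F-maximal subgroups for a Fitting set\<close>

locale npi_fitting = fin_group +
  fixes \<pi> :: "nat set" and F :: "'a set set"
  assumes primes: "\<pi> \<subseteq> {p. prime p}"
    and fit: "npi_fitting_set \<pi> G F"
    and ps: "npi_soluble \<pi>"
begin

lemma F_sub: "S \<in> F \<Longrightarrow> subgroup S G"
  using fit by (simp add: npi_fitting_set_def)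

lemma F_cnj_set: "S \<in> F \<Longrightarrow> x \<in> carrier G \<Longrightarrow> cnj_set S x \<in> F"
  using fit by (simp add: npi_fitting_set_def)

lemma F_normal_in: assumes S: "S \<in> F" and T: "normal_in T S" shows "T \<in> F"
proof -
  have s: "subgroup T G" "subgroup S G" "T \<subseteq> S" using T by (auto simp: normal_in_def)
  have "npi_dsubnormal \<pi> (G\<lparr>carrier := S\<rparr>) T"
    unfolding npi_dsubnormal_def
  proof (intro exI[of _ "1::nat"] exI[of _ "\<lambda>i::nat. if i = 0 then T else S"] conjI allI impI)
    fix i :: nat
    show "subgroup (if i = 0 then T else S) (G\<lparr>carrier := S\<rparr>)"
      using s subgroup_incl[OF s(1,2,3)] subgroup_incl[OF s(2,2)] by simp
    show "npi_dnormal \<pi> (G\<lparr>carrier := S\<rparr>\<lparr>carrier := if Suc i = 0 then T else S\<rparr>) (if i = 0 then T else S)" if "i < 1"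
      using dnormal_normal[OF T] that by simp
  qed auto
  thus ?thesis using fit S by (auto simp: npi_fitting_set_def)
qed

lemma F_join_dnormal: "S \<in> F \<Longrightarrow> T \<in> F \<Longrightarrow> npi_dnormal \<pi> (G\<lparr>carrier := generate G (S \<union> T)\<rparr>) S \<Longrightarrow>
   npi_dnormal \<pi> (G\<lparr>carrier := generate G (S \<union> T)\<rparr>) T \<Longrightarrow> generate G (S \<union> T) \<in> F"
  using fit by (simp add: npi_fitting_set_def)

lemma F_join: assumes "S \<in> F" "T \<in> F" "normal_in S C" "normal_in T C" shows "S <#> T \<in> F"
proof -
  have s: "subgroup S G" "subgroup T G" "T \<subseteq> C" "S \<subseteq> C" using assms by (auto simp: normal_in_def)
  note j = normal_in_join[OF assms(3) s(2,3)]
  have g: "generate G (S \<union> T) = S <#> T" using generate_join[OF s(1,2)] j by simp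
  have "normal_in S (S <#> T)" "normal_in T (S <#> T)" using normal_in_sub[OF assms(3) j(1) j(3,5)] normal_in_sub[OF assms(4) j(1) j(4,5)] by auto
  thus ?thesis using F_join_dnormal[OF assms(1,2)] dnormal_normal g by simp
qed

lemma Fmax_F: "F_maximal F H V \<Longrightarrow> V \<in> F" "F_maximal F H V \<Longrightarrow> V \<subseteq> H" "F_maximal F H V \<Longrightarrow> subgroup V G"
  using F_sub by (auto simp: F_maximal_def)

lemma FmaxD: "F_maximal F H V \<Longrightarrow> U \<in> F \<Longrightarrow> U \<subseteq> H \<Longrightarrow> V \<subseteq> U \<Longrightarrow> U = V"
  by (auto simp: F_maximal_def)

lemma Fmax_sub: "F_maximal F H V \<Longrightarrow> V \<subseteq> X \<Longrightarrow> X \<subseteq> H \<Longrightarrow> F_maximal F X V"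
  by (auto simp: F_maximal_def)

lemma Fmax_cnj_set: assumes V: "F_maximal F H V" and x: "x \<in> carrier G" and H: "H \<subseteq> carrier G"
  shows "F_maximal F (cnj_set H x) (cnj_set V x)"
proof -
  have "L = cnj_set V x" if L: "L \<in> F" "L \<subseteq> cnj_set H x" "cnj_set V x \<subseteq> L" for L
  proof -
    have c: "L \<subseteq> carrier G" "V \<subseteq> carrier G" using F_sub[OF L(1)] Fmax_F(3)[OF V] by (auto simp: subgroup.subset)
    have "cnj_set L (inv x) \<subseteq> H" "V \<subseteq> cnj_set L (inv x)"
      using cnj_set_mono[OF L(2), of "inv x"] cnj_set_mono[OF L(3), of "inv x"] c x H by simp_all
    hence "cnj_set L (inv x) = V" using FmaxD[OF V F_cnj_set[OF L(1)]] x by simp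
    thus ?thesis using c x cnj_set_inv_cancel(2)[OF x c(1)] by simp
  qed
  thus ?thesis using V F_cnj_set x cnj_set_mono[of V H x] by (auto simp: F_maximal_def)
qed

text \<open>The product of V and U belongs to F and equals V by maximality; thus V is the F-radical
  of C.\<close>

lemma Fmax_normal_unique:
  assumes V: "F_maximal F H V" and C: "C \<subseteq> H" "normal_in V C" and U: "U \<in> F" "normal_in U C"
  shows "U \<subseteq> V"
proof -
  have sU: "subgroup U G" "U \<subseteq> C" using U by (auto simp: normal_in_def)
  note j = normal_in_join[OF C(2) sU]
  have "V <#> U = V" using FmaxD[OF V F_join[OF Fmax_F(1)[OF V] U(1) C(2) U(2)]] j C(1) by blast
  thus ?thesis using j(4) by simp
qed

text \<open>\<open>K \<inter> U\<close> is normal in U, hence in F, and W is maximal in K.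
  Consequently U/W embeds in L/K for each such U.\<close>

lemma Fmax_Int:
  assumes W: "F_maximal F K W" and K: "normal_in K L" and U: "U \<in> F" "U \<subseteq> L" "W \<subseteq> U"
  shows "K \<inter> U = W"
proof (rule FmaxD[OF W])
  show "K \<inter> U \<in> F" using F_normal_in[OF U(1) normal_in_Int[OF K F_sub[OF U(1)] U(2)]] .
qed (use U Fmax_F(2)[OF W] in auto)

text \<open>The only use of (FS2) for subgroups that need not be normal in their join.\<close>

lemma Fmax_normal_pi:
  assumes T: "subgroup T G" and V: "F_maximal F T V" and e: "\<And>x. x \<in> T \<Longrightarrow> pi_elem (-\<pi>) x \<Longrightarrow> x \<in> V"
  shows "normal_in V T"
proof -
  have sV: "subgroup V G" "V \<subseteq> T" "V \<in> F" using Fmax_F[OF V] by auto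
  have Tc: "T \<subseteq> carrier G" "V \<subseteq> carrier G" using T sV by (auto simp: subgroup.subset)
  \<comment> \<open>For primes in \<pi> the conditions in \<open>npi_dnormal\<close> depend on the
    size of \<pi>: with at least two elements they concern O^\<pi>, for a singleton the subgroup
    itself.\<close>
  consider "infinite \<pi> \<or> card \<pi> \<ge> 2" | "\<pi> = {}" | p where "\<pi> = {p}"
  proof (cases "infinite \<pi> \<or> card \<pi> \<ge> 2")
    case True thus ?thesis using that by blast
  next
    case False
    hence f: "finite \<pi>" and "card \<pi> = 0 \<or> card \<pi> = 1" by linarith+
    hence "\<pi> = {} \<or> (\<exists>p. \<pi> = {p})" by (metis card_0_eq card_1_singletonE)
    thus ?thesis using that by blast
  qed
  thus ?thesis
  proof cases
    case 1
    \<comment> \<open>V and its conjugate contain all \<pi>'-elements of their join, so both are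
      Dnormal there and the join is V by maximality.\<close>
    show ?thesis
    proof (rule nrmI[OF sV(1) T sV(2)])
      fix r assume r: "r \<in> T"
      have rc: "r \<in> carrier G" using r Tc by blast
      let ?U = "cnj_set V r" and ?X = "generate G (V \<union> cnj_set V r)"
      have sU: "subgroup ?U G" "?U \<in> F" using subgroup_cnj_set[OF sV(1) rc] F_cnj_set[OF sV(3) rc] by auto
      have "?U \<subseteq> T" using cnj_set_mono[OF sV(2), of r] cnj_set_self[OF T r] by simp
      hence XT: "?X \<subseteq> T" using sV T by (intro generate_subgroup_incl) auto
      have "V \<union> ?U \<subseteq> carrier G" using Tc \<open>?U \<subseteq> T\<close> by blast
      hence sX: "subgroup ?X G" by (rule generate_is_subgroup)
      have inX: "V \<subseteq> ?X" "?U \<subseteq> ?X" by (auto intro: generate.incl)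
      have "x \<in> V \<and> x \<in> ?U" if x: "x \<in> ?X" "pi_elem (-\<pi>) x" for x
      proof
        have xT: "x \<in> T" using x XT by blast
        thus "x \<in> V" using e x by blast
        have xc: "x \<in> carrier G" using xT Tc by blast
        have "inv r \<in> T" using r T by (simp add: subgroup.m_inv_closed)
        hence "cnj (inv r) x \<in> T" using normal_in_cnj[OF normal_in_self[OF T]] xT by blast
        hence "cnj (inv r) x \<in> V" using e pi_elem_cnj[OF x(2), of "inv r"] rc by simp
        hence "cnj r (cnj (inv r) x) \<in> ?U" by (auto simp: cnj_set_def)
        thus "x \<in> ?U" using rc xc by simp
      qed
      hence "?X \<in> F" using dnormal_pi[OF sX sV(1) inX(1) _ 1] dnormal_pi[OF sX sU(1) inX(2) _ 1]
        F_join_dnormal[OF sV(3) sU(2)] by blast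
      hence "?X = V" using FmaxD[OF V] XT inX by blast
      thus "cnj_set V r \<subseteq> V" using inX by blast
    qed
  next
    case 2
    \<comment> \<open>With \<pi> empty, every element of T is a \<pi>'-element.\<close>
    hence "V = T" using e pi_elem_UNIV Tc sV by auto
    thus ?thesis using normal_in_self[OF T] by simp
  next
    case 3
    have pp: "prime p" using primes 3 by auto
    \<comment> \<open>The normalizer of V contains all p'-elements of T, so if it is proper, some x
      outside normalizes it. The conjugate of V by x is then also normal in it, hence equal to V by
      uniqueness, a contradiction.\<close>
    have "normalizer_in T V = T"
    proof (rule ccontr)
      assume ne: "normalizer_in T V \<noteq> T"
      have sN: "subgroup (normalizer_in T V) G" "normalizer_in T V \<subseteq> T" using subgroup_normalizer_in[OF T Tc(2)] normalizer_in_sub by auto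
      have nV: "normal_in V (normalizer_in T V)" using normal_in_normalizer_in[OF T sV(1,2)] .
      have VN: "V \<subseteq> normalizer_in T V" using nV by (simp add: normal_in_def)
      have "\<exists>x\<in>T. x \<notin> normalizer_in T V \<and> cnj_set (normalizer_in T V) x = normalizer_in T V"
      proof (rule normalizer_growth[OF T sN pp])
        show "\<not> P \<subseteq> normalizer_in T V" if P: "sylow_in p T P" for P
          using gen_q[OF sN(1) T sN(2) P _ pp] ne e 3 VN by blast
        fix x y assume xy: "x \<in> T" "y \<in> normalizer_in T V" "pi_elem (-{p}) y"
        have "cnj x y \<in> T" using normal_in_cnj[OF normal_in_self[OF T] xy(1)] xy(2) sN by blast
        moreover have "pi_elem (-{p}) (cnj x y)" using pi_elem_cnj[OF xy(3)] xy(1) Tc by blast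
        ultimately show "cnj x y \<in> normalizer_in T V" using e 3 VN by blast
      qed
      then obtain x where x: "x \<in> T" "x \<notin> normalizer_in T V" "cnj_set (normalizer_in T V) x = normalizer_in T V" by blast
      have xc: "x \<in> carrier G" using x Tc by blast
      have "normal_in (cnj_set V x) (normalizer_in T V)" using normal_in_cnj_set_cnj_set[OF nV xc] x(3) by simp
      hence "cnj_set V x \<subseteq> V" using Fmax_normal_unique[OF V sN(2) nV F_cnj_set[OF sV(3) xc]] by blast
      hence "cnj_set V x = V" using card_cnj_set[OF xc Tc(2)] sV by (intro card_subset_eq) auto
      thus False using x by (simp add: normalizer_in_def)
    qed
    thus ?thesis using normal_in_normalizer_in[OF T sV(1,2)] by simp
  qed
qed

text \<open>Assertion (b) for L. K and W are quantified inside, so that the induction hypothesis for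
  a subgroup X can be used with \<open>K \<inter> X\<close>.\<close>

definition conj_prop :: "'a set \<Rightarrow> bool" where
  "conj_prop L \<longleftrightarrow> (\<forall>K W V V\<^sub>1. normal_in K L \<longrightarrow> npi_res \<pi> L \<subseteq> K \<longrightarrow> F_maximal F K W \<longrightarrow> F_maximal F L V \<longrightarrow> F_maximal F L V\<^sub>1 \<longrightarrow>
     W \<subseteq> V \<longrightarrow> W \<subseteq> V\<^sub>1 \<longrightarrow> (\<exists>x\<in>npi_res \<pi> (generate G (V \<union> V\<^sub>1)). cnj_set V\<^sub>1 x = V))"

text \<open>The Frattini argument for V: its conjugate by g is also F-maximal in X and contains the
  normal subgroup W, so the residual of their join brings it back to V.\<close>

lemma conj_prop_use:
  assumes X: "conj_prop X" "subgroup X G" "X \<subseteq> L" and K: "normal_in K L" "npi_res \<pi> L \<subseteq> K" "F_maximal F K W" "normal_in W L"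
    and V: "F_maximal F X V" "W \<subseteq> V" and g: "g \<in> L" "F_maximal F X (cnj_set V g)"
  shows "\<exists>s\<in>npi_res \<pi> L. g \<otimes> s \<in> normalizer_in L V"
proof -
  have sL: "subgroup L G" using K by (simp add: normal_in_def)
  have sV: "subgroup V G" "V \<subseteq> X" using Fmax_F[OF V(1)] by auto
  have gc: "g \<in> carrier G" using g sL sub_carr by blast
  have sU: "cnj_set V g \<subseteq> X" using Fmax_F[OF g(2)] by auto
  have nK: "normal_in (K \<inter> X) X" using normal_in_Int[OF K(1) X(2,3)] .
  have RX: "npi_res \<pi> X \<subseteq> K \<inter> X" using npi_res_mono[OF X(3)] npi_res_sub[OF X(2)] K(2) by blast
  have W: "F_maximal F (K \<inter> X) W" using Fmax_sub[OF K(3)] Fmax_F(2)[OF K(3)] V sV by auto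
  have "W \<subseteq> cnj_set V g" using cnj_set_mono[OF V(2), of g] normal_in_cnj_set[OF K(4) g(1)] by simp
  then obtain s where s: "s \<in> npi_res \<pi> (generate G (V \<union> cnj_set V g))" "cnj_set (cnj_set V g) s = V"
    using X(1) nK RX W V g(2) unfolding conj_prop_def by blast
  have "generate G (V \<union> cnj_set V g) \<subseteq> L" using sV sU X by (intro generate_subgroup_incl sL) auto
  hence sR: "s \<in> npi_res \<pi> L" using s npi_res_mono by blast
  hence sc: "s \<in> L" "s \<in> carrier G" using npi_res_sub[OF sL] sL sub_carr by blast+
  have "cnj_set V (g \<otimes> s) = V" using s(2) gc sc sV by (simp add: cnj_set_cnj_set subgroup.subset)
  thus ?thesis using sR g sc sL by (intro bexI[of _ s]) (auto simp: normalizer_in_def subgroup.m_closed)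
qed

text \<open>Modulo the hull J the group L is a nilpotent \<pi>'-group, whose maximal subgroups are
  normal. Concretely, a prime q whose Sylow subgroups avoid M lies outside \<pi>; then q- and
  q'-elements commute modulo the residual and \<open>normalizer_growth\<close> applies.\<close>

lemma maximal_over_pi_normal:
  assumes L: "subgroup L G" and M: "subgroup M G" "M \<subseteq> L" "M \<noteq> L" and J: "pi_hull \<pi> (npi_res \<pi> L) L \<subseteq> M"
    and max: "\<And>X. subgroup X G \<Longrightarrow> M \<subseteq> X \<Longrightarrow> X \<subseteq> L \<Longrightarrow> X = M \<or> X = L"
  shows "normal_in M L"
proof -
  have nS: "normal_in (npi_res \<pi> L) L" using normal_in_npi_res[OF L] .
  note OJ = pi_hull_normal_in[OF nS, where \<sigma> = \<pi>]
  have "\<exists>q. prime q \<and> (\<forall>P. sylow_in q L P \<longrightarrow> \<not> P \<subseteq> M)"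
  proof (rule ccontr)
    assume a: "\<not> ?thesis"
    have "pi_num (-{r}) (index L M)" if r: "prime r" for r
    proof -
      obtain P where P: "sylow_in r L P" "P \<subseteq> M" using a r by blast
      hence "index L M dvd index L P" using M L by (intro index_dvd2) (auto simp: sylow_in_def)
      thus ?thesis using P pi_num_dvd unfolding sylow_in_def by blast
    qed
    thus False using index_no_prime[OF M(1) L M(2)] M(3) by blast
  qed
  then obtain q where q: "prime q" "\<And>P. sylow_in q L P \<Longrightarrow> \<not> P \<subseteq> M" by blast
  have "q \<notin> \<pi>"
  proof
    assume "q \<in> \<pi>"
    obtain P where P: "sylow_in q L P" using sylow_in_ex[OF q(1) L] by blast
    have "P \<subseteq> M"
    proof
      fix x assume x: "x \<in> P"
      have "pi_elem {q} x" using pi_elem_card[of P "{q}" x] P x by (simp add: sylow_in_def)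
      hence "pi_elem \<pi> x" using \<open>q \<in> \<pi>\<close> pi_elem_mono by blast
      thus "x \<in> M" using OJ(3)[of x] x P J by (auto simp: sylow_in_def)
    qed
    thus False using q P by blast
  qed
  have "\<exists>x\<in>L. x \<notin> M \<and> cnj_set M x = M"
  proof (rule normalizer_growth[OF L M(1,2) q])
    fix x y assume xy: "x \<in> L" "y \<in> M" "pi_elem {q} x" "pi_elem (-{q}) y"
    have c: "x \<in> carrier G" "y \<in> carrier G" "y \<in> L" using xy M L sub_carr by blast+
    have "commut x y \<in> npi_res \<pi> L" using npi_res_commut[OF xy(1) c(3) q(1) \<open>q \<notin> \<pi>\<close> xy(3,4)] .
    hence "commut y x \<in> npi_res \<pi> L" using commut_sym_in[OF subgroup_npi_res[OF L] c(1,2)] by blast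
    hence "commut y x \<in> M" using OJ(2) J by blast
    thus "cnj x y \<in> M" using cnj_commut[OF c(2,1)] xy M by (simp add: subgroup.m_closed)
  qed
  then obtain x where x: "x \<in> L" "x \<notin> M" "cnj_set M x = M" by blast
  have n: "normal_in M (normalizer_in L M)" using normal_in_normalizer_in[OF L M(1,2)] .
  have "normalizer_in L M \<noteq> M" using x by (auto simp: normalizer_in_def)
  hence "normalizer_in L M = L" using max[of "normalizer_in L M"] n normalizer_in_sub by (auto simp: normal_in_def)
  thus ?thesis using n by simp
qed

text \<open>If \<open>V\<close> together with the \<open>\<pi>\<close>-part of \<open>L\<close> modulo its residual \<open>S\<close> does not generate \<open>L\<close>, the conjugates
  of \<open>V\<close> lie in a proper normal subgroup and induction applies. Otherwise induction applies to
  the \<open>\<pi>'\<close>-part \<open>H\<close> of \<open>V\<close> modulo \<open>W\<close>, and a Hall subgroup of its normalizer above the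
  \<open>\<pi>\<close>-part of \<open>V\<close> normalizes \<open>V\<close>.\<close>

lemma normalizer_supplement:
  assumes IH: "\<And>X. subgroup X G \<Longrightarrow> X \<subseteq> L \<Longrightarrow> X \<noteq> L \<Longrightarrow> conj_prop X"
    and K: "normal_in K L" "npi_res \<pi> L \<subseteq> K" "F_maximal F K W" "normal_in W L"
    and V: "F_maximal F L V" "W \<subseteq> V" and g: "g \<in> L"
  shows "\<exists>s\<in>npi_res \<pi> L. g \<otimes> s \<in> normalizer_in L V"
proof -
  define S where "S = npi_res \<pi> L"
  have sL: "subgroup L G" "subgroup W G" "W \<subseteq> L" "subgroup K G" using K by (auto simp: normal_in_def)
  have Lc: "L \<subseteq> carrier G" using sL by (simp add: subgroup.subset)
  have nS: "normal_in S L" using normal_in_npi_res[OF sL(1)] by (simp add: S_def)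
  have sS: "subgroup S G" "S \<subseteq> L" using nS by (auto simp: normal_in_def)
  have sV: "subgroup V G" "V \<subseteq> L" "V \<in> F" using Fmax_F[OF V(1)] by auto
  have gV: "F_maximal F L (cnj_set V x)" if "x \<in> L" for x
    using Fmax_cnj_set[OF V(1) _ Lc, of x] that Lc cnj_set_self[OF sL(1) that] by auto
  define J where "J = pi_hull \<pi> S L"
  note OJ = pi_hull_normal_in[OF nS, where \<sigma> = \<pi>, folded J_def]
  have sJ: "subgroup J G" "J \<subseteq> L" using OJ by (auto simp: normal_in_def)
  note jJV = normal_in_join[OF OJ(1) sV(1,2)]
  show ?thesis
  proof (cases "J <#> V = L")
    case False
    \<comment> \<open>A maximal subgroup above \<open>J <#> V\<close> is normal in L, so it also
      contains the conjugate of V by g, and induction applies to it.\<close>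
    define Q where "Q X \<longleftrightarrow> subgroup X G \<and> J <#> V \<subseteq> X \<and> X \<subseteq> L \<and> X \<noteq> L" for X
    have "Q (J <#> V)" using jJV False by (simp add: Q_def)
    then obtain M where M: "Q M" "\<forall>Y. Q Y \<longrightarrow> card Y \<le> card M"
      using ex_max_subgroup[of Q "J <#> V"] unfolding Q_def by blast
    have sM: "subgroup M G" "J <#> V \<subseteq> M" "M \<subseteq> L" "M \<noteq> L" using M by (auto simp: Q_def)
    have "X = M \<or> X = L" if X: "subgroup X G" "M \<subseteq> X" "X \<subseteq> L" for X
    proof (rule disjCI)
      assume "X \<noteq> L"
      hence "Q X" using X sM by (auto simp: Q_def)
      hence "card X \<le> card M" using M by blast
      thus "X = M" using X by (intro card_seteq[symmetric]) auto
    qed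
    moreover have "pi_hull \<pi> (npi_res \<pi> L) L \<subseteq> M" using sM jJV by (auto simp: J_def S_def)
    ultimately have nM: "normal_in M L" using maximal_over_pi_normal[OF sL(1) sM(1,3,4)] by blast
    have VM: "V \<subseteq> M" using sM jJV by blast
    hence gVM: "cnj_set V g \<subseteq> M" using cnj_set_mono[OF VM, of g] normal_in_cnj_set[OF nM g] by simp
    show ?thesis
      using conj_prop_use[OF IH[OF sM(1,3,4)] sM(1,3) K Fmax_sub[OF V(1) VM sM(3)] V(2) g Fmax_sub[OF gV[OF g] gVM sM(3)]] .
  next
    case True
    \<comment> \<open>V meets K in W, so V/W embeds in L/K.\<close>
    have RV: "npi_res \<pi> V \<subseteq> W"
      using npi_res_sub[OF sV(1), of \<pi>] npi_res_mono[OF sV(2), of \<pi>] K(2) Fmax_Int[OF K(3,1) sV(3,2) V(2)] by blast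
    have nWV: "normal_in W V" using normal_in_sub[OF K(4) sV(1) V(2) sV(2)] .
    define H where "H = pi_hull (-\<pi>) W V"
    note OH = pi_hull_normal_in[OF nWV, where \<sigma> = "-\<pi>", folded H_def]
    have sH: "subgroup H G" "H \<subseteq> V" "H \<subseteq> L" "H \<in> F" using OH F_normal_in[OF sV(3) OH(1)] sV by (auto simp: normal_in_def)
    define B where "B = pi_hull (-\<pi>) S L"
    note OB = pi_hull_normal_in[OF nS, where \<sigma> = "-\<pi>", folded B_def]
    have sB: "subgroup B G" "B \<subseteq> L" using OB by (auto simp: normal_in_def)
    have pJ: "pi_num \<pi> (index J S)" and pB: "pi_num (-\<pi>) (index B S)"
      using pi_hull_pi[OF nS] pi_hull_pi'[OF nS] by (simp_all add: J_def B_def S_def)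
    have BJ: "B \<inter> J = S"
    proof -
      have i: "subgroup (B \<inter> J) G" using sB sJ subgroups_Inter_pair by blast
      have "index (B \<inter> J) S dvd index B S" "index (B \<inter> J) S dvd index J S"
        using i sS sB sJ OB OJ by (auto intro!: index_dvd1)
      hence "index (B \<inter> J) S = 1" using pJ pB pi_num_both pi_num_dvd by meson
      thus ?thesis using index_1[OF sS(1) i] OB(2) OJ(2) by blast
    qed
    note jSH = normal_in_join[OF nS sH(1,3)]
    \<comment> \<open>Write y = j v with j in J and take \<pi>'-parts: y is congruent modulo J to
      the \<pi>'-part of v. Their quotient also lies in B, hence in
      \<open>B \<inter> J = S\<close>.\<close>
    have elB: "y \<in> S <#> H" if y: "y \<in> L" "pi_elem (-\<pi>) y" for y
    proof -
      obtain k :: nat where k: "\<forall>x\<in>carrier G. pi_elem (-\<pi>) (x [^] k)" "\<forall>x. pi_elem (-\<pi>) x \<longrightarrow> x [^] k = x" using pi_elem_exp[of "-\<pi>"] by blast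
      obtain j v where jv: "j \<in> J" "v \<in> V" "y = j \<otimes> v" using y(1) unfolding True[symmetric] by (rule set_multE)
      have vL: "v \<in> L" "v \<in> carrier G" "y \<in> carrier G" using jv y sV Lc by auto
      have "J #> y = J #> v" using coset_mult_left[OF sJ(1) jv(1) vL(2)] jv(3) by simp
      hence "J #> y [^] k = J #> v [^] k" by (rule pow_coset[OF OJ(1) y(1) vL(1)])
      hence Jy: "J #> y = J #> v [^] k" using k y by simp
      have h: "v [^] k \<in> V" "pi_elem (-\<pi>) (v [^] k)" using subgroup_pow[OF sV(1) jv(2)] k vL by auto
      have hH: "v [^] k \<in> H" using OH(3) h by blast
      have hc: "v [^] k \<in> L" "v [^] k \<in> carrier G" using hH sH Lc by auto
      have "y \<otimes> inv (v [^] k) \<in> J" using Jy coset_eq_iff[OF sJ(1) vL(3) hc(2)] by simp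
      moreover have "y \<otimes> inv (v [^] k) \<in> B" using OB(3) y h hc sB by (simp add: subgroup.m_closed subgroup.m_inv_closed)
      ultimately have "y \<otimes> inv (v [^] k) \<in> S" using BJ by blast
      moreover have "y = (y \<otimes> inv (v [^] k)) \<otimes> v [^] k" using vL hc by (simp add: m_assoc)
      ultimately show ?thesis using hH set_multI by metis
    qed
    have BSH: "B \<subseteq> S <#> H" unfolding B_def using elB jSH by (intro pi_hull_least) auto
    have nSW: "normal_in (S <#> W) L" using normal_in_normal_in_join[OF nS K(4)] .
    have WH: "W \<subseteq> H" by (rule OH(2))
    \<comment> \<open>As a hull over the normal subgroup \<open>S <#> W\<close>, the product S H is
      normal in L.\<close>
    have "S <#> H = pi_hull (-\<pi>) (S <#> W) L"
    proof
      note O' = pi_hull_normal_in[OF nSW, where \<sigma> = "-\<pi>"]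
      have s': "subgroup (pi_hull (-\<pi>) (S <#> W) L) G" using O' by (simp add: normal_in_def)
      have "S \<subseteq> pi_hull (-\<pi>) (S <#> W) L" "W \<subseteq> pi_hull (-\<pi>) (S <#> W) L"
        using O'(2) normal_in_join[OF nS sL(2,3)] by auto
      moreover have "H \<subseteq> pi_hull (-\<pi>) (S <#> W) L" unfolding H_def
        using O'(3) sV calculation by (intro pi_hull_least s') auto
      ultimately show "S <#> H \<subseteq> pi_hull (-\<pi>) (S <#> W) L" by (intro set_mult_least s')
      have "S <#> W \<subseteq> S <#> H" using WH by (intro mono_set_mult) auto
      thus "pi_hull (-\<pi>) (S <#> W) L \<subseteq> S <#> H" using elB by (intro pi_hull_least jSH)
    qed
    hence nSH: "normal_in (S <#> H) L" using pi_hull_normal_in(1)[OF nSW] by simp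
    \<comment> \<open>The Frattini property with H in place of V: immediate if S H = L, and by
      induction in S H otherwise.\<close>
    have NH: "\<exists>s\<in>S. x \<otimes> s \<in> normalizer_in L H" if x: "x \<in> L" for x
    proof (cases "S <#> H = L")
      case True
      hence "x \<in> H <#> S" using x jSH(2) by simp
      then obtain h s where hs: "h \<in> H" "s \<in> S" "x = h \<otimes> s" by (rule set_multE)
      have c: "h \<in> carrier G" "s \<in> carrier G" using hs sH sS Lc by auto
      have "x \<otimes> inv s = h" using hs c by (simp add: m_assoc)
      moreover have "h \<in> normalizer_in L H" using cnj_set_self[OF sH(1) hs(1)] hs sH by (auto simp: normalizer_in_def)
      ultimately show ?thesis using hs sS by (intro bexI[of _ "inv s"]) (auto simp: subgroup.m_inv_closed)
    next
      case ne: False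
      \<comment> \<open>For U in F between H and S H, both H/W and U/W embed in K H / K, the former
        onto it; hence U is no larger than H.\<close>
      have mH: "F_maximal F (S <#> H) H"
        unfolding F_maximal_def
      proof (intro conjI ballI impI)
        show "H \<in> F" "H \<subseteq> S <#> H" using sH jSH by auto
        fix U assume U: "U \<in> F" "U \<subseteq> S <#> H" "H \<subseteq> U"
        have sU: "subgroup U G" "U \<subseteq> L" "W \<subseteq> U" using F_sub[OF U(1)] U jSH(5) WH by auto
        note a = normal_in_join[OF K(1) sU(1,2)]
        note b = normal_in_join[OF K(1) sH(1,3)]
        have "S <#> H \<subseteq> K <#> H" using K(2) by (intro mono_set_mult) (auto simp: S_def)
        hence "K <#> U \<subseteq> K <#> H" using U(2) b by (intro set_mult_least) auto
        hence "index (K <#> U) K dvd index (K <#> H) K" using a b sL by (intro index_dvd1) auto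
        moreover have "index (K <#> U) K = index U W"
          using index_set_mult[OF sL(4) sU(1) a(1)] Fmax_Int[OF K(3,1) U(1) sU(2,3)] by simp
        moreover have "index (K <#> H) K = index H W"
          using index_set_mult[OF sL(4) sH(1) b(1)] Fmax_Int[OF K(3,1) sH(4,3) WH] by simp
        ultimately have "index U W dvd index H W" by simp
        hence "index U W \<le> index H W" using index_pos[OF sL(2) sH(1) WH] by (rule dvd_imp_le)
        hence "card U \<le> card H" using index_mult[OF sL(2) sU(1,3)] index_mult[OF sL(2) sH(1) WH] by simp
        thus "U = H" using U(3) sU by (intro card_seteq[symmetric]) auto
      qed
      have xc: "x \<in> carrier G" using x Lc by blast
      have "F_maximal F (S <#> H) (cnj_set H x)"
        using Fmax_cnj_set[OF mH xc] jSH(1) normal_in_cnj_set[OF nSH x] by (simp add: subgroup.subset)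
      thus ?thesis using conj_prop_use[OF IH[OF jSH(1,5) ne] jSH(1,5) K mH WH x] by (simp add: S_def)
    qed
    define N where "N = normalizer_in L H"
    have sN: "subgroup N G" "N \<subseteq> L" "normal_in H N"
      using subgroup_normalizer_in[OF sL(1)] normalizer_in_sub normal_in_normalizer_in[OF sL(1) sH(1,3)] sH by (auto simp: N_def subgroup.subset)
    have VN: "V \<subseteq> N" using normal_in_cnj_set[OF OH(1)] sV by (auto simp: N_def normalizer_in_def)
    define U where "U = pi_hull \<pi> W V"
    note OU = pi_hull_normal_in[OF nWV, where \<sigma> = \<pi>, folded U_def]
    have sU: "subgroup U G" "U \<subseteq> V" using OU by (auto simp: normal_in_def)
    have nWN: "normal_in W N" using normal_in_sub[OF K(4) sN(1) _ sN(2)] V(2) VN by blast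
    \<comment> \<open>R/W is a Hall \<pi>-subgroup of N/W above the \<pi>-part U/W of V, so that
      \<open>H <#> R\<close> contains V.\<close>
    obtain R where R: "subgroup R G" "U \<subseteq> R" "R \<subseteq> N" "pi_num \<pi> (index R W)" "pi_num (-\<pi>) (index N R)"
      using hall_dominance[OF ps nWN sU(1) OU(2)] sU VN pi_hull_pi[OF nWV RV] by (auto simp: U_def)
    define T where "T = H <#> R"
    note jT = normal_in_join[OF sN(3) R(1,3), folded T_def]
    have VT: "V \<subseteq> T"
    proof
      fix v assume v: "v \<in> V"
      obtain a b where ab: "pi_elem \<pi> a" "pi_elem (-\<pi>) b" "a \<in> V" "b \<in> V" "v = a \<otimes> b" using pi_elem_split[OF sV(1) v] by blast
      have "a \<in> R" "b \<in> H" using OU(3)[OF ab(3,1)] R OH(3)[OF ab(4,2)] by auto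
      thus "v \<in> T" using ab(5) jT(3,4) subgroup.m_closed[OF jT(1)] by blast
    qed
    have TL: "T \<subseteq> L" using jT sN by blast
    have WR: "W \<subseteq> R" using OU(2) R by blast
    \<comment> \<open>T/H is a \<pi>-group, so the \<pi>'-elements of T lie in H; this is the
      hypothesis of \<open>Fmax_normal_pi\<close>.\<close>
    have "x \<in> V" if x: "x \<in> T" "pi_elem (-\<pi>) x" for x
    proof -
      have "index T H = index R (H \<inter> R)" unfolding T_def using index_set_mult[OF sH(1) R(1)] jT by (simp add: T_def)
      moreover have "index R (H \<inter> R) dvd index R W"
        using sH R sL WH WR by (intro index_dvd2 subgroups_Inter_pair) auto
      ultimately have "pi_num (-(-\<pi>)) (index T H)" using R(4) pi_num_dvd by simp
      thus ?thesis using pi_elem_in[OF jT(6) _ x] sH by blast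
    qed
    hence nVT: "normal_in V T" using Fmax_normal_pi[OF jT(1) Fmax_sub[OF V(1) VT TL]] by blast
    hence TN: "T \<subseteq> normalizer_in L V" using TL by (auto simp: normalizer_in_def normal_in_def)
    note jST = normal_in_join[OF nS jT(1) TL]
    \<comment> \<open>The index of S T is a \<pi>-number because S H contains all \<pi>'-elements of
      L, and a \<pi>'-number because N supplements S and R has \<pi>'-index in N.\<close>
    have "S <#> T = L"
    proof (rule index_1[OF jST(1) sL(1) jST(5)])
      have "B \<subseteq> S <#> T" using BSH mono_set_mult[of S S H T G] jT(3) by auto
      hence "index L (S <#> T) dvd index L B" using jST sB sL by (intro index_dvd2) auto
      moreover have "pi_num (-(-\<pi>)) (index L B)" using pi_hull_index[OF nS, of "-\<pi>"] by (simp add: B_def)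
      ultimately have 1: "pi_num \<pi> (index L (S <#> T))" using pi_num_dvd by simp
      have RL: "R \<subseteq> L" using R sN by blast
      note jSR = normal_in_join[OF nS R(1) RL]
      define C where "C = S <#> R"
      note jC = jSR[folded C_def]
      have "L \<subseteq> C <#> N"
      proof
        fix x assume x: "x \<in> L"
        obtain s where s: "s \<in> S" "x \<otimes> s \<in> N" using NH[OF x] by (auto simp: N_def)
        have c: "x \<in> carrier G" "s \<in> carrier G" using x s sS Lc by auto
        have "x = (x \<otimes> s) \<otimes> inv s" using c by (simp add: m_assoc)
        hence "x \<in> N <#> S" using set_multI[OF s(2), of "inv s" S] s sS by (simp add: subgroup.m_inv_closed)
        hence "x \<in> S <#> N" using normal_in_join(2)[OF nS sN(1,2)] by simp
        thus "x \<in> C <#> N" using mono_set_mult[OF jC(3) subset_refl, of G N] by blast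
      qed
      moreover have "C <#> N \<subseteq> L" using jC sN sL by (intro set_mult_least) auto
      ultimately have CN: "C <#> N = L" by blast
      have "index L C = index N (C \<inter> N)" using index_set_mult[OF jC(1) sN(1)] CN sL by simp
      also have "\<dots> dvd index N R" using jC sN R by (intro index_dvd2 subgroups_Inter_pair) auto
      finally have "pi_num (-\<pi>) (index L C)" using R(5) pi_num_dvd by blast
      moreover have "C \<subseteq> S <#> T" unfolding C_def using jT(4) by (intro mono_set_mult) auto
      hence "index L (S <#> T) dvd index L C" using jST jC sL by (intro index_dvd2) auto
      ultimately have "pi_num (-\<pi>) (index L (S <#> T))" using pi_num_dvd by blast
      thus "index L (S <#> T) = 1" using 1 pi_num_both by blast
    qed
    hence "g \<in> T <#> S" using g jST(2) by simp
    then obtain t s where ts: "t \<in> T" "s \<in> S" "g = t \<otimes> s" by (rule set_multE)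
    have c: "t \<in> carrier G" "s \<in> carrier G" using ts TL sS Lc by auto
    have "g \<otimes> inv s = t" using ts c by (simp add: m_assoc)
    thus ?thesis using ts TN sS by (intro bexI[of _ "inv s"]) (auto simp: subgroup.m_inv_closed S_def)
  qed
qed

text \<open>To lift P from the normalizer of V to L, \<open>covering_lift\<close> asks about every X
  above \<open>W <#> P\<close>. There \<open>normalizer_supplement\<close>, applied in X, writes X
  as the normalizer of V in X times the residual of X, and P is covering in that normalizer.\<close>

lemma ex_covering:
  assumes IH: "\<And>X. subgroup X G \<Longrightarrow> X \<subseteq> L \<Longrightarrow> X \<noteq> L \<Longrightarrow> conj_prop X"
    and K: "normal_in K L" "npi_res \<pi> L \<subseteq> K" "F_maximal F K W" "normal_in W L"
    and V: "F_maximal F L V" "W \<subseteq> V"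
  shows "\<exists>P. covering \<pi> P L \<and> normal_in V (W <#> P)"
proof -
  have sL: "subgroup L G" "subgroup W G" "W \<subseteq> L" "subgroup K G" using K by (auto simp: normal_in_def)
  have sV: "subgroup V G" "V \<subseteq> L" "V \<in> F" using Fmax_F[OF V(1)] by auto
  define N where "N = normalizer_in L V"
  have sN: "subgroup N G" "N \<subseteq> L" "normal_in V N"
    using subgroup_normalizer_in[OF sL(1)] normalizer_in_sub normal_in_normalizer_in[OF sL(1) sV(1,2)] sV by (auto simp: N_def subgroup.subset)
  have VN: "V \<subseteq> N" using sN by (simp add: normal_in_def)
  obtain P where P: "covering \<pi> P N" using covering_ex[OF ps sN(1)] by blast
  note p = covD[OF P]
  have PL: "P \<subseteq> L" using p sN by blast
  define C where "C = W <#> P"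
  note jC = normal_in_join[OF K(4) p(1) PL, folded C_def]
  have CN: "C \<subseteq> N" unfolding C_def using V(2) VN p by (intro set_mult_least sN) auto
  note jE = normal_in_join[OF sN(3) p(1,3)]
  \<comment> \<open>P has trivial residual, so the residual of V P lies in V; it also lies in K, and
    V meets K in W.\<close>
  have RE: "npi_res \<pi> (V <#> P) \<subseteq> W"
  proof -
    have "npi_res \<pi> (V <#> P) \<subseteq> V <#> npi_res \<pi> P" using npi_res_join[OF sN(3) p(1,3)] .
    also have "\<dots> = V" using p(4) sV by (simp add: set_mult_one subgroup.subset)
    finally have "npi_res \<pi> (V <#> P) \<subseteq> V" .
    moreover have "npi_res \<pi> (V <#> P) \<subseteq> K" using npi_res_mono[of "V <#> P" L \<pi>] jE sN K(2) by blast
    ultimately show ?thesis using Fmax_Int[OF K(3,1) sV(3,2) V(2)] by blast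
  qed
  have "V <#> P \<subseteq> P <#> npi_res \<pi> (V <#> P)" using p(5)[OF jE(1,4,5)] .
  also have "\<dots> \<subseteq> P <#> W" using RE by (intro mono_set_mult) auto
  also have "P <#> W = C" using jC(2) by simp
  finally have VC: "V \<subseteq> C" using jE(3) by blast
  have nVC: "normal_in V C" using normal_in_sub[OF sN(3) jC(1) VC CN] .
  have "covering \<pi> P L"
  proof (rule covering_lift[OF K(4) sN(1) _ sN(2) P])
    show "W \<subseteq> N" using V(2) VN by blast
    fix X assume X: "subgroup X G" "W <#> P \<subseteq> X" "X \<subseteq> L"
    have CX: "C \<subseteq> X" "V \<subseteq> X" "P \<subseteq> X" using X VC jC by (auto simp: C_def)
    have nK: "normal_in (K \<inter> X) X" using normal_in_Int[OF K(1) X(1,3)] .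
    have RX: "npi_res \<pi> X \<subseteq> K \<inter> X" using npi_res_mono[OF X(3)] npi_res_sub[OF X(1)] K(2) by blast
    have WX: "W \<subseteq> X" using V(2) CX by blast
    have W: "F_maximal F (K \<inter> X) W" using Fmax_sub[OF K(3)] Fmax_F(2)[OF K(3)] WX by auto
    have nW: "normal_in W X" using normal_in_sub[OF K(4) X(1) WX X(3)] .
    have VX: "F_maximal F X V" using Fmax_sub[OF V(1) CX(2) X(3)] .
    have IHX: "conj_prop Y" if "subgroup Y G" "Y \<subseteq> X" "Y \<noteq> X" for Y using IH[of Y] that X by blast
    show "X \<subseteq> (W <#> P) <#> npi_res \<pi> X"
    proof
      fix g assume g: "g \<in> X"
      obtain s where s: "s \<in> npi_res \<pi> X" "g \<otimes> s \<in> normalizer_in X V"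
        using normalizer_supplement[OF IHX nK RX W nW VX V(2) g] by blast
      have sZ: "subgroup (normalizer_in X V) G" "normalizer_in X V \<subseteq> N" "P \<subseteq> normalizer_in X V"
        using subgroup_normalizer_in[OF X(1)] sV X p CX by (auto simp: N_def normalizer_in_def subgroup.subset)
      have "normalizer_in X V \<subseteq> P <#> npi_res \<pi> (normalizer_in X V)" using p(5)[OF sZ(1,3,2)] .
      also have "\<dots> \<subseteq> P <#> npi_res \<pi> X" using npi_res_mono[OF normalizer_in_sub] by (intro mono_set_mult) auto
      finally have "g \<otimes> s \<in> P <#> npi_res \<pi> X" using s(2) by (rule subsetD)
      then obtain a b where ab: "a \<in> P" "b \<in> npi_res \<pi> X" "g \<otimes> s = a \<otimes> b" by (rule set_multE)
      have sR: "subgroup (npi_res \<pi> X) G" using subgroup_npi_res[OF X(1)] .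
      have c: "a \<in> carrier G" "b \<in> carrier G" "s \<in> carrier G" "g \<in> carrier G"
        using sub_carr[OF p(1) ab(1)] sub_carr[OF sR ab(2)] sub_carr[OF sR s(1)] sub_carr[OF X(1) g] by auto
      have "g = (g \<otimes> s) \<otimes> inv s" using c by (simp add: m_assoc)
      also have "\<dots> = a \<otimes> (b \<otimes> inv s)" using c ab by (simp add: m_assoc)
      finally have "g = a \<otimes> (b \<otimes> inv s)" .
      moreover have "b \<otimes> inv s \<in> npi_res \<pi> X" using ab s sR by (simp add: subgroup.m_closed subgroup.m_inv_closed)
      moreover have "a \<in> W <#> P" using ab jC by (auto simp: C_def)
      ultimately show "g \<in> (W <#> P) <#> npi_res \<pi> X" using set_multI by blast
    qed
  qed
  thus ?thesis using nVC by (auto simp: C_def)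
qed

theorem conj_prop_all: "subgroup L G \<Longrightarrow> conj_prop L"
proof (induction "card L" arbitrary: L rule: less_induct)
  case less
  have IH: "conj_prop X" if "subgroup X G" "X \<subseteq> L" "X \<noteq> L" for X
  proof (rule less.hyps[OF _ that(1)])
    show "card X < card L" using that less.prems by (intro psubset_card_mono) auto
  qed
  show ?case unfolding conj_prop_def
  proof (intro allI impI)
    fix K W V V' assume K: "normal_in K L" "npi_res \<pi> L \<subseteq> K" "F_maximal F K W"
      and V: "F_maximal F L V" "F_maximal F L V'" "W \<subseteq> V" "W \<subseteq> V'"
    have sL: "subgroup L G" "L \<subseteq> carrier G" using less.prems by (auto simp: subgroup.subset)
    have sV: "subgroup V G" "V \<subseteq> L" "V \<in> F" "subgroup V' G" "V' \<subseteq> L" "V' \<in> F" using Fmax_F V by blast+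
    define X where "X = generate G (V \<union> V')"
    have sX: "subgroup X G" "X \<subseteq> L" "V \<subseteq> X" "V' \<subseteq> X"
      using generate_is_subgroup[of "V \<union> V'"] generate_subgroup_incl[of "V \<union> V'" L] sV sL
      by (auto simp: X_def intro: generate.incl)
    show "\<exists>x\<in>npi_res \<pi> (generate G (V \<union> V')). cnj_set V' x = V"
    proof (cases "X = L")
      case False
      have "normal_in (K \<inter> X) X" using normal_in_Int[OF K(1) sX(1,2)] .
      moreover have "npi_res \<pi> X \<subseteq> K \<inter> X" using npi_res_mono[OF sX(2)] npi_res_sub[OF sX(1)] K(2) by blast
      moreover have "F_maximal F (K \<inter> X) W" using Fmax_sub[OF K(3)] Fmax_F(2)[OF K(3)] V sX by auto
      moreover have "F_maximal F X V" "F_maximal F X V'" using Fmax_sub V sX by auto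
      ultimately show ?thesis using IH[OF sX(1,2) False] V(3,4) unfolding conj_prop_def by blast
    next
      case True
      have sW: "subgroup W G" "W \<subseteq> L" using Fmax_F[OF K(3)] K(1) by (auto simp: normal_in_def)
      have W: "K \<inter> V = W" "K \<inter> V' = W" using Fmax_Int[OF K(3,1)] sV V by auto
      have "normal_in W V" "normal_in W V'" using normal_in_Int[OF K(1) sV(1,2)] normal_in_Int[OF K(1) sV(4,5)] W by auto
      hence "V \<union> V' \<subseteq> normalizer_in L W" using sV by (auto simp: normal_in_def normalizer_in_def)
      hence "X \<subseteq> normalizer_in L W" unfolding X_def using subgroup_normalizer_in[OF sL(1)] sW
        by (intro generate_subgroup_incl) (auto simp: subgroup.subset)
      hence "normalizer_in L W = L" using True normalizer_in_sub by blast
      hence nW: "normal_in W L" using normal_in_normalizer_in[OF sL(1) sW] by simp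
      obtain P where P: "covering \<pi> P L" "normal_in V (W <#> P)" using ex_covering[OF IH K nW V(1,3)] by blast
      obtain P' where P': "covering \<pi> P' L" "normal_in V' (W <#> P')" using ex_covering[OF IH K nW V(2,4)] by blast
      obtain x where x: "x \<in> npi_res \<pi> L" "cnj_set P' x = P" using covering_conj[OF ps P(1) P'(1)] by blast
      have xL: "x \<in> L" "x \<in> carrier G" using x npi_res_sub[OF sL(1)] sL by auto
      have c: "W \<subseteq> carrier G" "P' \<subseteq> carrier G" using sW covD(1)[OF P'(1)] by (auto simp: subgroup.subset)
      have "cnj_set (W <#> P') x = W <#> P" using cnj_set_set_mult[OF xL(2) c] x normal_in_cnj_set[OF nW xL(1)] by simp
      hence n: "normal_in (cnj_set V' x) (W <#> P)" using normal_in_cnj_set_cnj_set[OF P'(2) xL(2)] by simp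
      have "W <#> P \<subseteq> L" using sW covD[OF P(1)] sL by (intro set_mult_least) auto
      \<comment> \<open>V is the largest normal F-subgroup of W P, and the conjugate of V' is
        another one; its own maximality then gives equality.\<close>
      hence "cnj_set V' x \<subseteq> V" using Fmax_normal_unique[OF V(1) _ P(2) F_cnj_set[OF sV(6) xL(2)] n] by blast
      moreover have "F_maximal F L (cnj_set V' x)" using Fmax_cnj_set[OF V(2) xL(2) sL(2)] cnj_set_self[OF sL(1) xL(1)] by simp
      ultimately have "V = cnj_set V' x" using FmaxD sV by blast
      thus ?thesis using x True X_def by blast
    qed
  qed
qed

end

subsection \<open>Residuals and projectors\<close>

context group
begin

lemma comm_of_commut: "x \<in> carrier G \<Longrightarrow> y \<in> carrier G \<Longrightarrow> commut x y = \<one> \<Longrightarrow> x \<otimes> y = y \<otimes> x"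
  using cnj_commut[of x y] by (simp add: cnj_def) (metis inv_solve_left inv_closed m_assoc m_closed)

lemma commut_one_iff: "x \<in> carrier G \<Longrightarrow> y \<in> carrier G \<Longrightarrow> commut x y = \<one> \<longleftrightarrow> x \<otimes> y = y \<otimes> x"
proof
  assume c: "x \<in> carrier G" "y \<in> carrier G" "x \<otimes> y = y \<otimes> x"
  hence "commut x y = inv x \<otimes> inv y \<otimes> (y \<otimes> x)" by (simp add: commut_def m_assoc)
  also have "\<dots> = \<one>" using c(1,2) by (simp add: m_assoc)
  finally show "commut x y = \<one>" .
qed (rule comm_of_commut)

text \<open>Let c be the commutator. The exponent a kills x and its conjugate x c; as c is central,
  c^a = 1. Likewise c^b = 1.\<close>

lemma central_commut_one:
  fixes a b :: nat
  assumes xy: "x \<in> carrier G" "y \<in> carrier G" and ab: "x [^] a = \<one>" "y [^] b = \<one>" "coprime a b"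
    and c: "\<And>g. g \<in> carrier G \<Longrightarrow> commut x y \<otimes> g = g \<otimes> commut x y"
  shows "commut x y = \<one>"
proof -
  let ?c = "commut x y"
  have cc: "?c \<in> carrier G" using xy by simp
  have "cnj y x [^] a = \<one>" using cnj_pow[OF xy(2,1), of a] ab xy by simp
  moreover have "(x \<otimes> ?c) [^] a = x [^] a \<otimes> ?c [^] a" using c xy cc by (intro pow_mult_distrib) auto
  ultimately have 1: "?c [^] a = \<one>" using cnj_commut[OF xy] ab cc by simp
  have ci: "inv ?c \<otimes> y = y \<otimes> inv ?c" using c[OF xy(2)] xy cc by (metis inv_solve_left inv_solve_right m_assoc m_closed inv_closed)
  have "cnj x y [^] b = \<one>" using cnj_pow[OF xy, of b] ab xy by simp
  moreover have "(y \<otimes> inv ?c) [^] b = y [^] b \<otimes> inv ?c [^] b" using ci xy cc by (intro pow_mult_distrib) auto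
  moreover have "cnj x y = y \<otimes> inv ?c" using cnj_commut[OF xy(2,1)] inv_commut[OF xy] by simp
  ultimately have "inv ?c [^] b = \<one>" using ab cc by simp
  hence "?c [^] b = \<one>" using cc by (simp add: nat_pow_inv)
  with 1 show ?thesis using pow_coprime_in[OF triv_subgroup cc, of a b] ab(3) by simp
qed

end

lemma pi_elem_hom:
  assumes "group X" "group Y" "f \<in> hom X Y" "group.pi_elem X \<sigma> x"
  shows "group.pi_elem Y \<sigma> (f x)"
proof -
  interpret h: group_hom X Y f using assms(1-3) by (simp add: group_hom_def group_hom_axioms_def)
  obtain n where "pi_num \<sigma> n" "x [^]\<^bsub>X\<^esub> n = \<one>\<^bsub>X\<^esub>" "x \<in> carrier X" using assms(4) by (auto simp: h.G.pi_elem_def)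
  thus ?thesis using h.hom_nat_pow[of x n] by (auto simp: h.H.pi_elem_def)
qed

context fin_group
begin

lemma quotient_hom: "normal_in M L \<Longrightarrow> (\<lambda>x. M #> x) \<in> hom (G\<lparr>carrier := L\<rparr>) (G\<lparr>carrier := L\<rparr> Mod M)"
  using quotient_context(2,4)[of M L] by (auto simp: hom_def simp del: mult_FactGroup)

lemma pi_elem_sub_iff: "subgroup L G \<Longrightarrow> x \<in> L \<Longrightarrow> group.pi_elem (G\<lparr>carrier := L\<rparr>) \<sigma> x \<longleftrightarrow> pi_elem \<sigma> x"
  using group.pi_elem_def[of "G\<lparr>carrier := L\<rparr>"] subgroup_imp_group[of L] sub_carr[of L x]
  by (simp add: pi_elem_def flip: nat_pow_consistent)

text \<open>Split a representative x = a b into its \<sigma>- and \<sigma>'-part. A \<sigma>-power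
  and a \<sigma>'-power of b lie in M, so b lies in M and a represents the same coset.\<close>

lemma pi_elem_quotient_lift:
  assumes M: "normal_in M L" and c: "group.pi_elem (G\<lparr>carrier := L\<rparr> Mod M) \<sigma> c"
  shows "\<exists>x\<in>L. pi_elem \<sigma> x \<and> c = M #> x"
proof -
  note q = quotient_context[OF M]
  let ?Q = "G\<lparr>carrier := L\<rparr> Mod M"
  interpret Q: fin_group ?Q by (rule q(1))
  have sL: "subgroup L G" "subgroup M G" "M \<subseteq> L" using M by (auto simp: normal_in_def)
  obtain n where n: "pi_num \<sigma> n" "c [^]\<^bsub>?Q\<^esub> n = \<one>\<^bsub>?Q\<^esub>" "c \<in> carrier ?Q" using c by (auto simp: Q.pi_elem_def)
  obtain x where x: "x \<in> L" "c = M #> x" using q(3) n by blast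
  have pw: "(M #> x) [^]\<^bsub>?Q\<^esub> k = M #> x [^] k" for k :: nat
  proof (induction k)
    case 0 thus ?case using sL q(6)[OF subgroup.one_closed[OF sL(1)]] by (simp add: subgroup.one_closed del: one_FactGroup)
  next
    case (Suc k) thus ?case using q(4)[OF subgroup_pow[OF sL(1) x(1)] x(1), of k] by (simp del: mult_FactGroup)
  qed
  have xn: "x [^] n \<in> M" using n(2) x(2) pw[of n] q(6)[OF subgroup_pow[OF sL(1) x(1)], of n] by simp
  obtain a b l where ab: "pi_elem \<sigma> a" "pi_elem (-\<sigma>) b" "a \<in> L" "b \<in> L" "x = a \<otimes> b" "b = x [^] (l::nat)"
    using pi_elem_split[OF sL(1) x(1)] by blast
  obtain m where m: "pi_num (-\<sigma>) m" "b [^] m = \<one>" "b \<in> carrier G" using ab(2) by (auto simp: pi_elem_def)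
  have xc: "x \<in> carrier G" "a \<in> carrier G" using x ab sL sub_carr by blast+
  have "b [^] n = (x [^] n) [^] l" using ab(6) xc by (simp add: nat_pow_pow mult.commute)
  hence "b [^] n \<in> M" using subgroup_pow[OF sL(2) xn] by simp
  hence bM: "b \<in> M" using pow_coprime_in[OF sL(2) m(3), of n m] m(2) subgroup.one_closed[OF sL(2)] pi_num_coprime[OF n(1) m(1)]
    by (simp only:)
  have ia: "inv a \<in> L" using ab(3) sL(1) by (simp add: subgroup.m_inv_closed)
  have "M #> (cnj (inv a) b \<otimes> a) = M #> a" by (rule coset_mult_left[OF sL(2) normal_in_cnj[OF M ia bM] xc(2)])
  moreover have "cnj (inv a) b \<otimes> a = a \<otimes> b" using xc(2) m(3) by (simp add: cnj_def m_assoc)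
  ultimately have "c = M #> a" using x(2) ab(5) by simp
  thus ?thesis using ab(1,3) by blast
qed

text \<open>Elements of prescribed type map to such elements of L/M and lift back to L, so the
  defining commutators of L/M are the images of those of L.\<close>

lemma npi_res_quotient:
  assumes M: "normal_in M L"
  shows "fin_group.npi_res (G\<lparr>carrier := L\<rparr> Mod M) \<pi> (carrier (G\<lparr>carrier := L\<rparr> Mod M)) \<subseteq> {\<one>\<^bsub>G\<lparr>carrier := L\<rparr> Mod M\<^esub>}
    \<longleftrightarrow> npi_res \<pi> L \<subseteq> M"
proof -
  note q = quotient_context[OF M]
  let ?Q = "G\<lparr>carrier := L\<rparr> Mod M"
  interpret Q: fin_group ?Q by (rule q(1))
  have sL: "subgroup L G" "subgroup M G" "M \<subseteq> L" using M by (auto simp: normal_in_def)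
  have gL: "group (G\<lparr>carrier := L\<rparr>)" using sL(1) by (rule subgroup_imp_group)
  have cmQ: "Q.commut (M #> x) (M #> y) = \<one>\<^bsub>?Q\<^esub> \<longleftrightarrow> commut x y \<in> M" if "x \<in> L" "y \<in> L" for x y
    using quotient_commut[OF M that] q(6)[OF commut_in[OF sL(1) that]] by simp
  show ?thesis
  proof
    assume a: "Q.npi_res \<pi> (carrier ?Q) \<subseteq> {\<one>\<^bsub>?Q\<^esub>}"
    show "npi_res \<pi> L \<subseteq> M"
    proof (rule npi_res_least[OF sL(2)])
      fix x y p assume xy: "x \<in> L" "y \<in> L" "prime p" "p \<notin> \<pi>" "pi_elem {p} x" "pi_elem (-{p}) y"
      have "Q.pi_elem {p} (M #> x)" "Q.pi_elem (-{p}) (M #> y)"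
        using pi_elem_hom[OF gL Q.is_group quotient_hom[OF M]] pi_elem_sub_iff[OF sL(1)] xy by auto
      hence "Q.commut (M #> x) (M #> y) \<in> Q.npi_res \<pi> (carrier ?Q)" using Q.npi_res_commut xy q(2) by blast
      hence "Q.commut (M #> x) (M #> y) = \<one>\<^bsub>?Q\<^esub>" using a by blast
      thus "commut x y \<in> M" using cmQ xy by blast
    qed
  next
    assume a: "npi_res \<pi> L \<subseteq> M"
    show "Q.npi_res \<pi> (carrier ?Q) \<subseteq> {\<one>\<^bsub>?Q\<^esub>}"
    proof (rule Q.npi_res_least[OF Q.triv_subgroup])
      fix c d p assume cd: "prime p" "p \<notin> \<pi>" "Q.pi_elem {p} c" "Q.pi_elem (-{p}) d"
      obtain x where x: "x \<in> L" "pi_elem {p} x" "c = M #> x" using pi_elem_quotient_lift[OF M cd(3)] by blast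
      obtain y where y: "y \<in> L" "pi_elem (-{p}) y" "d = M #> y" using pi_elem_quotient_lift[OF M cd(4)] by blast
      have "commut x y \<in> M" using npi_res_commut[OF x(1) y(1) cd(1,2) x(2) y(2)] a by blast
      thus "Q.commut c d \<in> {\<one>\<^bsub>?Q\<^esub>}" using cmQ[OF x(1) y(1)] x y by blast
    qed
  qed
qed

text \<open>Descent along a central series: a commutator in \<open>Z (Suc i)\<close> is central
  modulo \<open>Z i\<close>, so \<open>central_commut_one\<close> puts it into
  \<open>Z i\<close>.\<close>

lemma nilpotent_commute:
  assumes N: "nilpotent_group G" and x: "pi_elem {p} x" and y: "pi_elem (-{p}) y"
  shows "commut x y = \<one>"
proof -
  obtain n Z where Z: "Z 0 = {\<one>}" "Z n = carrier G"
    "\<forall>i<n. Z i \<lhd> G \<and> Z i \<subseteq> Z (Suc i) \<and> (\<forall>x\<in>Z (Suc i). \<forall>g\<in>carrier G. x \<otimes> g \<otimes> inv x \<otimes> inv g \<in> Z i)"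
    using N unfolding nilpotent_group_def by blast
  have c: "x \<in> carrier G" "y \<in> carrier G" using x y pi_elem_carrier by blast+
  have "commut x y \<in> Z (n - k)" if "k \<le> n" for k
    using that
  proof (induction k)
    case 0 thus ?case using Z c by simp
  next
    case (Suc k)
    let ?i = "n - Suc k"
    have i: "?i < n" "Suc ?i = n - k" using Suc by auto
    have M: "normal_in (Z ?i) (carrier G)" using Z(3) i normal_iff_normal_in_carrier by blast
    note q = quotient_context[OF M]
    let ?Q = "G\<lparr>carrier := carrier G\<rparr> Mod Z ?i"
    interpret Q: fin_group ?Q by (rule q(1))
    have sM: "subgroup (Z ?i) G" using M by (simp add: normal_in_def)
    have gL: "group (G\<lparr>carrier := carrier G\<rparr>)" by simp
    have commut_Q: "Z ?i #> commut x y = Q.commut (Z ?i #> x) (Z ?i #> y)" using quotient_commut[OF M c] .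
    have e: "Q.pi_elem {p} (Z ?i #> x)" "Q.pi_elem (-{p}) (Z ?i #> y)"
      using pi_elem_hom[OF gL Q.is_group quotient_hom[OF M]] x y by auto
    then obtain a b where ab: "pi_num {p} a" "(Z ?i #> x) [^]\<^bsub>?Q\<^esub> a = \<one>\<^bsub>?Q\<^esub>" "pi_num (-{p}) b" "(Z ?i #> y) [^]\<^bsub>?Q\<^esub> b = \<one>\<^bsub>?Q\<^esub>"
      unfolding Q.pi_elem_def by blast
    have "Q.commut (Z ?i #> x) (Z ?i #> y) = \<one>\<^bsub>?Q\<^esub>"
    proof (rule Q.central_commut_one[OF q(2)[OF c(1)] q(2)[OF c(2)] ab(2,4) pi_num_coprime[OF ab(1,3)]])
      fix d assume "d \<in> carrier ?Q"
      then obtain g where g: "g \<in> carrier G" "d = Z ?i #> g" using q(3) by blast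
      have z: "commut x y \<in> Z (Suc ?i)" "commut x y \<in> carrier G" using Suc i c by auto
      hence "commut x y \<otimes> g \<otimes> inv (commut x y) \<otimes> inv g \<in> Z ?i" using Z(3) i g by blast
      hence "(commut x y \<otimes> g) \<otimes> inv (g \<otimes> commut x y) \<in> Z ?i" using z g by (simp add: inv_mult_group m_assoc)
      hence "Z ?i #> (commut x y \<otimes> g) = Z ?i #> (g \<otimes> commut x y)" using coset_eq_iff[OF sM] z g by simp
      thus "Q.commut (Z ?i #> x) (Z ?i #> y) \<otimes>\<^bsub>?Q\<^esub> d = d \<otimes>\<^bsub>?Q\<^esub> Q.commut (Z ?i #> x) (Z ?i #> y)"
        using q(4)[OF z(2) g(1)] q(4)[OF g(1) z(2)] g(2) commut_Q by (simp del: mult_FactGroup)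
    qed
    thus ?case using commut_Q q(6)[of "commut x y"] c by simp
  qed
  from this[of n] show ?thesis using Z by simp
qed

text \<open>For empty \<pi> the residual is the nilpotent one. The normal Sylow q-subgroup of B/M
  has a nontrivial centre, which the q'-elements centralize as well, so it is central in B/M by
  \<open>gen_q\<close>.\<close>

lemma ex_rel_central:
  assumes M: "normal_in M B" "M \<noteq> B" and R: "npi_res {} B \<subseteq> M"
  shows "\<exists>z\<in>B. z \<notin> M \<and> (\<forall>n\<in>B. commut z n \<in> M)"
proof -
  have s: "subgroup M G" "subgroup B G" "M \<subseteq> B" using M by (auto simp: normal_in_def)
  have "index B M \<noteq> 1" using index_1[OF s] M by blast
  then obtain q where q: "prime q" "q dvd index B M" by (metis prime_factor_nat)
  obtain P where P: "sylow_in q B P" using sylow_in_ex[OF q(1) s(2)] by blast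
  have sP: "subgroup P G" "P \<subseteq> B" using P by (auto simp: sylow_in_def)
  have q0: "q \<notin> {}" by simp
  note J = normal_in_sylow_join[OF M(1) R q(1) q0 P]
  note j = normal_in_join[OF M(1) sP]
  have "M \<noteq> M <#> P"
  proof
    assume "M = M <#> P"
    hence "pi_num (-{q}) (index B M)" using J(3) by simp
    thus False using q by (auto simp: pi_num_def)
  qed
  then obtain z where z: "z \<in> M <#> P" "z \<notin> M" "\<forall>n\<in>M <#> P. commut z n \<in> M" using rel_center[OF q(1) j(6) _ J(2)] by blast
  have zB: "z \<in> B" using z j by blast
  define C where "C = {x \<in> B. \<forall>r\<in>{z}. commut r x \<in> M}"
  have "C = B"
  proof (rule gen_q[OF _ s(2) _ P _ q(1)])
    show "subgroup C G" unfolding C_def using subgroup_rel_centralizer[OF M(1), of "{z}"] zB by simp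
    show "C \<subseteq> B" by (auto simp: C_def)
    show "P \<subseteq> C" using z(3) j(4) sP by (auto simp: C_def)
    show "y \<in> C" if "y \<in> B" "pi_elem (-{q}) y" for y
      using sylow_join_commutes[OF M(1) R q(1) q0 P z(1) that] that by (simp add: C_def)
  qed
  hence "\<forall>n\<in>B. commut z n \<in> M" by (auto simp: C_def)
  thus ?thesis using zB z by blast
qed

text \<open>\<open>Z\<close> is the upper central series, \<open>nx M\<close> being the preimage of
  the centre of G/M.\<close>

lemma nilpotentI:
  assumes R: "npi_res {} (carrier G) \<subseteq> {\<one>}"
  shows "nilpotent_group G"
proof -
  let ?L = "carrier G"
  define nx where "nx M = {z \<in> ?L. \<forall>n\<in>?L. commut z n \<in> M}" for M
  define Z where "Z i = (nx ^^ i) {\<one>}" for i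
  have step: "normal_in (nx M) ?L \<and> M \<subseteq> nx M" if "normal_in M ?L" for M
    using normal_in_rel_center[OF that normal_in_self[OF subgroup_self] that] commut_normal_in(1)[OF that] normal_in_subgroup(3)[OF that]
    by (auto simp: nx_def)
  have Z0: "Z 0 = {\<one>}" and ZS: "\<And>i. Z (Suc i) = nx (Z i)" by (auto simp: Z_def)
  have nZ: "normal_in (Z i) ?L" for i
    by (induction i) (use step normal_in_one[OF subgroup_self] in \<open>auto simp: Z0 ZS\<close>)
  \<comment> \<open>Each strict step gains at least one element, so the series reaches the top after
    at most \<open>card ?L\<close> steps.\<close>
  have grow: "Z i = ?L \<or> i < card (Z i)" for i
  proof (induction i)
    case 0 thus ?case by (simp add: Z0)
  next
    case (Suc i)
    show ?case
    proof (cases "Z i = ?L")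
      case True
      thus ?thesis using step[OF nZ[of i]] normal_in_subgroup(3)[OF nZ[of "Suc i"]] by (auto simp: ZS)
    next
      case False
      have "npi_res {} ?L \<subseteq> Z i" using R subgroup.one_closed[OF normal_in_subgroup(1)[OF nZ[of i]]] by blast
      then obtain z where "z \<in> ?L" "z \<notin> Z i" "\<forall>n\<in>?L. commut z n \<in> Z i" using ex_rel_central[OF nZ False] by blast
      hence "z \<in> Z (Suc i)" "z \<notin> Z i" by (auto simp: ZS nx_def)
      hence "Z i \<subset> Z (Suc i)" using step[OF nZ[of i]] by (auto simp: ZS)
      hence "card (Z i) < card (Z (Suc i))" using normal_in_subgroup(1)[OF nZ[of "Suc i"]] by (intro psubset_card_mono) auto
      thus ?thesis using Suc False by auto
    qed
  qed
  have "Z (card ?L) = ?L"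
  proof -
    have "card (Z (card ?L)) \<le> card ?L" using normal_in_subgroup(3)[OF nZ] by (intro card_mono) auto
    thus ?thesis using grow[of "card ?L"] by auto
  qed
  moreover have "Z i \<lhd> G \<and> Z i \<subseteq> Z (Suc i) \<and> (\<forall>x\<in>Z (Suc i). \<forall>g\<in>?L. x \<otimes> g \<otimes> inv x \<otimes> inv g \<in> Z i)" for i
  proof (intro conjI ballI)
    show "Z i \<lhd> G" using nZ normal_iff_normal_in_carrier by blast
    show "Z i \<subseteq> Z (Suc i)" using step[OF nZ] by (simp add: ZS)
    fix x g assume xg: "x \<in> Z (Suc i)" "g \<in> ?L"
    have "inv x \<in> Z (Suc i)" using subgroup.m_inv_closed[OF normal_in_subgroup(1)[OF nZ] xg(1)] .
    hence "commut (inv x) (inv g) \<in> Z i" using xg by (simp add: ZS nx_def)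
    moreover have "x \<in> ?L" using xg by (simp add: ZS nx_def)
    ultimately show "x \<otimes> g \<otimes> inv x \<otimes> inv g \<in> Z i" using xg by (simp add: commut_def)
  qed
  ultimately show ?thesis unfolding nilpotent_group_def using Z0 by blast
qed

text \<open>In a direct product H x K, a q-element with q outside \<pi> has trivial component in the
  \<pi>-group H, and in the nilpotent K it commutes with q'-elements. Conversely, the subgroups
  generated by the \<pi>- and by the \<pi>'-elements have coprime orders and centralize each
  other.\<close>

lemma npi_group_iff: "npi_group \<pi> G \<longleftrightarrow> npi_res \<pi> (carrier G) \<subseteq> {\<one>}"
proof
  assume "npi_group \<pi> G"
  then obtain H K :: "'a monoid" where HK: "pi_group \<pi> H" "pi_group (prime_compl \<pi>) K" "nilpotent_group K"
    "G \<cong> H \<times>\<times> K" unfolding npi_group_def by blast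
  then obtain f where f: "f \<in> iso G (H \<times>\<times> K)" by (auto simp: is_iso_def)
  interpret H: fin_group H using HK(1) by (intro fin_group.intro fin_group_axioms.intro) (auto simp: pi_group_def)
  interpret K: fin_group K using HK(2) by (intro fin_group.intro fin_group_axioms.intro) (auto simp: pi_group_def)
  have fh: "f \<in> hom G (H \<times>\<times> K)" and inj: "inj_on f (carrier G)" using f by (auto simp: iso_def bij_betw_def)
  have f1: "(\<lambda>x. fst (f x)) \<in> hom G H" and f2: "(\<lambda>x. snd (f x)) \<in> hom G K"
    using fh by (auto simp: hom_def Pi_iff DirProd_def split: prod.splits)
  show "npi_res \<pi> (carrier G) \<subseteq> {\<one>}"
  proof (rule npi_res_least[OF triv_subgroup])
    fix x y p assume xy: "x \<in> carrier G" "y \<in> carrier G" "prime p" "p \<notin> \<pi>" "pi_elem {p} x" "pi_elem (-{p}) y"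
    have "H.pi_elem {p} (fst (f x))" using pi_elem_hom[OF is_group H.is_group f1 xy(5)] .
    then obtain n where n: "pi_num {p} n" "fst (f x) [^]\<^bsub>H\<^esub> n = \<one>\<^bsub>H\<^esub>" "fst (f x) \<in> carrier H" by (auto simp: H.pi_elem_def)
    have "pi_num \<pi> (order H)" using HK(1) H.order_gt_0_iff_finite by (auto simp: pi_group_def pi_num_def)
    moreover have "pi_num (-\<pi>) n" using n(1) xy(4) by (auto elim!: pi_num_mono)
    ultimately have "coprime n (order H)" using pi_num_coprime[of \<pi> "order H" n] by (simp add: coprime_commute)
    hence h1: "fst (f x) = \<one>\<^bsub>H\<^esub>"
      using H.pow_coprime_in[OF H.triv_subgroup n(3), of n "order H"] n H.pow_order_eq_1[OF n(3)] by simp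
    have k: "snd (f x) \<in> carrier K" "snd (f y) \<in> carrier K" "fst (f y) \<in> carrier H"
      using f1 f2 xy by (auto simp: hom_def Pi_iff)
    have "K.commut (snd (f x)) (snd (f y)) = \<one>\<^bsub>K\<^esub>"
      using K.nilpotent_commute[OF HK(3)] pi_elem_hom[OF is_group K.is_group f2] xy by blast
    hence kc: "snd (f x) \<otimes>\<^bsub>K\<^esub> snd (f y) = snd (f y) \<otimes>\<^bsub>K\<^esub> snd (f x)" using K.comm_of_commut k by blast
    have "f (x \<otimes> y) = f (y \<otimes> x)"
    proof (rule prod_eqI)
      show "fst (f (x \<otimes> y)) = fst (f (y \<otimes> x))" using f1 xy h1 k by (simp add: hom_def)
      show "snd (f (x \<otimes> y)) = snd (f (y \<otimes> x))" using f2 xy kc by (simp add: hom_def)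
    qed
    hence "x \<otimes> y = y \<otimes> x" using inj xy by (auto dest: inj_onD)
    thus "commut x y \<in> {\<one>}" using commut_one_iff xy by simp
  qed
next
  assume R: "npi_res \<pi> (carrier G) \<subseteq> {\<one>}"
  let ?L = "carrier G"
  have n1: "normal_in {\<one>} ?L" using normal_in_one[OF subgroup_self] .
  define J where "J = pi_hull \<pi> {\<one>} ?L"
  define B where "B = pi_hull (-\<pi>) {\<one>} ?L"
  note OJ = pi_hull_normal_in[OF n1, where \<sigma> = \<pi>, folded J_def]
  note OB = pi_hull_normal_in[OF n1, where \<sigma> = "-\<pi>", folded B_def]
  have sJ: "subgroup J G" and sB: "subgroup B G" using OJ OB by (auto simp: normal_in_def)
  have Jc: "J \<subseteq> ?L" and Bc: "B \<subseteq> ?L" using sJ sB by (auto dest: subgroup.subset)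
  have pJ: "pi_num \<pi> (card J)" and pB: "pi_num (-\<pi>) (card B)"
    using pi_hull_pi[OF n1 R] pi_hull_pi'[OF n1 R] by (simp_all add: J_def B_def index_def)
  have JB: "J \<inter> B = {\<one>}"
  proof -
    have i: "subgroup (J \<inter> B) G" using sJ sB subgroups_Inter_pair by blast
    have "card (J \<inter> B) dvd card J" "card (J \<inter> B) dvd card B" using i sJ sB by (auto intro!: card_dvd)
    hence "card (J \<inter> B) = 1" using pJ pB pi_num_both pi_num_dvd by meson
    then obtain u where "J \<inter> B = {u}" by (auto simp: card_1_singleton_iff)
    moreover have "\<one> \<in> J \<inter> B" using subgroup.one_closed[OF i] .
    ultimately show ?thesis by (metis singletonD)
  qed
  have comm: "j \<otimes> b = b \<otimes> j" if "j \<in> J" "b \<in> B" for j b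
  proof -
    have "commut j b \<in> J" "commut j b \<in> B" using commut_normal_in(1)[OF OJ(1) that(1)] commut_normal_in(2)[OF OB(1) that(2)] that Jc Bc by auto
    thus ?thesis using JB comm_of_commut that Jc Bc by blast
  qed
  \<comment> \<open>\<open>npi_group\<close> asks for factors of type \<open>'a monoid\<close>
    without record extension, so the subgroups are repackaged.\<close>
  define H :: "'a monoid" where "H = \<lparr>carrier = J, monoid.mult = monoid.mult G, one = \<one>\<rparr>"
  define K :: "'a monoid" where "K = \<lparr>carrier = B, monoid.mult = monoid.mult G, one = \<one>\<rparr>"
  have mk: "group \<lparr>carrier = X, monoid.mult = monoid.mult G, one = \<one>\<rparr>" if X: "subgroup X G" for X
  proof (rule groupI)
    fix x assume "x \<in> carrier \<lparr>carrier = X, monoid.mult = monoid.mult G, one = \<one>\<rparr>"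
    hence "x \<in> X" by simp
    thus "\<exists>y\<in>carrier \<lparr>carrier = X, monoid.mult = monoid.mult G, one = \<one>\<rparr>. y \<otimes>\<^bsub>\<lparr>carrier = X, monoid.mult = monoid.mult G, one = \<one>\<rparr>\<^esub> x = \<one>\<^bsub>\<lparr>carrier = X, monoid.mult = monoid.mult G, one = \<one>\<rparr>\<^esub>"
      using X by (intro bexI[of _ "inv x"]) (auto simp: sub_carr subgroup.m_inv_closed)
  qed (use X in \<open>auto simp: subgroup.m_closed subgroup.one_closed m_assoc sub_carr\<close>)
  interpret H: fin_group H using mk[OF sJ] sJ by (intro fin_group.intro fin_group_axioms.intro) (auto simp: H_def)
  interpret K: fin_group K using mk[OF sB] sB by (intro fin_group.intro fin_group_axioms.intro) (auto simp: K_def)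
  have pH: "pi_group \<pi> H" using pJ H.is_group H.finite_carrier by (auto simp: pi_group_def H_def order_def pi_num_def)
  have pK: "pi_group (prime_compl \<pi>) K" using pB K.is_group K.finite_carrier by (auto simp: pi_group_def K_def order_def pi_num_def prime_compl_def)
  have idK: "(\<lambda>x. x) \<in> hom K G" using Bc by (auto simp: hom_def K_def)
  have "K.npi_res {} (carrier K) \<subseteq> {\<one>\<^bsub>K\<^esub>}"
  proof (rule K.npi_res_least[OF K.triv_subgroup])
    fix x y p assume xy: "x \<in> carrier K" "y \<in> carrier K" "prime p" "K.pi_elem {p} x" "K.pi_elem (-{p}) y"
    have e: "pi_elem {p} x" "pi_elem (-{p}) y" using pi_elem_hom[OF K.is_group is_group idK] xy by auto
    have B: "x \<in> B" "y \<in> B" "x \<in> ?L" "y \<in> ?L" using xy Bc by (auto simp: K_def)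
    have "x \<otimes> y = y \<otimes> x"
    proof (cases "p \<in> \<pi>")
      case True
      hence "pi_elem \<pi> x" using e(1) by (auto elim!: pi_elem_mono)
      hence "x \<in> J \<inter> B" using OJ(3) B by blast
      hence "x = \<one>" using JB by blast
      thus ?thesis using B by simp
    next
      case False
      hence "commut x y \<in> npi_res \<pi> ?L" using npi_res_commut[OF B(3,4) xy(3)] e by blast
      thus ?thesis using R comm_of_commut B by blast
    qed
    hence "x \<otimes>\<^bsub>K\<^esub> y = y \<otimes>\<^bsub>K\<^esub> x" by (simp add: K_def)
    thus "K.commut x y \<in> {\<one>\<^bsub>K\<^esub>}" using K.commut_one_iff xy by simp
  qed
  hence nK: "nilpotent_group K" by (rule K.nilpotentI)
  have "(\<lambda>(j, b). j \<otimes> b) \<in> iso (H \<times>\<times> K) G"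
  proof (rule isoI)
    show "(\<lambda>(j, b). j \<otimes> b) \<in> hom (H \<times>\<times> K) G"
    proof (rule homI)
      fix u v assume "u \<in> carrier (H \<times>\<times> K)" "v \<in> carrier (H \<times>\<times> K)"
      then obtain j b j' b' where u: "u = (j, b)" "v = (j', b')" "j \<in> J" "b \<in> B" "j' \<in> J" "b' \<in> B"
        by (auto simp: DirProd_def H_def K_def)
      have c: "j \<in> ?L" "b \<in> ?L" "j' \<in> ?L" "b' \<in> ?L" using u Jc Bc by auto
      have "j \<otimes> j' \<otimes> (b \<otimes> b') = j \<otimes> (j' \<otimes> b) \<otimes> b'" using c by (simp add: m_assoc)
      also have "\<dots> = j \<otimes> b \<otimes> (j' \<otimes> b')" using c comm[OF u(5,4)] by (simp add: m_assoc)
      finally show "(\<lambda>(j, b). j \<otimes> b) (u \<otimes>\<^bsub>H \<times>\<times> K\<^esub> v) = (\<lambda>(j, b). j \<otimes> b) u \<otimes> (\<lambda>(j, b). j \<otimes> b) v"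
        using u by (simp add: H_def K_def)
    qed (use Jc Bc in \<open>auto simp: DirProd_def H_def K_def\<close>)
    show "bij_betw (\<lambda>(j, b). j \<otimes> b) (carrier (H \<times>\<times> K)) ?L"
      unfolding bij_betw_def
    proof
      show "inj_on (\<lambda>(j, b). j \<otimes> b) (carrier (H \<times>\<times> K))"
      proof (rule inj_onI, clarsimp simp: DirProd_def H_def K_def)
        fix j b j' b' assume a: "j \<in> J" "b \<in> B" "j' \<in> J" "b' \<in> B" "j \<otimes> b = j' \<otimes> b'"
        have c: "j \<in> ?L" "b \<in> ?L" "j' \<in> ?L" "b' \<in> ?L" using a Jc Bc by auto
        have "inv j' \<otimes> j = inv j' \<otimes> (j \<otimes> b) \<otimes> inv b" using c by (simp add: m_assoc)
        also have "\<dots> = b' \<otimes> inv b" using c a(5) by (simp add: m_assoc)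
        finally have e: "inv j' \<otimes> j = b' \<otimes> inv b" .
        hence "inv j' \<otimes> j \<in> J \<inter> B" using a sJ sB by (simp add: subgroup.m_closed subgroup.m_inv_closed) (metis subgroup.m_closed subgroup.m_inv_closed)
        hence "inv j' \<otimes> j = \<one>" "b' \<otimes> inv b = \<one>" using JB e by auto
        thus "j = j' \<and> b = b'" using c by (metis inv_cancel(2) inv_inv inv_closed l_inv r_one inv_equality)
      qed
      have "x \<in> (\<lambda>(j, b). j \<otimes> b) ` carrier (H \<times>\<times> K)" if x: "x \<in> ?L" for x
      proof -
        obtain a b where ab: "pi_elem \<pi> a" "pi_elem (-\<pi>) b" "a \<in> ?L" "b \<in> ?L" "x = a \<otimes> b" using pi_elem_split[OF subgroup_self x] by blast
        have "(a, b) \<in> carrier (H \<times>\<times> K)" using OJ(3) OB(3) ab by (simp add: DirProd_def H_def K_def)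
        thus ?thesis using ab(5) by force
      qed
      moreover have "(\<lambda>(j, b). j \<otimes> b) ` carrier (H \<times>\<times> K) \<subseteq> ?L" using Jc Bc by (auto simp: DirProd_def H_def K_def)
      ultimately show "(\<lambda>(j, b). j \<otimes> b) ` carrier (H \<times>\<times> K) = ?L" by blast
    qed
  qed
  hence "H \<times>\<times> K \<cong> G" by (auto simp: is_iso_def)
  hence "G \<cong> H \<times>\<times> K" using group.iso_sym[OF DirProd_group[OF H.is_group K.is_group]] by blast
  thus "npi_group \<pi> G" unfolding npi_group_def using pH pK nK is_group by blast
qed

lemma npi_quotient:
  assumes "normal_in M L" shows "npi_group \<pi> (G\<lparr>carrier := L\<rparr> Mod M) \<longleftrightarrow> npi_res \<pi> L \<subseteq> M"
  using fin_group.npi_group_iff[OF quotient_context(1)[OF assms]] npi_res_quotient[OF assms] by metis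

lemma residual_eq: assumes L: "subgroup L G" shows "residual (npi_group \<pi>) (G\<lparr>carrier := L\<rparr>) = npi_res \<pi> L"
  unfolding residual_def
proof (rule Least_equality)
  show "npi_res \<pi> L \<lhd> G\<lparr>carrier := L\<rparr> \<and> npi_group \<pi> (G\<lparr>carrier := L\<rparr> Mod npi_res \<pi> L)"
    using normal_iff_normal_in[OF L] npi_quotient normal_in_npi_res[OF L] by blast
  show "npi_res \<pi> L \<subseteq> N" if "N \<lhd> G\<lparr>carrier := L\<rparr> \<and> npi_group \<pi> (G\<lparr>carrier := L\<rparr> Mod N)" for N
    using normal_iff_normal_in[OF L] npi_quotient that by blast
qed

lemma Mod_carrier_eq: "(G Mod K)\<lparr>carrier := (\<lambda>x. K #> x) ` L\<rparr> = G\<lparr>carrier := L\<rparr> Mod K"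
  unfolding FactGroup_def RCOSETS_def by (simp add: UNION_singleton_eq_range fun_eq_iff set_mult_def)

text \<open>If L contains P and L/K belongs to the class, then the residual of L lies in K and the
  covering property gives L inside \<open>P <#> K\<close>.\<close>

lemma covering_projector: assumes P: "covering \<pi> P (carrier G)" shows "projector (npi_group \<pi>) G P"
  unfolding projector_def
proof (intro conjI allI impI)
  note p = covD[OF P]
  show "subgroup P G" by (rule p)
  fix K assume "K \<lhd> G"
  hence K: "normal_in K (carrier G)" using normal_iff_normal_in_carrier by blast
  have sK: "subgroup K G" using K by (simp add: normal_in_def)
  note j = normal_in_join[OF K p(1,3)]
  let ?U = "P <#> K"
  have U: "?U = K <#> P" by (rule j(2))
  have sU: "subgroup ?U G" "K \<subseteq> ?U" "P \<subseteq> ?U" "?U \<subseteq> carrier G" unfolding U using j by auto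
  have nU: "normal_in K ?U" unfolding U by (rule j(6))
  have cU: "carrier (G\<lparr>carrier := ?U\<rparr> Mod K) = (\<lambda>x. K #> x) ` ?U" by (auto simp: carrier_FactGroup)
  show "class_maximal (npi_group \<pi>) (G Mod K) (carrier (G\<lparr>carrier := ?U\<rparr> Mod K))"
    unfolding class_maximal_def cU
  proof (intro conjI allI impI)
    show "subgroup ((\<lambda>x. K #> x) ` ?U) (G Mod K)"
      using quotient_image[OF K sU(1,4)] by simp
    have "npi_res \<pi> (K <#> P) \<subseteq> K <#> npi_res \<pi> P" using npi_res_join[OF K p(1,3)] .
    hence "npi_res \<pi> ?U \<subseteq> K" using p(4) sK U by (simp add: set_mult_one subgroup.subset)
    thus "npi_group \<pi> ((G Mod K)\<lparr>carrier := (\<lambda>x. K #> x) ` ?U\<rparr>)" unfolding Mod_carrier_eq using npi_quotient[OF nU] by blast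
    fix L' assume L': "subgroup L' (G Mod K)" "npi_group \<pi> ((G Mod K)\<lparr>carrier := L'\<rparr>)" "(\<lambda>x. K #> x) ` ?U \<subseteq> L'"
    define L where "L = {x \<in> carrier G. K #> x \<in> L'}"
    have sL: "subgroup L G" using quotient_subgroup[OF K] L'(1) by (simp add: L_def)
    have PL: "P \<subseteq> L" "K \<subseteq> L" using L'(3) sU by (auto simp: L_def)
    have "L' \<subseteq> carrier (G Mod K)" using L'(1) by (rule subgroup.subset)
    hence Le: "L' = (\<lambda>x. K #> x) ` L" by (auto simp: L_def carrier_FactGroup)
    have nL: "normal_in K L" using normal_in_sub[OF K sL PL(2)] by (auto simp: L_def)
    have "npi_res \<pi> L \<subseteq> K" using L'(2) unfolding Le Mod_carrier_eq using npi_quotient[OF nL] by blast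
    hence "P <#> npi_res \<pi> L \<subseteq> ?U" by (intro mono_set_mult) auto
    hence "L \<subseteq> ?U" using p(5)[OF sL PL(1)] sL by (auto dest: subgroup.subset)
    thus "L' = (\<lambda>x. K #> x) ` ?U" using L'(3) Le by blast
  qed
qed

text \<open>\<open>pi_soluble\<close> only restricts factors of composition series, so one has to be
  produced before this hypothesis yields anything.\<close>

lemma ex_composition_series:
  "subgroup L G \<Longrightarrow> \<exists>n S. S 0 = {\<one>} \<and> S n = L \<and> (\<forall>i<n. S i \<lhd> G\<lparr>carrier := S (Suc i)\<rparr> \<and>
     simple_group (G\<lparr>carrier := S (Suc i)\<rparr> Mod S i))"
proof (induction "card L" arbitrary: L rule: less_induct)
  case less
  show ?case
  proof (cases "L = {\<one>}")
    case True thus ?thesis by (intro exI[of _ 0] exI[of _ "\<lambda>_. {\<one>}"]) auto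
  next
    case False
    obtain M where M: "normal_in M L" "M \<noteq> L" "\<forall>X. normal_in X L \<longrightarrow> M \<subseteq> X \<longrightarrow> X \<subseteq> L \<longrightarrow> X = M \<or> X = L"
      using ex_chief_below[OF normal_in_self[OF less.prems] False] by blast
    have sM: "subgroup M G" "M \<subseteq> L" using M by (auto simp: normal_in_def)
    have "card M < card L" using sM M less.prems by (intro psubset_card_mono) auto
    then obtain n S where S: "S 0 = {\<one>}" "S n = M" "\<forall>i<n. S i \<lhd> G\<lparr>carrier := S (Suc i)\<rparr> \<and>
     simple_group (G\<lparr>carrier := S (Suc i)\<rparr> Mod S i)" using less.hyps sM(1) by blast
    note q = quotient_context[OF M(1)]
    let ?Q = "G\<lparr>carrier := L\<rparr> Mod M"
    interpret Q: fin_group ?Q by (rule q(1))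
    have nM: "M \<lhd> G\<lparr>carrier := L\<rparr>" using M normal_iff_normal_in[OF less.prems] by blast
    interpret N: normal M "G\<lparr>carrier := L\<rparr>" by (rule nM)
    have "simple_group ?Q"
    proof (rule simple_group.intro[OF Q.is_group simple_group_axioms.intro])
      have "index L M \<noteq> 1" "index L M > 0" using index_1[OF sM(1) less.prems sM(2)] index_pos[OF sM(1) less.prems sM(2)] M by auto
      thus "order ?Q > 1" using order_Mod[OF M(1)] by simp
      fix H assume H: "H \<lhd> ?Q"
      have sH: "subgroup H ?Q" using H by (rule normal_imp_subgroup)
      have U: "\<Union>H = {x \<in> L. M #> x \<in> H}" using N.factgroup_subgroup_union_char[OF sH] by simp
      have "normal_in (\<Union>H) L" using N.factgroup_subgroup_union_normal[OF H] normal_iff_normal_in[OF less.prems] by blast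
      moreover have "M \<subseteq> \<Union>H" using subgroup.one_closed[OF sH] by auto
      ultimately have "\<Union>H = M \<or> \<Union>H = L" using M(3) by (auto simp: U)
      thus "H = carrier ?Q \<or> H = {\<one>\<^bsub>?Q\<^esub>}"
      proof
        assume a: "\<Union>H = M"
        have "c = \<one>\<^bsub>?Q\<^esub>" if c: "c \<in> H" for c
        proof -
          have "c \<in> carrier ?Q" using c sH by (rule subgroup.mem_carrier[rotated])
          then obtain x where x: "x \<in> L" "c = M #> x" using q(3) by blast
          hence "x \<in> \<Union>H" using c U by blast
          thus ?thesis using a q(6)[OF x(1)] x(2) by blast
        qed
        thus ?thesis using subgroup.one_closed[OF sH] by blast
      next
        assume a: "\<Union>H = L"
        have "carrier ?Q \<subseteq> H"
        proof
          fix c assume "c \<in> carrier ?Q"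
          then obtain x where x: "x \<in> L" "c = M #> x" using q(3) by blast
          hence "x \<in> {x \<in> L. M #> x \<in> H}" using a U by blast
          thus "c \<in> H" using x by simp
        qed
        thus ?thesis using subgroup.subset[OF sH] by blast
      qed
    qed
    thus ?thesis using S nM
      by (intro exI[of _ "Suc n"] exI[of _ "\<lambda>i. if i = Suc n then L else S i"]) (auto simp: less_Suc_eq)
  qed
qed

lemma npi_soluble_of_pi_soluble:
  assumes "pi_soluble (prime_compl \<pi>) G" shows "npi_soluble \<pi>"
proof -
  obtain n S where S: "S 0 = {\<one>}" "S n = carrier G" "\<forall>i<n. S i \<lhd> G\<lparr>carrier := S (Suc i)\<rparr> \<and>
     simple_group (G\<lparr>carrier := S (Suc i)\<rparr> Mod S i)" using ex_composition_series[OF subgroup_self] by blast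
  hence cnj_set: "composition_series G n S" by (simp add: composition_series_def)
  \<comment> \<open>Proved from the top downwards, since each term is only known to be normal in the
    next one.\<close>
  have sS: "subgroup (S (Suc i)) G" if "i < n" for i
    using that
  proof (induction "n - Suc i" arbitrary: i)
    case 0 hence "Suc i = n" by simp
    thus ?case using S subgroup_self by simp
  next
    case (Suc k)
    hence "subgroup (S (Suc (Suc i))) G" by (intro Suc.hyps(1)) auto
    moreover have "S (Suc i) \<lhd> G\<lparr>carrier := S (Suc (Suc i))\<rparr>" using S(3) Suc by auto
    ultimately show ?case using normal_iff_normal_in normal_in_subgroup(1) by blast
  qed
  have "normal_in (S i) (S (Suc i)) \<and>
     (pi_num \<pi> (index (S (Suc i)) (S i)) \<or> (\<exists>p. prime p \<and> p \<notin> \<pi> \<and> pi_num {p} (index (S (Suc i)) (S i))))" if i: "i < n" for i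
  proof
    show n: "normal_in (S i) (S (Suc i))" using S(3) i normal_iff_normal_in[OF sS[OF i]] by blast
    let ?Q = "G\<lparr>carrier := S (Suc i)\<rparr> Mod S i"
    have f: "composition_factor G ?Q" using cnj_set i by (auto simp: composition_factor_def)
    show "pi_num \<pi> (index (S (Suc i)) (S i)) \<or> (\<exists>p. prime p \<and> p \<notin> \<pi> \<and> pi_num {p} (index (S (Suc i)) (S i)))"
    proof (cases "pi_group (prime_compl \<pi>) ?Q")
      case True
      then obtain p where "p \<in> prime_compl \<pi>" "prime p" "pi_group {p} ?Q" using assms f unfolding pi_soluble_def by blast
      thus ?thesis using pi_group_Mod[OF n] by (auto simp: prime_compl_def)
    next
      case False
      hence "pi_group (prime_compl (prime_compl \<pi>)) ?Q" using assms f unfolding pi_soluble_def pi_separable_def by blast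
      hence "pi_num (prime_compl (prime_compl \<pi>)) (index (S (Suc i)) (S i))" using pi_group_Mod[OF n] by blast
      moreover have "prime_compl (prime_compl \<pi>) \<subseteq> \<pi>" by (auto simp: prime_compl_def)
      ultimately show ?thesis using pi_num_mono by blast
    qed
  qed
  thus ?thesis using S(1,2) unfolding npi_soluble_def by blast
qed

end

section \<open>Projectors and conjugacy of F-maximal subgroups\<close>

theorem lemma2p9:
  fixes G :: "('a, 'b) monoid_scheme"
    and \<pi> :: "nat set"
    and \<F> :: "'a set set"
    and K W V V\<^sub>1 :: "'a set"
  assumes "\<pi> \<subseteq> {p. Factorial_Ring.prime p}"
    and "group G"
    and "finite (carrier G)"
    and "pi_soluble (prime_compl \<pi>) G"
    and "npi_fitting_set \<pi> G \<F>"
    and "K \<lhd> G"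
    and "residual (npi_group \<pi>) G \<subseteq> K"
    and "F_maximal \<F> K W"
    and "F_maximal \<F> (carrier G) V"
    and "F_maximal \<F> (carrier G) V\<^sub>1"
    and "W \<subseteq> V"
    and "W \<subseteq> V\<^sub>1"
  shows "(W \<lhd> G\<lparr>carrier := K\<rparr> \<longrightarrow>
           (\<exists>P. projector (npi_group \<pi>) G P \<and> V = radical G \<F> (W <#>\<^bsub>G\<^esub> P)))
       \<and> (\<exists>x\<in>generate G (V \<union> V\<^sub>1). conj_set G V\<^sub>1 x = V)
       \<and> (\<exists>x\<in>residual (npi_group \<pi>) (G\<lparr>carrier := generate G (V \<union> V\<^sub>1)\<rparr>).
            conj_set G V\<^sub>1 x = V)"
proof -
  interpret fin_group G using assms(2,3) by (intro fin_group.intro fin_group_axioms.intro)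
  interpret npi_fitting G \<pi> \<F>
    using assms(1,5) npi_soluble_of_pi_soluble[OF assms(4)] by unfold_locales auto
  have K: "normal_in K (carrier G)" using assms(6) normal_iff_normal_in_carrier by blast
  have RK: "npi_res \<pi> (carrier G) \<subseteq> K" using assms(7) residual_eq[OF subgroup_self, of \<pi>] by simp
  note W = assms(8) and V = assms(9) and V1 = assms(10)
  have sV: "subgroup V G" "V \<in> \<F>" "subgroup V\<^sub>1 G" using Fmax_F V V1 by blast+
  define X where "X = generate G (V \<union> V\<^sub>1)"
  have sX: "subgroup X G" unfolding X_def
    using sV by (intro generate_is_subgroup) (auto simp: subgroup.subset)
  obtain x where x: "x \<in> npi_res \<pi> X" "cnj_set V\<^sub>1 x = V"
    using conj_prop_all[OF subgroup_self] K RK W V V1 assms(11,12) unfolding conj_prop_def X_def by blast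
  have "\<exists>P. projector (npi_group \<pi>) G P \<and> V = radical G \<F> (W <#>\<^bsub>G\<^esub> P)" if "W \<lhd> G\<lparr>carrier := K\<rparr>"
  proof -
    have sK: "subgroup K G" "K \<subseteq> carrier G" using K by (auto simp: normal_in_def)
    have WK: "normal_in W K" using that normal_iff_normal_in[OF sK(1)] by blast
    have sW: "subgroup W G" "W \<subseteq> K" "W \<in> \<F>" using Fmax_F W by blast+
    \<comment> \<open>A conjugate of W under G is again normal in K and in F, so it lies in W by
      uniqueness.\<close>
    have nW: "normal_in W (carrier G)"
    proof (rule nrmI[OF sW(1) subgroup_self])
      show "W \<subseteq> carrier G" using sW sK by blast
      fix g assume g: "g \<in> carrier G"
      have "normal_in (cnj_set W g) K" using normal_in_cnj_set_cnj_set[OF WK g] normal_in_cnj_set[OF K g] by simp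
      thus "cnj_set W g \<subseteq> W" using Fmax_normal_unique[OF W subset_refl WK F_cnj_set[OF sW(3) g]] by blast
    qed
    obtain P where P: "covering \<pi> P (carrier G)" "normal_in V (W <#>\<^bsub>G\<^esub> P)"
      using ex_covering[OF conj_prop_all K RK W nW V assms(11)] by blast
    have sC: "subgroup (W <#>\<^bsub>G\<^esub> P) G" "W <#>\<^bsub>G\<^esub> P \<subseteq> carrier G" using P(2) by (auto simp: normal_in_def subgroup.subset)
    \<comment> \<open>V is itself one of the subgroups N joined in the radical and contains all of
      them.\<close>
    have N: "N \<subseteq> V" if "N \<in> \<F>" "N \<lhd> G\<lparr>carrier := W <#>\<^bsub>G\<^esub> P\<rparr>" for N
      using Fmax_normal_unique[OF V sC(2) P(2) that(1)] that(2) normal_iff_normal_in[OF sC(1)] by blast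
    have "V \<lhd> G\<lparr>carrier := W <#>\<^bsub>G\<^esub> P\<rparr>" using P(2) normal_iff_normal_in[OF sC(1)] by blast
    hence "\<Union>{N \<in> \<F>. N \<lhd> G\<lparr>carrier := W <#>\<^bsub>G\<^esub> P\<rparr>} = V" using N sV by blast
    moreover have "generate G V = V" using generateI[OF sV(1), of V] by simp
    ultimately have "V = radical G \<F> (W <#>\<^bsub>G\<^esub> P)" by (simp add: radical_def)
    thus ?thesis using covering_projector[OF P(1)] by blast
  qed
  moreover have "x \<in> X" using x(1) npi_res_sub[OF sX] by blast
  ultimately show ?thesis using x residual_eq[OF sX, of \<pi>] unfolding X_def by auto
qed

end
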